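(* Let $n$ be a positive integer, $R'=\mathbb Q[x_1,x_2,x_3,x_4]$, $w=x_1^{n+1}-x_2^{n+1}+x_3^{n+1}-x_4^{n+1}$. Consider the graded $(R',w)$-factorizations $$C(\Gamma)=W(x_1,x_5;x_6,x_4)\otimes_{\mathbb Q[x_5,x_6]}W(x_3,x_6;x_5,x_2),\qquad C(\Gamma_1)=L^1_4\otimes_{\mathbb Q}L^3_2,\qquad C(\Gamma_2)=L^1_2\otimes_{\mathbb Q}L^3_4,$$ corresponding respectively to a square formed by two wide edges joined by two oriented edges marked $x_5,x_6$, to two arcs $4\to1$, $2\to3$, and to two arcs $2\to1$, $4\to3$. Then there is a direct sum decomposition in $\mathrm{hmf}_w$ $$C(\Gamma)\cong C(\Gamma_2)\oplus\Bigl(\bigoplus_{i=0}^{n-3}C(\Gamma_1)\langle1\rangle\{3-n+2i\}\Bigr).$$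
   Context: **Graded factorizations.** Let $R$ be a polynomial ring over $\mathbb Q$ in finitely many variables of degree $2$, $w\in R$ homogeneous of degree $2(n+1)$. $\{m\}$ shifts the grading of a graded module up by $m$. A graded $(R,w)$-factorization is a pair of free graded $R$-modules $M^0,M^1$ (possibly of infinite rank) with $R$-linear maps $M^0\xrightarrow{d}M^1\xrightarrow{d}M^0$ of degree $n+1$, $d^2=w$. Morphisms are pairs of degree $0$ maps commuting with $d$; $f,g$ are homotopic if $f-g=hd+dh$ with $h^i:M^i\to N^{i-1}$ of degree $-n-1$. $H(M)$ is the cohomology of $M/\mathfrak mM$, $\mathfrak m$ the ideal generated by the variables. $\mathrm{hmf}_w$ is the category of graded $(R,w)$-factorizations with $\dim_{\mathbb Q}H(M)<\infty$ and morphisms up to homotopy. $M\langle1\rangle^i=M^{i+1}$ with differential $-d$. If $R\subset S$ and $w\in R$, an $(S,w)$-factorization is regarded as an $(R,w)$-factorization. Tensor products have $d(m\otimes m')=dm\otimes m'+(-1)^im\otimes dm'$, $m\in M^i$. For homogeneous $a,b$ with $\deg a+\deg b=2n+2$, $\{a,b\}$ is $R\xrightarrow{a}R\{n+1-\deg a\}\xrightarrow{b}R$; $\{(a_i),(b_i)\}=\bigotimes_i\{a_i,b_i\}$. **Arcs and wide edges.** $L^i_j=\{\pi_{ij},x_i-x_j\}$ over $\mathbb Q[x_i,x_j]$, $\pi_{ij}=(x_i^{n+1}-x_j^{n+1})/(x_i-x_j)$. Let $g$ be the polynomial with $g(x+y,xy)=x^{n+1}+y^{n+1}$. For a wide edge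 with outgoing marks $y_1,y_2$ and incoming marks $y_3,y_4$, $$W(y_1,y_2;y_3,y_4)=\{(u_1,u_2),(y_1+y_2-y_3-y_4,\;y_1y_2-y_3y_4)\}\{-1\}$$ over $\mathbb Q[y_1,\dots,y_4]$, where $u_1=\frac{g(y_1+y_2,y_1y_2)-g(y_3+y_4,y_1y_2)}{y_1+y_2-y_3-y_4}$, $u_2=\frac{g(y_3+y_4,y_1y_2)-g(y_3+y_4,y_3y_4)}{y_1y_2-y_3y_4}$.
   Formalization: The formal statement assumes n ≥ 2 rather than n positive: for n = 1 the entry u_2 = −2 is a unit, so C(Γ) is contractible, while the direct sum is empty and C(Γ_2) has 4-dimensional cohomology, so the decomposition fails. *)

theory Defs
  imports
    Complex_Main
    "HOL-Library.Poly_Mapping"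
    "HOL-Library.Z2"
    "HOL-Algebra.Module"
    "HOL-Algebra.Ideal"
    "HOL-Algebra.Generated_Groups"
begin

section \<open>Graded polynomial rings over the rationals\<close>

text \<open>
  Polynomials in the variables \<open>x\<^sub>0, x\<^sub>1, \<dots>\<close> are finitely supported functions from exponent
  vectors to coefficients. The ring in the variables indexed by \<open>V\<close> is a subring of this type, so
  that for \<open>V \<subseteq> V'\<close> the inclusion of rings is an inclusion of sets.
\<close>

type_synonym qpoly = "(nat \<Rightarrow>\<^sub>0 nat) \<Rightarrow>\<^sub>0 rat"

definition X :: "nat \<Rightarrow> qpoly" where
  "X i = Poly_Mapping.single (Poly_Mapping.single i 1) 1"

definition Const :: "rat \<Rightarrow> qpoly" where
  "Const c = Poly_Mapping.single 0 c"

definition poly_ring :: "nat set \<Rightarrow> qpoly ring" where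
  "poly_ring V = \<lparr>carrier = {p. \<forall>m\<in>Poly_Mapping.keys p. Poly_Mapping.keys m \<subseteq> V}, mult = (*), one = 1, zero = 0, add = (+)\<rparr>"

text \<open>Every variable has degree 2.\<close>

definition mono_deg :: "(nat \<Rightarrow>\<^sub>0 nat) \<Rightarrow> int" where
  "mono_deg m = 2 * (\<Sum>i\<in>Poly_Mapping.keys m. int (Poly_Mapping.lookup m i))"

definition homogeneous :: "qpoly \<Rightarrow> int \<Rightarrow> bool" where
  "homogeneous p k \<longleftrightarrow> (\<forall>m\<in>Poly_Mapping.keys p. mono_deg m = k)"

text \<open>Only used for nonzero homogeneous polynomials.\<close>

definition poly_deg :: "qpoly \<Rightarrow> int" where
  "poly_deg p = Max (mono_deg ` Poly_Mapping.keys p)"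

definition irrelevant_ideal :: "nat set \<Rightarrow> qpoly set" where
  "irrelevant_ideal V = Idl\<^bsub>poly_ring V\<^esub> (X ` V)"

definition subst :: "(nat \<Rightarrow> qpoly) \<Rightarrow> qpoly \<Rightarrow> qpoly" where
  "subst \<sigma> p = (\<Sum>m\<in>Poly_Mapping.keys p. Const (Poly_Mapping.lookup p m) * (\<Prod>i\<in>Poly_Mapping.keys m. \<sigma> i ^ Poly_Mapping.lookup m i))"

text \<open>The quotient \<open>p / q\<close>, for \<open>q \<noteq> 0\<close> dividing \<open>p\<close>.\<close>

definition exact_quot :: "qpoly \<Rightarrow> qpoly \<Rightarrow> qpoly" where
  "exact_quot p q = (THE r. p = q * r)"

lemma exact_quot_eqI:
  assumes "q \<noteq> 0" "p = q * r"
  shows "exact_quot p q = r"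
  unfolding exact_quot_def using assms by (intro the_equality) auto


section \<open>Graded free modules\<close>

record 'm gmodule = "(qpoly, 'm) module" +
  grade :: "int \<Rightarrow> 'm set"

definition is_graded :: "nat set \<Rightarrow> 'm gmodule \<Rightarrow> bool" where
  "is_graded V M \<longleftrightarrow>
     (\<forall>k. additive_subgroup (grade M k) M) \<and>
     (\<forall>k l. \<forall>r\<in>carrier (poly_ring V). \<forall>x\<in>grade M l.
        homogeneous r k \<longrightarrow> r \<odot>\<^bsub>M\<^esub> x \<in> grade M (k + l)) \<and>
     (\<forall>x\<in>carrier M. \<exists>!c. (\<forall>k. c k \<in> grade M k) \<and> finite {k. c k \<noteq> \<zero>\<^bsub>M\<^esub>} \<and>
        x = (\<Oplus>\<^bsub>M\<^esub>k\<in>{k. c k \<noteq> \<zero>\<^bsub>M\<^esub>}. c k))"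

definition is_basis :: "nat set \<Rightarrow> 'm gmodule \<Rightarrow> 'm set \<Rightarrow> bool" where
  "is_basis V M B \<longleftrightarrow> B \<subseteq> carrier M \<and>
     (\<forall>x\<in>carrier M. \<exists>!c. (\<forall>b. c b \<in> carrier (poly_ring V)) \<and>
        finite {b. c b \<noteq> 0} \<and> {b. c b \<noteq> 0} \<subseteq> B \<and>
        x = (\<Oplus>\<^bsub>M\<^esub>b\<in>{b. c b \<noteq> 0}. c b \<odot>\<^bsub>M\<^esub> b))"

definition free_gmodule :: "nat set \<Rightarrow> 'm gmodule \<Rightarrow> bool" where
  "free_gmodule V M \<longleftrightarrow> Module.module (poly_ring V) M \<and> is_graded V M \<and>
     (\<exists>B. B \<subseteq> (\<Union>k. grade M k) \<and> is_basis V M B)"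

definition linear_map ::
  "nat set \<Rightarrow> 'm gmodule \<Rightarrow> 'k gmodule \<Rightarrow> ('m \<Rightarrow> 'k) \<Rightarrow> bool" where
  "linear_map V M N f \<longleftrightarrow> f \<in> carrier M \<rightarrow> carrier N \<and>
     (\<forall>x\<in>carrier M. \<forall>y\<in>carrier M. f (x \<oplus>\<^bsub>M\<^esub> y) = f x \<oplus>\<^bsub>N\<^esub> f y) \<and>
     (\<forall>r\<in>carrier (poly_ring V). \<forall>x\<in>carrier M. f (r \<odot>\<^bsub>M\<^esub> x) = r \<odot>\<^bsub>N\<^esub> f x)"

definition has_degree :: "'m gmodule \<Rightarrow> 'k gmodule \<Rightarrow> int \<Rightarrow> ('m \<Rightarrow> 'k) \<Rightarrow> bool" where
  "has_degree M N k f \<longleftrightarrow> (\<forall>l. f ` grade M l \<subseteq> grade N (l + k))"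


section \<open>Graded factorizations and the category \<open>hmf\<close>\<close>

text \<open>
  The type \<open>bit\<close> is the field with two elements; it indexes the two modules of a factorization,
  so that \<open>i + 1 = i - 1\<close> is the other index. The ground ring is not part of the data: regarding
  a factorization over a smaller ring leaves the record unchanged.
\<close>

record 'm factorization =
  module_at :: "bit \<Rightarrow> 'm gmodule"
  diff :: "bit \<Rightarrow> 'm \<Rightarrow> 'm"

definition graded_factorization ::
  "nat \<Rightarrow> nat set \<Rightarrow> qpoly \<Rightarrow> 'm factorization \<Rightarrow> bool" where
  "graded_factorization n V w M \<longleftrightarrow>
     finite V \<and> w \<in> carrier (poly_ring V) \<and> homogeneous w (2 * (int n + 1)) \<and>
     (\<forall>i. free_gmodule V (module_at M i) \<and>
          linear_map V (module_at M i) (module_at M (i + 1)) (diff M i) \<and>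
          has_degree (module_at M i) (module_at M (i + 1)) (int n + 1) (diff M i) \<and>
          (\<forall>x\<in>carrier (module_at M i). diff M (i + 1) (diff M i x) = w \<odot>\<^bsub>module_at M i\<^esub> x))"

definition morphism ::
  "nat set \<Rightarrow> 'm factorization \<Rightarrow> 'k factorization \<Rightarrow> (bit \<Rightarrow> 'm \<Rightarrow> 'k) \<Rightarrow> bool" where
  "morphism V M N f \<longleftrightarrow>
     (\<forall>i. linear_map V (module_at M i) (module_at N i) (f i) \<and>
          has_degree (module_at M i) (module_at N i) 0 (f i) \<and>
          (\<forall>x\<in>carrier (module_at M i). f (i + 1) (diff M i x) = diff N i (f i x)))"

definition homotopic ::
  "nat \<Rightarrow> nat set \<Rightarrow> 'm factorization \<Rightarrow> 'k factorization \<Rightarrow>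
   (bit \<Rightarrow> 'm \<Rightarrow> 'k) \<Rightarrow> (bit \<Rightarrow> 'm \<Rightarrow> 'k) \<Rightarrow> bool" where
  "homotopic n V M N f g \<longleftrightarrow>
     (\<exists>h. \<forall>i. linear_map V (module_at M i) (module_at N (i - 1)) (h i) \<and>
          has_degree (module_at M i) (module_at N (i - 1)) (- int n - 1) (h i) \<and>
          (\<forall>x\<in>carrier (module_at M i).
             f i x \<ominus>\<^bsub>module_at N i\<^esub> g i x =
             h (i + 1) (diff M i x) \<oplus>\<^bsub>module_at N i\<^esub> diff N (i - 1) (h i x)))"

text \<open>
  The complex \<open>M / \<mm>M\<close>: its cocycles and coboundaries are described by their preimages in \<open>M\<close>,
  so that \<open>H(M)\<close> in degree \<open>i\<close> is \<open>cocycles V M i\<close> modulo \<open>coboundaries V M i\<close>.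
\<close>

definition irrelevant_part :: "nat set \<Rightarrow> 'm gmodule \<Rightarrow> 'm set" where
  "irrelevant_part V M =
     generate (add_monoid M) {r \<odot>\<^bsub>M\<^esub> x | r x. r \<in> irrelevant_ideal V \<and> x \<in> carrier M}"

definition cocycles :: "nat set \<Rightarrow> 'm factorization \<Rightarrow> bit \<Rightarrow> 'm set" where
  "cocycles V M i =
     {x \<in> carrier (module_at M i). diff M i x \<in> irrelevant_part V (module_at M (i + 1))}"

definition coboundaries :: "nat set \<Rightarrow> 'm factorization \<Rightarrow> bit \<Rightarrow> 'm set" where
  "coboundaries V M i =
     {diff M (i - 1) y \<oplus>\<^bsub>module_at M i\<^esub> u | y u.
        y \<in> carrier (module_at M (i - 1)) \<and> u \<in> irrelevant_part V (module_at M i)}"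

definition finite_dim_cohomology :: "nat set \<Rightarrow> 'm factorization \<Rightarrow> bool" where
  "finite_dim_cohomology V M \<longleftrightarrow>
     (\<forall>i. \<exists>F. finite F \<and> F \<subseteq> cocycles V M i \<and>
        (\<forall>z\<in>cocycles V M i. \<exists>c :: 'm \<Rightarrow> rat.
           z \<ominus>\<^bsub>module_at M i\<^esub> (\<Oplus>\<^bsub>module_at M i\<^esub>b\<in>F. Const (c b) \<odot>\<^bsub>module_at M i\<^esub> b)
             \<in> coboundaries V M i))"

definition hmf_object :: "nat \<Rightarrow> nat set \<Rightarrow> qpoly \<Rightarrow> 'm factorization \<Rightarrow> bool" where
  "hmf_object n V w M \<longleftrightarrow> graded_factorization n V w M \<and> finite_dim_cohomology V M"

definition hmf_iso ::
  "nat \<Rightarrow> nat set \<Rightarrow> qpoly \<Rightarrow> 'm factorization \<Rightarrow> 'k factorization \<Rightarrow> bool" where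
  "hmf_iso n V w M N \<longleftrightarrow> hmf_object n V w M \<and> hmf_object n V w N \<and>
     (\<exists>f g. morphism V M N f \<and> morphism V N M g \<and>
        homotopic n V M M (\<lambda>i x. g i (f i x)) (\<lambda>i x. x) \<and>
        homotopic n V N N (\<lambda>i x. f i (g i x)) (\<lambda>i x. x))"


section \<open>Factorizations with a chosen homogeneous basis\<close>

text \<open>
  A factorization over the ring in the variables \<open>bvars\<close> given by a homogeneous basis of
  \<open>M\<^sup>0 \<oplus> M\<^sup>1\<close>, the parity and degree of each basis element, and the differential on the basis.
  Elements are finitely supported functions from the basis to polynomials.
\<close>

record 'b bfact =
  bvars :: "nat set"
  basis :: "'b set"
  par :: "'b \<Rightarrow> bit"
  bdeg :: "'b \<Rightarrow> int"
  bdiff :: "'b \<Rightarrow> 'b \<Rightarrow>\<^sub>0 qpoly"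

definition scale :: "qpoly \<Rightarrow> ('b \<Rightarrow>\<^sub>0 qpoly) \<Rightarrow> 'b \<Rightarrow>\<^sub>0 qpoly" where
  "scale p v = Poly_Mapping.map (\<lambda>c. p * c) v"

definition bmodule :: "'b bfact \<Rightarrow> bit \<Rightarrow> ('b \<Rightarrow>\<^sub>0 qpoly) gmodule" where
  "bmodule M i =
     (let C = {v. \<forall>b\<in>Poly_Mapping.keys v. b \<in> basis M \<and> par M b = i \<and>
                    Poly_Mapping.lookup v b \<in> carrier (poly_ring (bvars M))}
      in \<lparr>carrier = C, mult = undefined, one = undefined, zero = 0, add = (+), smult = scale,
          grade = (\<lambda>k. {v \<in> C. \<forall>b\<in>Poly_Mapping.keys v. homogeneous (Poly_Mapping.lookup v b) (k - bdeg M b)})\<rparr>)"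

definition fact_of :: "'b bfact \<Rightarrow> ('b \<Rightarrow>\<^sub>0 qpoly) factorization" where
  "fact_of M =
     \<lparr>module_at = bmodule M, diff = (\<lambda>i v. \<Sum>b\<in>Poly_Mapping.keys v. scale (Poly_Mapping.lookup v b) (bdiff M b))\<rparr>"

definition grade_shift :: "int \<Rightarrow> 'b bfact \<Rightarrow> 'b bfact" where
  "grade_shift m M = M\<lparr>bdeg := (\<lambda>b. bdeg M b + m)\<rparr>"

definition parity_shift :: "'b bfact \<Rightarrow> 'b bfact" where
  "parity_shift M = M\<lparr>par := (\<lambda>b. par M b + 1), bdiff := (\<lambda>b. - bdiff M b)\<rparr>"

definition elem_tensor ::
  "('b \<Rightarrow>\<^sub>0 qpoly) \<Rightarrow> ('c \<Rightarrow>\<^sub>0 qpoly) \<Rightarrow> ('b \<times> 'c) \<Rightarrow>\<^sub>0 qpoly" where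
  "elem_tensor u v =
     (\<Sum>b\<in>Poly_Mapping.keys u. \<Sum>c\<in>Poly_Mapping.keys v. Poly_Mapping.single (b, c) (Poly_Mapping.lookup u b * Poly_Mapping.lookup v c))"

text \<open>
  If \<open>M\<close> is free over \<open>A = \<rat>[V]\<close> with basis \<open>(e\<^sub>b)\<close> and \<open>N\<close> is free over \<open>B = \<rat>[V']\<close> with basis
  \<open>(e\<^sub>c)\<close>, then the tensor product of \<open>M\<close> and \<open>N\<close> over \<open>\<rat>[V \<inter> V']\<close> is free over
  \<open>A \<otimes> B = \<rat>[V \<union> V']\<close> with basis \<open>(e\<^sub>b \<otimes> e\<^sub>c)\<close>. For \<open>V = V'\<close> this is the tensor product over
  \<open>\<rat>[V]\<close>, for disjoint \<open>V\<close> and \<open>V'\<close> the one over \<open>\<rat>\<close>.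
\<close>

definition tensor :: "'b bfact \<Rightarrow> 'c bfact \<Rightarrow> ('b \<times> 'c) bfact" (infixl \<open>\<otimes>\<^sub>f\<close> 75) where
  "M \<otimes>\<^sub>f N =
     \<lparr>bvars = bvars M \<union> bvars N,
      basis = basis M \<times> basis N,
      par = (\<lambda>(b, c). par M b + par N c),
      bdeg = (\<lambda>(b, c). bdeg M b + bdeg N c),
      bdiff = (\<lambda>(b, c).
        elem_tensor (bdiff M b) (Poly_Mapping.single c 1) +
        scale (if par M b = 0 then 1 else - 1)
          (elem_tensor (Poly_Mapping.single b 1) (bdiff N c)))\<rparr>"

text \<open>
  In the direct sums all summands are meant to live over the same ring; the empty sum is the zero
  module.
\<close>

definition inject :: "('b \<Rightarrow> 'c) \<Rightarrow> ('b \<Rightarrow>\<^sub>0 qpoly) \<Rightarrow> 'c \<Rightarrow>\<^sub>0 qpoly" where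
  "inject \<phi> v = (\<Sum>b\<in>Poly_Mapping.keys v. Poly_Mapping.single (\<phi> b) (Poly_Mapping.lookup v b))"

definition dsum :: "'b bfact \<Rightarrow> 'c bfact \<Rightarrow> ('b + 'c) bfact" (infixl \<open>\<oplus>\<^sub>f\<close> 65) where
  "M \<oplus>\<^sub>f N =
     \<lparr>bvars = bvars M \<union> bvars N,
      basis = basis M <+> basis N,
      par = case_sum (par M) (par N),
      bdeg = case_sum (bdeg M) (bdeg N),
      bdiff = case_sum (\<lambda>b. inject Inl (bdiff M b)) (\<lambda>c. inject Inr (bdiff N c))\<rparr>"

definition dsum_family :: "'i set \<Rightarrow> ('i \<Rightarrow> 'b bfact) \<Rightarrow> ('i \<times> 'b) bfact" where
  "dsum_family I M =
     \<lparr>bvars = (\<Union>i\<in>I. bvars (M i)),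
      basis = (SIGMA i:I. basis (M i)),
      par = (\<lambda>(i, b). par (M i) b),
      bdeg = (\<lambda>(i, b). bdeg (M i) b),
      bdiff = (\<lambda>(i, b). inject (Pair i) (bdiff (M i) b))\<rparr>"

text \<open>
  The factorization \<open>{a, b}\<close>, that is \<open>R \<rightarrow> R{n + 1 - deg a} \<rightarrow> R\<close> with maps \<open>a\<close> and \<open>b\<close>, over the
  ring \<open>R\<close> in the variables \<open>V\<close>. The generator of \<open>R{m}\<close> has degree \<open>m\<close>.
\<close>

definition koszul :: "nat \<Rightarrow> nat set \<Rightarrow> qpoly \<Rightarrow> qpoly \<Rightarrow> bit bfact" where
  "koszul n V a b =
     \<lparr>bvars = V, basis = UNIV, par = (\<lambda>i. i),
      bdeg = (\<lambda>i. if i = 0 then 0 else int n + 1 - poly_deg a),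
      bdiff = (\<lambda>i. Poly_Mapping.single (i + 1) (if i = 0 then a else b))\<rparr>"


section \<open>Arcs and wide edges\<close>

definition arc :: "nat \<Rightarrow> nat \<Rightarrow> nat \<Rightarrow> bit bfact" where
  "arc n i j =
     koszul n {i, j} (exact_quot (X i ^ (n + 1) - X j ^ (n + 1)) (X i - X j)) (X i - X j)"

text \<open>The polynomial \<open>g\<close>, in the variables \<open>x\<^sub>1, x\<^sub>2\<close>, and its value \<open>g(s, p)\<close>.\<close>

definition g_poly :: "nat \<Rightarrow> qpoly" where
  "g_poly n = (THE g. g \<in> carrier (poly_ring {1, 2}) \<and>
     subst (\<lambda>i. if i = 1 then X 1 + X 2 else X 1 * X 2) g = X 1 ^ (n + 1) + X 2 ^ (n + 1))"

definition g_at :: "nat \<Rightarrow> qpoly \<Rightarrow> qpoly \<Rightarrow> qpoly" where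
  "g_at n s p = subst (\<lambda>i. if i = 1 then s else p) (g_poly n)"

text \<open>\<open>wide_edge n i\<^sub>1 i\<^sub>2 i\<^sub>3 i\<^sub>4\<close> has outgoing marks \<open>i\<^sub>1, i\<^sub>2\<close> and incoming marks \<open>i\<^sub>3, i\<^sub>4\<close>.\<close>

definition wide_edge :: "nat \<Rightarrow> nat \<Rightarrow> nat \<Rightarrow> nat \<Rightarrow> nat \<Rightarrow> (bit \<times> bit) bfact" where
  "wide_edge n i\<^sub>1 i\<^sub>2 i\<^sub>3 i\<^sub>4 =
     (let s = X i\<^sub>1 + X i\<^sub>2; p = X i\<^sub>1 * X i\<^sub>2;
          s' = X i\<^sub>3 + X i\<^sub>4; p' = X i\<^sub>3 * X i\<^sub>4;
          u\<^sub>1 = exact_quot (g_at n s p - g_at n s' p) (s - s');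
          u\<^sub>2 = exact_quot (g_at n s' p - g_at n s' p') (p - p');
          V = {i\<^sub>1, i\<^sub>2, i\<^sub>3, i\<^sub>4}
      in grade_shift (- 1) (koszul n V u\<^sub>1 (s - s') \<otimes>\<^sub>f koszul n V u\<^sub>2 (p - p')))"

definition C_square :: "nat \<Rightarrow> ((bit \<times> bit) \<times> (bit \<times> bit)) bfact" where
  "C_square n = wide_edge n 1 5 6 4 \<otimes>\<^sub>f wide_edge n 3 6 5 2"

definition C_arcs1 :: "nat \<Rightarrow> (bit \<times> bit) bfact" where
  "C_arcs1 n = arc n 1 4 \<otimes>\<^sub>f arc n 3 2"

definition C_arcs2 :: "nat \<Rightarrow> (bit \<times> bit) bfact" where
  "C_arcs2 n = arc n 1 2 \<otimes>\<^sub>f arc n 3 4"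

end

(*
  The square is the tensor product of four rows {a_i, b_i} over Q[x_1, ..., x_6]. The first row has
  b_1 = x_1 + x_5 - x_4 - x_6, and dividing by it replaces x_6 by x_1 + x_5 - x_4. Of the three
  remaining rows over R[x_5], R = Q[x_1, ..., x_4], the entry a_4 is up to a unit monic of degree
  n - 1 in x_5, so dividing by it leaves two rows over A = R[x_5]/(a_4), with
  b_2 = (x_1 - x_4) y and b_3 = x_1 + x_3 - x_2 - x_4, where y = x_5 - x_4. With respect to the
  R-bases 1, y, ..., y^(n-3), z and y, ..., y^(n-2), 1 of A, where y z lies in R, multiplication by y
  is diagonal with n - 2 entries 1 and one entry y z. Each entry 1 gives a copy of the factorization
  of Gamma_1; the last one gives that of Gamma_2, because modulo b_3 the potential is
  (x_1 - x_4) (x_3 - x_4) y z.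
*)
theory Submission
  imports Defs "HOL-Computational_Algebra.Polynomial"
begin

section \<open>Polynomials\<close>

text \<open>Over R = Q[x_1, ..., x_4] the square has infinite rank, and eliminating a row divides
  coefficients with remainder, which is linear over R only. So all maps are merely R-linear,
  finiteness of cohomology is proved for the target and carried back, and freeness over R uses
  monomials in the internal marks. The maps that identify the quotient left by an elimination need
  commute with the differentials only modulo a contractible part.

  The row divided out last survives through its odd generator. A copy of Gamma_1 keeps the roles of
  the two generators of the row {a_2, b_2} and is therefore shifted in parity. At the last diagonal
  entry, (x_1 - x_4) y z has degree 2n and equals P_34 - P_12 up to corrections, so the roles are
  exchanged and Gamma_2 appears unshifted.

  Diagonalising multiplication by y takes care of the b-entries only. The a-entries are determined
  by the potential up to Koszul syzygies, because (x_1 - x_4, b_3) and (x_3 - x_4, b_3) are regular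
  sequences. The polynomials \<open>t\<close>, \<open>u\<close>, \<open>v\<close> are these
  syzygies; they enter the isomorphism as off-diagonal corrections.\<close>

abbreviation pring :: "nat set \<Rightarrow> qpoly set" where
  "pring V \<equiv> carrier (poly_ring V)"

lemma pring_iff: "p \<in> pring V \<longleftrightarrow> (\<forall>m\<in>Poly_Mapping.keys p. Poly_Mapping.keys m \<subseteq> V)"
  by (simp add: poly_ring_def)

lemma poly_ring_simps [simp]:
  "monoid.mult (poly_ring V) = (*)" "one (poly_ring V) = 1" "zero (poly_ring V) = 0" "add (poly_ring V) = (+)"
  by (simp_all add: poly_ring_def)

lemma poly_mapping_sum_singles:
  fixes p :: "'a \<Rightarrow>\<^sub>0 'b::comm_monoid_add"
  shows "p = (\<Sum>m\<in>Poly_Mapping.keys p. Poly_Mapping.single m (Poly_Mapping.lookup p m))"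
  by (rule poly_mapping_eqI)
    (auto simp: lookup_sum lookup_single when_def in_keys_iff sum.delta)

lemma poly_mapping_single_induct [case_names single add]:
  fixes p :: "'a \<Rightarrow>\<^sub>0 'b::comm_monoid_add"
  assumes "\<And>m c. P (Poly_Mapping.single m c)"
    and "\<And>p q. P p \<Longrightarrow> P q \<Longrightarrow> P (p + q)"
  shows "P p"
proof -
  have "P (\<Sum>m\<in>A. Poly_Mapping.single m (Poly_Mapping.lookup p m))" if "finite A" for A
    using that
  proof (induction A rule: finite_induct)
    case empty
    then show ?case using assms(1)[of _ 0] by simp
  qed (simp add: assms)
  then show ?thesis
    by (metis finite_keys poly_mapping_sum_singles)
qed

lemma keys_plus_nat:
  fixes m m' :: "'a \<Rightarrow>\<^sub>0 nat"
  shows "Poly_Mapping.keys (m + m') = Poly_Mapping.keys m \<union> Poly_Mapping.keys m'"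
  by (auto simp: in_keys_iff lookup_add)

lemma pring_mono: "p \<in> pring V \<Longrightarrow> V \<subseteq> W \<Longrightarrow> p \<in> pring W"
  by (auto simp: pring_iff)

lemma pring_zero [simp, intro]: "0 \<in> pring V" by (simp add: pring_iff)
lemma pring_one [simp, intro]: "1 \<in> pring V" by (simp add: pring_iff)

lemma pring_add [intro]: "p \<in> pring V \<Longrightarrow> q \<in> pring V \<Longrightarrow> p + q \<in> pring V"
  using keys_add[of p q] by (auto simp: pring_iff)

lemma pring_uminus [intro]: "p \<in> pring V \<Longrightarrow> - p \<in> pring V"
  by (auto simp: pring_iff in_keys_iff)

lemma pring_diff [intro]: "p \<in> pring V \<Longrightarrow> q \<in> pring V \<Longrightarrow> p - q \<in> pring V"
  using pring_add[of p V "- q"] by (auto simp: pring_uminus)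

lemma pring_mult [intro]: "p \<in> pring V \<Longrightarrow> q \<in> pring V \<Longrightarrow> p * q \<in> pring V"
  using keys_mult[of p q] by (fastforce simp: pring_iff keys_plus_nat)

lemma pring_power [intro]: "p \<in> pring V \<Longrightarrow> p ^ k \<in> pring V"
  by (induction k) auto

lemma pring_sum [intro]: "(\<And>i. i \<in> A \<Longrightarrow> f i \<in> pring V) \<Longrightarrow> sum f A \<in> pring V"
  by (induction A rule: infinite_finite_induct) auto

lemma pring_prod [intro]: "(\<And>i. i \<in> A \<Longrightarrow> f i \<in> pring V) \<Longrightarrow> prod f A \<in> pring V"
  by (induction A rule: infinite_finite_induct) auto

lemma pring_Const [simp, intro]: "Const c \<in> pring V" by (simp add: pring_iff Const_def)
lemma pring_X [intro]: "i \<in> V \<Longrightarrow> X i \<in> pring V" by (simp add: pring_iff X_def)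

lemma Const_add: "Const (a + b) = Const a + Const b" by (simp add: Const_def single_add)
lemma Const_mult: "Const (a * b) = Const a * Const b" by (simp add: Const_def mult_single)
lemma Const_zero [simp]: "Const 0 = 0" by (simp add: Const_def)
lemma Const_one [simp]: "Const 1 = 1" by (simp add: Const_def)
lemma Const_uminus: "Const (- a) = - Const a" by (simp add: Const_def single_uminus)
lemma Const_of_nat: "Const (of_nat k) = of_nat k"
  by (induction k) (simp_all add: Const_add)
lemma Const_numeral: "Const (numeral k) = numeral k"
  using Const_of_nat[of "numeral k"] by simp

lemma X_power: "X i ^ k = Poly_Mapping.single (Poly_Mapping.single i k) 1"
proof (induction k)
  case (Suc k)
  have "Poly_Mapping.single i (Suc 0) + Poly_Mapping.single i k = Poly_Mapping.single i (Suc k)"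
    by (metis plus_1_eq_Suc single_add One_nat_def)
  then show ?case by (simp add: Suc, simp add: X_def mult_single)
qed simp

lemma single_prod_X:
  "Poly_Mapping.single m c = Const c * (\<Prod>i\<in>Poly_Mapping.keys m. X i ^ Poly_Mapping.lookup m i)"
proof -
  have "(\<Prod>i\<in>A. X i ^ f i) = Poly_Mapping.single (\<Sum>i\<in>A. Poly_Mapping.single i (f i)) 1"
    if "finite A" for A f
    using that by (induction A rule: finite_induct) (simp_all add: X_power mult_single)
  from this[of "Poly_Mapping.keys m" "Poly_Mapping.lookup m"] show ?thesis
    by (simp add: Const_def mult_single flip: poly_mapping_sum_singles)
qed

text \<open>Identifies \<open>pring V\<close>, given through exponents, with the subring generated
  by the constants and the variables in \<open>V\<close>. The cases for sums and products keep the
  membership of both parts, because quotients built along such an induction must stay in the same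
  ring.\<close>

lemma pring_induct [consumes 1, case_names Const X add mult]:
  assumes p: "p \<in> pring V"
    and Const: "\<And>c. P (Const c)" and X: "\<And>i. i \<in> V \<Longrightarrow> P (X i)"
    and add: "\<And>p q. p \<in> pring V \<Longrightarrow> q \<in> pring V \<Longrightarrow> P p \<Longrightarrow> P q \<Longrightarrow> P (p + q)"
    and mult: "\<And>p q. p \<in> pring V \<Longrightarrow> q \<in> pring V \<Longrightarrow> P p \<Longrightarrow> P q \<Longrightarrow> P (p * q)"
  shows "P p"
proof -
  have one: "P 1" using Const[of 1] by simp
  have pow: "P (X i ^ k)" if "i \<in> V" for i k
    by (induction k) (auto simp: one intro!: mult X that)
  have prd: "P (\<Prod>i\<in>A. X i ^ f i)" if "finite A" "A \<subseteq> V" for A f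
    using that by (induction A rule: finite_induct) (auto simp: one intro!: mult pow)
  have mon: "P (Poly_Mapping.single m c)" if "m \<in> Poly_Mapping.keys p" for m c
  proof -
    have "Poly_Mapping.keys m \<subseteq> V" using that p by (simp add: pring_iff)
    then show ?thesis
      unfolding single_prod_X by (intro mult prd Const) auto
  qed
  have "P (\<Sum>m\<in>A. Poly_Mapping.single m (Poly_Mapping.lookup p m)) \<and>
        (\<Sum>m\<in>A. Poly_Mapping.single m (Poly_Mapping.lookup p m)) \<in> pring V"
    if "finite A" "A \<subseteq> Poly_Mapping.keys p" for A
    using that
  proof (induction A rule: finite_induct)
    case empty
    then show ?case using Const[of 0] by simp
  next
    case (insert m A)
    moreover have "Poly_Mapping.single m (Poly_Mapping.lookup p m) \<in> pring V"
      using insert p by (auto simp: pring_iff)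
    ultimately show ?case using mon by (auto intro!: add)
  qed
  then show ?thesis by (metis finite_keys order_refl poly_mapping_sum_singles)
qed

section \<open>Substitution homomorphisms and the factor theorem\<close>

definition monomial_value :: "(nat \<Rightarrow> qpoly) \<Rightarrow> (nat \<Rightarrow>\<^sub>0 nat) \<Rightarrow> qpoly" where
  "monomial_value \<sigma> m = (\<Prod>i\<in>Poly_Mapping.keys m. \<sigma> i ^ Poly_Mapping.lookup m i)"

lemma monomial_value_superset:
  "finite A \<Longrightarrow> Poly_Mapping.keys m \<subseteq> A \<Longrightarrow> monomial_value \<sigma> m = (\<Prod>i\<in>A. \<sigma> i ^ Poly_Mapping.lookup m i)"
  unfolding monomial_value_def by (rule prod.mono_neutral_left) (auto simp: in_keys_iff)

lemma monomial_value_add: "monomial_value \<sigma> (m + m') = monomial_value \<sigma> m * monomial_value \<sigma> m'"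
proof -
  let ?A = "Poly_Mapping.keys m \<union> Poly_Mapping.keys m'"
  have "monomial_value \<sigma> m'' = (\<Prod>i\<in>?A. \<sigma> i ^ Poly_Mapping.lookup m'' i)"
    if "Poly_Mapping.keys m'' \<subseteq> ?A" for m''
    by (rule monomial_value_superset) (use that in auto)
  from this[of m] this[of m'] this[of "m + m'"] show ?thesis
    by (simp add: keys_plus_nat lookup_add power_add prod.distrib)
qed

lemma subst_single: "subst \<sigma> (Poly_Mapping.single m c) = Const c * monomial_value \<sigma> m"
  by (cases "c = 0") (simp_all add: subst_def monomial_value_def)

lemma subst_add: "subst \<sigma> (p + q) = subst \<sigma> p + subst \<sigma> q"
  unfolding subst_def monomial_value_def[symmetric]
  by (rule setsum_keys_plus_distrib) (simp_all add: Const_add algebra_simps)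

lemma subst_mult: "subst \<sigma> (p * q) = subst \<sigma> p * subst \<sigma> q"
proof (induction p rule: poly_mapping_single_induct)
  case (single m c)
  show ?case
  proof (induction q rule: poly_mapping_single_induct)
    case (single m' c')
    then show ?case by (simp add: mult_single subst_single monomial_value_add Const_mult ac_simps)
  qed (simp add: subst_add algebra_simps)
qed (simp add: subst_add algebra_simps)

lemma subst_Const [simp]: "subst \<sigma> (Const c) = Const c"
  by (simp add: Const_def subst_single monomial_value_def)

lemma subst_X [simp]: "subst \<sigma> (X i) = \<sigma> i"
  by (simp add: X_def subst_single monomial_value_def)

lemma subst_zero [simp]: "subst \<sigma> 0 = 0" using subst_Const[of \<sigma> 0] by simp
lemma subst_one [simp]: "subst \<sigma> 1 = 1" using subst_Const[of \<sigma> 1] by simp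
lemma subst_uminus: "subst \<sigma> (- p) = - subst \<sigma> p"
  using subst_add[of \<sigma> p "- p"] by (simp add: eq_neg_iff_add_eq_0 add.commute)
lemma subst_diff: "subst \<sigma> (p - q) = subst \<sigma> p - subst \<sigma> q"
  using subst_add[of \<sigma> p "- q"] by (simp add: subst_uminus)
lemma subst_power: "subst \<sigma> (p ^ k) = subst \<sigma> p ^ k"
  by (induction k) (simp_all add: subst_mult)
lemma subst_numeral [simp]: "subst \<sigma> (numeral k) = numeral k"
  using subst_Const[of \<sigma> "numeral k"] by (simp add: Const_numeral)
lemmas subst_ring_simps = subst_add subst_mult subst_uminus subst_diff subst_power

lemma pring_UNIV [simp]: "p \<in> pring UNIV" by (simp add: pring_iff)

lemma subst_subst: "subst \<sigma> (subst \<tau> p) = subst (\<lambda>i. subst \<sigma> (\<tau> i)) p"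
proof -
  have "p \<in> pring UNIV" by simp
  then show ?thesis by (induction p rule: pring_induct) (simp_all add: subst_add subst_mult)
qed

lemma subst_ident: "p \<in> pring V \<Longrightarrow> (\<And>i. i \<in> V \<Longrightarrow> \<sigma> i = X i) \<Longrightarrow> subst \<sigma> p = p"
  by (induction p rule: pring_induct) (simp_all add: subst_add subst_mult)

lemma pring_subst: "p \<in> pring V \<Longrightarrow> (\<And>i. i \<in> V \<Longrightarrow> \<sigma> i \<in> pring W) \<Longrightarrow> subst \<sigma> p \<in> pring W"
  by (induction p rule: pring_induct) (auto simp: subst_add subst_mult)

lemma X_eq_iff [simp]: "X i = X j \<longleftrightarrow> i = j"
proof
  assume "X i = X j"
  then have "Poly_Mapping.keys (X i) = Poly_Mapping.keys (X j)" by simp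
  then have "Poly_Mapping.single i (1::nat) = Poly_Mapping.single j 1" by (simp add: X_def)
  then have "Poly_Mapping.keys (Poly_Mapping.single i (1::nat)) = Poly_Mapping.keys (Poly_Mapping.single j (1::nat))"
    by simp
  then show "i = j" by simp
qed simp

abbreviation subst1 :: "nat \<Rightarrow> qpoly \<Rightarrow> qpoly \<Rightarrow> qpoly" where
  "subst1 v c \<equiv> subst (\<lambda>i. if i = v then c else X i)"

text \<open>The factor theorem for the variable \<open>X v\<close> at \<open>c\<close>, with control
  of the ring of the quotient. The quotient is assembled along the structure of \<open>p\<close>:
  for a product, p q - p' q' = (p - p') q + p' (q - q'), where p' and q' are the substituted
  polynomials.\<close>

lemma linear_division:
  assumes "p \<in> pring V" "c \<in> pring V"
  shows "\<exists>q\<in>pring V. p - subst1 v c p = (X v - c) * q"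
  using assms(1)
proof (induction p rule: pring_induct)
  case (Const a)
  then show ?case by (intro bexI[of _ 0]) auto
next
  case (X i)
  show ?case
  proof (cases "i = v")
    case True
    then show ?thesis by (intro bexI[of _ 1]) auto
  next
    case False
    then show ?thesis by (intro bexI[of _ 0]) auto
  qed
next
  case (add p q)
  then obtain p' q' where *: "p' \<in> pring V" "p - subst1 v c p = (X v - c) * p'"
    "q' \<in> pring V" "q - subst1 v c q = (X v - c) * q'" by blast
  have "p + q - subst1 v c (p + q) = (p - subst1 v c p) + (q - subst1 v c q)"
    by (simp add: subst_add)
  with * show ?case
    by (intro bexI[of _ "p' + q'"]) (auto simp: distrib_left)
next
  case (mult p q)
  then obtain p' q' where *: "p' \<in> pring V" "p - subst1 v c p = (X v - c) * p'"
    "q' \<in> pring V" "q - subst1 v c q = (X v - c) * q'" by blast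
  have "subst1 v c p \<in> pring V"
    using mult.hyps assms(2) by (auto intro!: pring_subst)
  moreover have "p * q - subst1 v c (p * q) = (p - subst1 v c p) * q + subst1 v c p * (q - subst1 v c q)"
    by (simp add: subst_mult algebra_simps)
  ultimately show ?case
    by (intro bexI[of _ "p' * q + subst1 v c p * q'"])
      (use * mult.hyps in \<open>auto simp: algebra_simps\<close>)
qed

section \<open>Homogeneous polynomials\<close>

lemma mono_deg_superset:
  "finite A \<Longrightarrow> Poly_Mapping.keys m \<subseteq> A \<Longrightarrow> mono_deg m = 2 * (\<Sum>i\<in>A. int (Poly_Mapping.lookup m i))"
  unfolding mono_deg_def by (simp, rule sum.mono_neutral_left) (auto simp: in_keys_iff)

lemma mono_deg_add: "mono_deg (m + m') = mono_deg m + mono_deg m'"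
proof -
  let ?A = "Poly_Mapping.keys m \<union> Poly_Mapping.keys m'"
  have "mono_deg m'' = 2 * (\<Sum>i\<in>?A. int (Poly_Mapping.lookup m'' i))"
    if "Poly_Mapping.keys m'' \<subseteq> ?A" for m''
    by (rule mono_deg_superset) (use that in auto)
  from this[of m] this[of m'] this[of "m + m'"] show ?thesis
    by (simp add: keys_plus_nat lookup_add sum.distrib)
qed

lemma mono_deg_zero [simp]: "mono_deg 0 = 0" by (simp add: mono_deg_def)

lemma homogeneous_zero [simp, intro]: "homogeneous 0 k" by (simp add: homogeneous_def)
lemma homogeneous_single: "homogeneous (Poly_Mapping.single m c) (mono_deg m)"
  by (simp add: homogeneous_def)
lemma homogeneous_Const [simp, intro]: "homogeneous (Const c) 0"
  by (simp add: homogeneous_def Const_def)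
lemma homogeneous_one [simp, intro]: "homogeneous 1 0" using homogeneous_Const[of 1] by simp
lemma homogeneous_X [simp, intro]: "homogeneous (X i) 2"
  by (simp add: homogeneous_def X_def mono_deg_def)

lemma homogeneous_add [intro]: "homogeneous p k \<Longrightarrow> homogeneous q k \<Longrightarrow> homogeneous (p + q) k"
  using keys_add[of p q] by (auto simp: homogeneous_def)
lemma homogeneous_uminus [intro]: "homogeneous p k \<Longrightarrow> homogeneous (- p) k"
  by (auto simp: homogeneous_def in_keys_iff)
lemma homogeneous_diff [intro]: "homogeneous p k \<Longrightarrow> homogeneous q k \<Longrightarrow> homogeneous (p - q) k"
  using homogeneous_add[of p k "- q"] by (auto simp: homogeneous_uminus)
lemma homogeneous_mult: "homogeneous p k \<Longrightarrow> homogeneous q l \<Longrightarrow> homogeneous (p * q) (k + l)"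
  using keys_mult[of p q] by (fastforce simp: homogeneous_def mono_deg_add)
lemma homogeneous_mult': "homogeneous p k \<Longrightarrow> homogeneous q l \<Longrightarrow> m = k + l \<Longrightarrow> homogeneous (p * q) m"
  using homogeneous_mult by blast
lemma homogeneous_power: "homogeneous p k \<Longrightarrow> homogeneous (p ^ j) (int j * k)"
  by (induction j) (auto simp: algebra_simps intro: homogeneous_mult')
lemma homogeneous_sum [intro]: "(\<And>i. i \<in> A \<Longrightarrow> homogeneous (f i) k) \<Longrightarrow> homogeneous (sum f A) k"
  by (induction A rule: infinite_finite_induct) auto

lemma poly_deg_homogeneous:
  assumes "homogeneous p k" "p \<noteq> 0"
  shows "poly_deg p = k"
proof -
  obtain m where "m \<in> Poly_Mapping.keys p"
    using assms(2) by (auto simp: poly_mapping_eq_iff fun_eq_iff in_keys_iff)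
  then have "mono_deg ` Poly_Mapping.keys p = {k}" using assms(1) by (auto simp: homogeneous_def)
  then show ?thesis by (simp add: poly_deg_def)
qed

text \<open>The homogeneous component of degree \<open>d\<close>. Homogeneity is proved below by
  showing that a polynomial equals one of its components.\<close>

definition hcomp :: "int \<Rightarrow> qpoly \<Rightarrow> qpoly" where
  "hcomp d p = (\<Sum>m\<in>Poly_Mapping.keys p. if mono_deg m = d then Poly_Mapping.single m (Poly_Mapping.lookup p m) else 0)"

lemma lookup_hcomp: "Poly_Mapping.lookup (hcomp d p) m = (if mono_deg m = d then Poly_Mapping.lookup p m else 0)"
proof -
  have "Poly_Mapping.lookup (hcomp d p) m =
      (\<Sum>m'\<in>Poly_Mapping.keys p. if m' = m then (if mono_deg m = d then Poly_Mapping.lookup p m else 0) else 0)"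
    unfolding hcomp_def lookup_sum by (rule sum.cong) (auto simp: lookup_single when_def)
  then show ?thesis by (auto simp: sum.delta in_keys_iff)
qed

lemma homogeneous_iff: "homogeneous p k \<longleftrightarrow> hcomp k p = p"
  by (auto simp: poly_mapping_eq_iff fun_eq_iff lookup_hcomp homogeneous_def in_keys_iff)

lemma homogeneous_hcomp [simp, intro]: "homogeneous (hcomp d p) d"
  by (auto simp: homogeneous_def in_keys_iff lookup_hcomp split: if_splits)

lemma pring_hcomp [intro]: "p \<in> pring V \<Longrightarrow> hcomp d p \<in> pring V"
  by (auto simp: pring_iff in_keys_iff lookup_hcomp split: if_splits)

lemma hcomp_add: "hcomp d (p + q) = hcomp d p + hcomp d q"
  by (auto intro!: poly_mapping_eqI simp: lookup_hcomp lookup_add)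
lemma hcomp_uminus: "hcomp d (- p) = - hcomp d p"
  by (auto intro!: poly_mapping_eqI simp: lookup_hcomp)
lemma hcomp_zero [simp]: "hcomp d 0 = 0"
  by (auto intro!: poly_mapping_eqI simp: lookup_hcomp)
lemma hcomp_sum: "hcomp d (sum f A) = (\<Sum>i\<in>A. hcomp d (f i))"
  by (induction A rule: infinite_finite_induct) (auto simp: hcomp_add)

lemma hcomp_homogeneous: "homogeneous p k \<Longrightarrow> hcomp d p = (if d = k then p else 0)"
  by (auto intro!: poly_mapping_eqI simp: lookup_hcomp homogeneous_def in_keys_iff)

lemma hcomp_mult_left:
  assumes "homogeneous b j"
  shows "hcomp d (b * q) = b * hcomp (d - j) q"
proof (induction q rule: poly_mapping_single_induct)
  case (single m c)
  show ?case
    using hcomp_homogeneous[OF homogeneous_mult[OF assms homogeneous_single], of d m c]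
      hcomp_homogeneous[OF homogeneous_single, of "d - j" m c]
    by (auto split: if_splits)
qed (simp add: hcomp_add distrib_left)

lemma hcomp_eq_0: "d \<notin> mono_deg ` Poly_Mapping.keys p \<Longrightarrow> hcomp d p = 0"
  by (rule poly_mapping_eqI) (auto simp: lookup_hcomp not_in_keys_iff_lookup_eq_zero[symmetric])

lemma hcomp_decomp:
  assumes "finite D" "mono_deg ` Poly_Mapping.keys p \<subseteq> D"
  shows "(\<Sum>d\<in>D. hcomp d p) = p"
proof (rule poly_mapping_eqI)
  fix m
  have "mono_deg m \<in> D" if "Poly_Mapping.lookup p m \<noteq> 0"
    using assms(2) that by (auto simp: in_keys_iff)
  then show "Poly_Mapping.lookup (\<Sum>d\<in>D. hcomp d p) m = Poly_Mapping.lookup p m"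
    using assms(1) by (auto simp: lookup_sum lookup_hcomp sum.delta)
qed

text \<open>The component of degree \<open>k\<close> of b q is b times a single component of q;
  cancelling b in the domain shows that q is that component.\<close>

lemma homogeneous_quotient:
  assumes "homogeneous b j" "b \<noteq> 0" "homogeneous (b * q) k"
  shows "homogeneous q (k - j)"
proof -
  have "b * hcomp (k - j) q = b * q"
    using assms(3) hcomp_mult_left[OF assms(1), of k q] by (simp add: homogeneous_iff)
  then show ?thesis using assms(2) by (simp add: homogeneous_iff)
qed

section \<open>The irrelevant ideal\<close>

lemma cring_poly_ring: "cring (poly_ring V)"
proof (rule cringI)
  show "abelian_group (poly_ring V)"
    by (rule abelian_groupI) (auto simp: algebra_simps intro: pring_uminus exI[of _ "- _"] intro!: bexI[of _ "- _"])
  show "Group.comm_monoid (poly_ring V)"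
    by (rule comm_monoidI) (auto simp: algebra_simps)
qed (auto simp: algebra_simps)

lemma irrelevant_ideal: "ideal (irrelevant_ideal V) (poly_ring V)"
  unfolding irrelevant_ideal_def
  using cring_poly_ring[of V] by (auto simp: cring_def intro!: ring.genideal_ideal)

lemma irrelevant_ideal_closed:
  "0 \<in> irrelevant_ideal V"
  "p \<in> irrelevant_ideal V \<Longrightarrow> q \<in> irrelevant_ideal V \<Longrightarrow> p + q \<in> irrelevant_ideal V"
  "p \<in> irrelevant_ideal V \<Longrightarrow> q \<in> pring V \<Longrightarrow> q * p \<in> irrelevant_ideal V"
  "p \<in> irrelevant_ideal V \<Longrightarrow> p \<in> pring V"
  using additive_subgroup.zero_closed[OF ideal.axioms(1)[OF irrelevant_ideal[of V]]]
    additive_subgroup.a_closed[OF ideal.axioms(1)[OF irrelevant_ideal[of V]], of p q]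
    ideal.I_l_closed[OF irrelevant_ideal[of V], of p q]
    ideal.Icarr[OF irrelevant_ideal[of V], of p]
  by simp_all

text \<open>The residue field at the irrelevant ideal is the field of rational numbers. This reduces
  cocycles to rational coefficients when cohomology is shown to be finite-dimensional.\<close>

lemma constant_part:
  assumes "p \<in> pring V"
  shows "\<exists>c. p - Const c \<in> irrelevant_ideal V"
  using assms
proof (induction p rule: pring_induct)
  case (Const c)
  then show ?case by (intro exI[of _ c]) (simp add: irrelevant_ideal_closed)
next
  case (X i)
  have "X i \<in> irrelevant_ideal V"
    unfolding irrelevant_ideal_def using cring_poly_ring[of V] X
    by (intro subsetD[OF ring.genideal_self]) (auto simp: cring_def)
  then show ?case by (intro exI[of _ 0]) simp
next
  case (add p q)
  then obtain c d where "p - Const c \<in> irrelevant_ideal V" "q - Const d \<in> irrelevant_ideal V" by blast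
  from irrelevant_ideal_closed(2)[OF this] show ?case
    by (intro exI[of _ "c + d"]) (simp add: Const_add algebra_simps)
next
  case (mult p q)
  then obtain c d where "p - Const c \<in> irrelevant_ideal V" "q - Const d \<in> irrelevant_ideal V" by blast
  then have "q * (p - Const c) + Const c * (q - Const d) \<in> irrelevant_ideal V"
    using mult.hyps by (intro irrelevant_ideal_closed(2,3)) auto
  then show ?case by (intro exI[of _ "c * d"]) (simp add: Const_mult algebra_simps)
qed

section \<open>One distinguished variable over a smaller polynomial ring, and division in it\<close>

definition polys_over :: "nat set \<Rightarrow> qpoly poly set" where
  "polys_over V = {P. \<forall>i. coeff P i \<in> pring V}"

lemma polys_over_zero [simp, intro]: "0 \<in> polys_over V" by (simp add: polys_over_def)
lemma polys_over_pCons [intro]: "a \<in> pring V \<Longrightarrow> P \<in> polys_over V \<Longrightarrow> pCons a P \<in> polys_over V"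
  by (auto simp: polys_over_def coeff_pCons split: nat.split)
lemma polys_over_pConsD: "pCons a P \<in> polys_over V \<Longrightarrow> a \<in> pring V \<and> P \<in> polys_over V"
  by (auto simp: polys_over_def coeff_pCons split: nat.splits)
lemma polys_over_add [intro]: "P \<in> polys_over V \<Longrightarrow> Q \<in> polys_over V \<Longrightarrow> P + Q \<in> polys_over V"
  by (auto simp: polys_over_def)
lemma polys_over_diff [intro]: "P \<in> polys_over V \<Longrightarrow> Q \<in> polys_over V \<Longrightarrow> P - Q \<in> polys_over V"
  by (auto simp: polys_over_def)
lemma polys_over_uminus [intro]: "P \<in> polys_over V \<Longrightarrow> - P \<in> polys_over V"
  by (auto simp: polys_over_def)
lemma polys_over_mult [intro]: "P \<in> polys_over V \<Longrightarrow> Q \<in> polys_over V \<Longrightarrow> P * Q \<in> polys_over V"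
  by (auto simp: polys_over_def coeff_mult intro!: pring_sum)
lemma polys_over_smult [intro]: "a \<in> pring V \<Longrightarrow> P \<in> polys_over V \<Longrightarrow> smult a P \<in> polys_over V"
  by (auto simp: polys_over_def)
lemma X_neq_0 [simp]: "X v \<noteq> 0"
  by (metis X_def lookup_single_eq lookup_zero zero_neq_one)

text \<open>A variable outside \<open>V\<close> is transcendental over \<open>pring V\<close>:
  setting it to 0 isolates the constant coefficient, and after cancelling the variable the argument
  repeats.\<close>

lemma poly_X_eq_0:
  assumes "P \<in> polys_over V" "v \<notin> V" "poly P (X v) = 0"
  shows "P = 0"
  using assms(1,3)
proof (induction P)
  case (pCons a P)
  have a: "a \<in> pring V" and P: "P \<in> polys_over V" using pCons.prems polys_over_pConsD by auto
  have eq: "a + X v * poly P (X v) = 0" using pCons.prems by simp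
  then have "subst1 v 0 (a + X v * poly P (X v)) = 0" by simp
  moreover have "subst1 v 0 a = a" using a assms(2) by (intro subst_ident) auto
  ultimately have "a = 0" by (simp add: subst_add subst_mult)
  then show ?case using eq pCons.IH[OF P] by simp
qed simp

text \<open>A translation of \<open>X v\<close> by \<open>c\<close> reduces this to the centre 0.
  Together with \<open>pring_insert_eq_poly\<close>, evaluation at \<open>X v - c\<close> is a
  bijection from the polynomials over \<open>pring V\<close> to
  \<open>pring (insert v V)\<close>.\<close>

lemma poly_X_shift_eq_0:
  assumes "P \<in> polys_over V" "v \<notin> V" "c \<in> pring V" "poly P (X v - c) = 0"
  shows "P = 0"
proof (rule poly_X_eq_0[OF assms(1,2)])
  have "subst1 v (X v + c) (poly Q (X v - c)) = poly Q (X v)" if "Q \<in> polys_over V" for Q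
    using that
  proof (induction Q)
    case (pCons a Q)
    have "subst1 v (X v + c) a = a" "subst1 v (X v + c) c = c"
      using pCons.prems polys_over_pConsD assms(2,3) by (auto intro!: subst_ident)
    then show ?case
      using pCons polys_over_pConsD by (auto simp: subst_add subst_mult subst_diff)
  qed simp
  from this[OF assms(1)] show "poly P (X v) = 0" by (simp add: assms(4))
qed

lemma poly_pring [intro]:
  assumes "P \<in> polys_over V" "y \<in> pring W" "V \<subseteq> W"
  shows "poly P y \<in> pring W"
  using assms(1)
proof (induction P)
  case (pCons a P)
  then show ?case using polys_over_pConsD[OF pCons.prems] pring_mono[OF _ assms(3)] assms(2) by auto
qed simp

lemma pring_insert_eq_poly:
  assumes "p \<in> pring (insert v V)" "c \<in> pring V"
  shows "\<exists>P\<in>polys_over V. p = poly P (X v - c)"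
  using assms(1)
proof (induction p rule: pring_induct)
  case (Const a)
  then show ?case by (intro bexI[of _ "[:Const a:]"]) auto
next
  case (X i)
  show ?case
  proof (cases "i \<in> V")
    case True
    then show ?thesis by (intro bexI[of _ "[:X i:]"]) auto
  next
    case False
    then show ?thesis using X assms(2) by (intro bexI[of _ "[:c, 1:]"]) auto
  qed
next
  case (add p q)
  then show ?case by (metis poly_add polys_over_add)
next
  case (mult p q)
  then show ?case by (metis poly_mult polys_over_mult)
qed

text \<open>Remainders of degree below \<open>k\<close>. The condition on coefficients covers the
  zero polynomial and \<open>k = 0\<close> without a separate case.\<close>

definition low_polys :: "nat set \<Rightarrow> nat \<Rightarrow> qpoly poly set" where
  "low_polys V k = {C \<in> polys_over V. \<forall>i\<ge>k. coeff C i = 0}"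

text \<open>Horner's scheme: dividing the tail of the dividend leaves a remainder of degree below
  \<open>k\<close>. Multiplied by the variable it may reach degree \<open>k\<close>, and one
  multiple of \<open>B\<close> removes that term because the leading coefficient is a nonzero
  rational.\<close>

lemma poly_division_unit_lead:
  assumes B: "B \<in> polys_over V" "degree B = k" "lead_coeff B = Const l" "l \<noteq> 0" and P: "P \<in> polys_over V"
  shows "\<exists>Q\<in>polys_over V. \<exists>C\<in>low_polys V k. P = B * Q + C"
  using P
proof (induction P)
  case 0
  show ?case by (intro bexI[of _ 0]) (auto simp: low_polys_def)
next
  case (pCons a P)
  then obtain Q C where Q: "Q \<in> polys_over V" and C: "C \<in> low_polys V k" and eq: "P = B * Q + C"
    using polys_over_pConsD by blast
  define m where "m = coeff (pCons a C) k * Const (1 / l)"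
  have aC: "pCons a C \<in> polys_over V"
    using C pCons.prems polys_over_pConsD by (auto simp: low_polys_def)
  then have m: "m \<in> pring V" by (auto simp: m_def polys_over_def simp del: coeff_pCons)
  have mB: "m * coeff B k = coeff (pCons a C) k"
    using B by (simp add: m_def mult.assoc flip: Const_mult)
  show ?case
  proof (intro bexI)
    show "pCons a P = B * (pCons m Q) + (pCons a C - smult m B)"
      by (simp add: eq)
    show "pCons m Q \<in> polys_over V" using m Q by auto
    show "pCons a C - smult m B \<in> low_polys V k"
      unfolding low_polys_def
    proof (intro CollectI conjI allI impI)
      show "pCons a C - smult m B \<in> polys_over V" using aC m B by auto
      fix i assume "k \<le> i"
      show "coeff (pCons a C - smult m B) i = 0"
      proof (cases "i = k")
        case True
        then show ?thesis using mB by simp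
      next
        case False
        with \<open>k \<le> i\<close> have "coeff B i = 0" "coeff (pCons a C) i = 0"
          using B C by (auto simp: coeff_eq_0 low_polys_def coeff_pCons split: nat.split)
        then show ?thesis by simp
      qed
    qed
  qed
qed

text \<open>Evaluation is injective, so the equation lifts to B Q = C in one variable over a domain,
  where a nonzero multiple of \<open>B\<close> has degree at least \<open>k\<close>.\<close>

lemma low_poly_multiple_eq_0:
  assumes B: "B \<in> polys_over V" "degree B = k" "B \<noteq> 0"
    and v: "v \<notin> V" "c \<in> pring V"
    and q: "q \<in> pring (insert v V)" and C: "C \<in> low_polys V k"
    and eq: "poly B (X v - c) * q = poly C (X v - c)"
  shows "C = 0 \<and> q = 0"
proof -
  obtain Q where Q: "Q \<in> polys_over V" "q = poly Q (X v - c)"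
    using pring_insert_eq_poly[OF q v(2)] by blast
  have C': "C \<in> polys_over V" using C by (simp add: low_polys_def)
  have "B * Q - C = 0"
    by (rule poly_X_shift_eq_0[OF _ v]) (use B Q C' eq in auto)
  then have BQ: "B * Q = C" by simp
  have "Q = 0"
  proof (rule ccontr)
    assume "Q \<noteq> 0"
    then have "degree C = k + degree Q" "C \<noteq> 0" using B BQ by (auto simp: degree_mult_eq)
    then show False using C by (metis (mono_tags, lifting) leading_coeff_0_iff le_add1 low_polys_def mem_Collect_eq)
  qed
  then show ?thesis using BQ Q by simp
qed

section \<open>Modules with a homogeneous basis\<close>

lemma lookup_scale [simp]: "Poly_Mapping.lookup (scale p v) b = p * Poly_Mapping.lookup v b"
  by (simp add: scale_def map.rep_eq when_def)

lemma scale_add_right: "scale p (u + v) = scale p u + scale p v"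
  by (rule poly_mapping_eqI) (simp add: lookup_add algebra_simps)
lemma scale_add_left: "scale (p + q) v = scale p v + scale q v"
  by (rule poly_mapping_eqI) (simp add: lookup_add algebra_simps)
lemma scale_scale [simp]: "scale p (scale q v) = scale (p * q) v"
  by (rule poly_mapping_eqI) (simp add: algebra_simps)
lemma scale_one [simp]: "scale 1 v = v" by (rule poly_mapping_eqI) simp
lemma scale_zero_left [simp]: "scale 0 v = 0" by (rule poly_mapping_eqI) simp
lemma scale_zero_right [simp]: "scale p 0 = 0" by (rule poly_mapping_eqI) simp
lemma scale_uminus_right: "scale p (- v) = - scale p v" by (rule poly_mapping_eqI) simp
lemma scale_uminus_left: "scale (- p) v = - scale p v" by (rule poly_mapping_eqI) simp
lemma scale_diff_right: "scale p (u - v) = scale p u - scale p v"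
  by (rule poly_mapping_eqI) (simp add: lookup_minus algebra_simps)
lemma scale_sum_right: "scale p (sum f A) = (\<Sum>i\<in>A. scale p (f i))"
  by (induction A rule: infinite_finite_induct) (auto simp: scale_add_right)
lemma scale_single [simp]: "scale p (Poly_Mapping.single b c) = Poly_Mapping.single b (p * c)"
  by (rule poly_mapping_eqI) (simp add: lookup_single when_def)

text \<open>Extension by linearity over the full polynomial ring; the differential of
  \<open>fact_of M\<close> is \<open>lin (bdiff M)\<close>.\<close>

definition lin :: "('b \<Rightarrow> 'c \<Rightarrow>\<^sub>0 qpoly) \<Rightarrow> ('b \<Rightarrow>\<^sub>0 qpoly) \<Rightarrow> 'c \<Rightarrow>\<^sub>0 qpoly" where
  "lin \<psi> v = (\<Sum>b\<in>Poly_Mapping.keys v. scale (Poly_Mapping.lookup v b) (\<psi> b))"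

lemma lin_superset:
  "finite A \<Longrightarrow> Poly_Mapping.keys v \<subseteq> A \<Longrightarrow> lin \<psi> v = (\<Sum>b\<in>A. scale (Poly_Mapping.lookup v b) (\<psi> b))"
  unfolding lin_def by (rule sum.mono_neutral_left) (auto simp: in_keys_iff)

lemma lin_zero [simp]: "lin \<psi> 0 = 0" by (simp add: lin_def)
lemma lin_add: "lin \<psi> (u + v) = lin \<psi> u + lin \<psi> v"
  unfolding lin_def by (rule setsum_keys_plus_distrib) (simp_all add: scale_add_left)
lemma lin_uminus: "lin \<psi> (- v) = - lin \<psi> v"
  using lin_add[of \<psi> v "- v"] by (simp add: eq_neg_iff_add_eq_0 add.commute)
lemma lin_diff: "lin \<psi> (u - v) = lin \<psi> u - lin \<psi> v"
  using lin_add[of \<psi> u "- v"] by (simp add: lin_uminus)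
lemma lin_single [simp]: "lin \<psi> (Poly_Mapping.single b c) = scale c (\<psi> b)"
  by (cases "c = 0") (simp_all add: lin_def)
lemma lin_sum: "lin \<psi> (sum f A) = (\<Sum>i\<in>A. lin \<psi> (f i))"
  by (induction A rule: infinite_finite_induct) (auto simp: lin_add)
lemma lin_scale: "lin \<psi> (scale p v) = scale p (lin \<psi> v)"
proof -
  have "Poly_Mapping.keys (scale p v) \<subseteq> Poly_Mapping.keys v" by (auto simp: in_keys_iff)
  from lin_superset[OF _ this] show ?thesis
    by (simp add: lin_def scale_sum_right)
qed
lemma lin_lin: "lin \<psi> (lin \<chi> v) = lin (\<lambda>b. lin \<psi> (\<chi> b)) v"
  by (simp only: lin_def[of \<chi> v] lin_sum lin_scale lin_def[of "\<lambda>b. lin \<psi> (\<chi> b)" v])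
lemma lin_cong: "(\<And>b. b \<in> Poly_Mapping.keys v \<Longrightarrow> \<psi> b = \<chi> b) \<Longrightarrow> lin \<psi> v = lin \<chi> v"
  by (simp add: lin_def)
lemma lin_scale_single [simp]: "lin (\<lambda>b. Poly_Mapping.single b w) v = scale w v"
proof -
  have "scale w v = (\<Sum>b\<in>Poly_Mapping.keys v. scale w (Poly_Mapping.single b (Poly_Mapping.lookup v b)))"
    by (subst poly_mapping_sum_singles) (rule scale_sum_right)
  then show ?thesis by (simp add: lin_def mult.commute)
qed
lemma lin_diff_fun: "lin (\<lambda>b. \<psi> b - \<chi> b) v = lin \<psi> v - lin \<chi> v"
  by (simp add: lin_def scale_diff_right sum_subtractf)
lemma lookup_lin:
  "Poly_Mapping.lookup (lin \<psi> v) c = (\<Sum>b\<in>Poly_Mapping.keys v. Poly_Mapping.lookup v b * Poly_Mapping.lookup (\<psi> b) c)"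
  by (simp add: lin_def lookup_sum)

text \<open>The carrier and, below, the graded pieces of \<open>bmodule\<close>, phrased with
  coefficients instead of keys. Zero is homogeneous of every degree, so the grading can quantify
  over all basis elements.\<close>

definition bcar :: "'b bfact \<Rightarrow> bit \<Rightarrow> ('b \<Rightarrow>\<^sub>0 qpoly) set" where
  "bcar M i = {v. \<forall>b. Poly_Mapping.lookup v b \<noteq> 0 \<longrightarrow> b \<in> basis M \<and> par M b = i \<and> Poly_Mapping.lookup v b \<in> pring (bvars M)}"

definition bgrade :: "'b bfact \<Rightarrow> bit \<Rightarrow> int \<Rightarrow> ('b \<Rightarrow>\<^sub>0 qpoly) set" where
  "bgrade M i k = {v \<in> bcar M i. \<forall>b. homogeneous (Poly_Mapping.lookup v b) (k - bdeg M b)}"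

lemma bmodule_simps [simp]:
  "carrier (bmodule M i) = bcar M i" "zero (bmodule M i) = 0" "add (bmodule M i) = (+)"
  "module.smult (bmodule M i) = scale" "grade (bmodule M i) k = bgrade M i k"
proof -
  show *: "carrier (bmodule M i) = bcar M i"
    by (auto simp: bmodule_def Let_def bcar_def in_keys_iff)
  have "grade (bmodule M i) k =
      {v \<in> carrier (bmodule M i). \<forall>b\<in>Poly_Mapping.keys v. homogeneous (Poly_Mapping.lookup v b) (k - bdeg M b)}"
    by (simp add: bmodule_def Let_def)
  also have "\<dots> = bgrade M i k"
    unfolding * bgrade_def in_keys_iff Ball_def by (metis (no_types, lifting) homogeneous_zero)
  finally show "grade (bmodule M i) k = bgrade M i k" .
qed (simp_all add: bmodule_def Let_def)

lemma fact_of_simps [simp]: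
  "module_at (fact_of M) = bmodule M" "diff (fact_of M) i = lin (bdiff M)"
  by (auto simp: fact_of_def lin_def fun_eq_iff)

lemma bcar_zero [simp, intro]: "0 \<in> bcar M i" by (simp add: bcar_def)
lemma bcar_lookup: "v \<in> bcar M i \<Longrightarrow> Poly_Mapping.lookup v b \<in> pring (bvars M)"
  by (cases "Poly_Mapping.lookup v b = 0") (auto simp: bcar_def)
lemma bcar_add [intro]:
  assumes "u \<in> bcar M i" "v \<in> bcar M i"
  shows "u + v \<in> bcar M i"
  unfolding bcar_def
proof (intro CollectI allI impI)
  fix b assume "Poly_Mapping.lookup (u + v) b \<noteq> 0"
  then have "Poly_Mapping.lookup u b \<noteq> 0 \<or> Poly_Mapping.lookup v b \<noteq> 0"
    by (auto simp: lookup_add)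
  then show "b \<in> basis M \<and> par M b = i \<and> Poly_Mapping.lookup (u + v) b \<in> pring (bvars M)"
    using assms bcar_lookup[OF assms(1)] bcar_lookup[OF assms(2)]
    by (auto simp: bcar_def lookup_add)
qed
lemma bcar_scale [intro]: "v \<in> bcar M i \<Longrightarrow> p \<in> pring (bvars M) \<Longrightarrow> scale p v \<in> bcar M i"
  by (auto simp: bcar_def)
lemma bcar_uminus [intro]: "v \<in> bcar M i \<Longrightarrow> - v \<in> bcar M i"
  by (auto simp: bcar_def)
lemma bcar_diff [intro]: "u \<in> bcar M i \<Longrightarrow> v \<in> bcar M i \<Longrightarrow> u - v \<in> bcar M i"
  using bcar_add[of u M i "- v"] by auto
lemma bcar_sum [intro]: "(\<And>x. x \<in> A \<Longrightarrow> f x \<in> bcar M i) \<Longrightarrow> sum f A \<in> bcar M i"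
  by (induction A rule: infinite_finite_induct) auto
lemma bcar_single: "b \<in> basis M \<Longrightarrow> par M b = i \<Longrightarrow> p \<in> pring (bvars M) \<Longrightarrow> Poly_Mapping.single b p \<in> bcar M i"
  by (auto simp: bcar_def lookup_single when_def)

lemma bgrade_bcar: "v \<in> bgrade M i k \<Longrightarrow> v \<in> bcar M i" by (simp add: bgrade_def)
lemma bgrade_zero [simp, intro]: "0 \<in> bgrade M i k" by (simp add: bgrade_def)
lemma bgrade_add [intro]: "u \<in> bgrade M i k \<Longrightarrow> v \<in> bgrade M i k \<Longrightarrow> u + v \<in> bgrade M i k"
  by (auto simp: bgrade_def lookup_add)
lemma bgrade_uminus [intro]: "v \<in> bgrade M i k \<Longrightarrow> - v \<in> bgrade M i k"
  by (auto simp: bgrade_def)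
lemma bgrade_diff [intro]: "u \<in> bgrade M i k \<Longrightarrow> v \<in> bgrade M i k \<Longrightarrow> u - v \<in> bgrade M i k"
  using bgrade_add[of u M i k "- v"] by auto
lemma bgrade_sum [intro]: "(\<And>x. x \<in> A \<Longrightarrow> f x \<in> bgrade M i k) \<Longrightarrow> sum f A \<in> bgrade M i k"
  by (induction A rule: infinite_finite_induct) auto
lemma bgrade_scale: "v \<in> bgrade M i k \<Longrightarrow> p \<in> pring (bvars M) \<Longrightarrow> homogeneous p l \<Longrightarrow> m = k + l \<Longrightarrow> scale p v \<in> bgrade M i m"
  by (auto simp: bgrade_def intro!: homogeneous_mult'[of p l])
lemma bgrade_single:
  "b \<in> basis M \<Longrightarrow> par M b = i \<Longrightarrow> p \<in> pring (bvars M) \<Longrightarrow> homogeneous p (k - bdeg M b) \<Longrightarrow>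
    Poly_Mapping.single b p \<in> bgrade M i k"
  by (auto simp: bgrade_def bcar_single lookup_single when_def)

lemma abelian_group_bmodule: "abelian_group (bmodule M i)"
  by (rule abelian_groupI) (auto simp: algebra_simps intro!: bexI[of _ "- _"])

lemma a_inv_bmodule: "v \<in> bcar M i \<Longrightarrow> \<ominus>\<^bsub>bmodule M i\<^esub> v = - v"
  using abelian_group.minus_equality[OF abelian_group_bmodule[of M i], of "- v" v] by auto

lemma a_minus_bmodule [simp]:
  "u \<in> bcar M i \<Longrightarrow> v \<in> bcar M i \<Longrightarrow> u \<ominus>\<^bsub>bmodule M i\<^esub> v = u - v"
  by (simp add: a_minus_def a_inv_bmodule)

lemma finsum_bmodule:
  assumes "\<And>x. x \<in> A \<Longrightarrow> f x \<in> bcar M i" "finite A"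
  shows "finsum (bmodule M i) f A = sum f A"
proof -
  interpret abelian_group "bmodule M i" by (rule abelian_group_bmodule)
  show ?thesis using assms(2,1) by (induction A rule: finite_induct) auto
qed

text \<open>The axioms of a graded factorization, tested on basis elements and over the ring in
  \<open>bvars M\<close>. They pass to every smaller polynomial ring that contains the
  potential.\<close>

definition bfact_ok :: "nat \<Rightarrow> qpoly \<Rightarrow> 'b bfact \<Rightarrow> bool" where
  "bfact_ok n w M \<longleftrightarrow> finite (bvars M) \<and> w \<in> pring (bvars M) \<and> homogeneous w (2 * (int n + 1)) \<and>
     (\<forall>b\<in>basis M. bdiff M b \<in> bgrade M (par M b + 1) (bdeg M b + int n + 1) \<and>
        lin (bdiff M) (bdiff M b) = Poly_Mapping.single b w)"

lemma lin_bcar: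
  assumes "\<And>b. b \<in> basis M \<Longrightarrow> \<psi> b \<in> bcar N (par M b + j)" "bvars M \<subseteq> bvars N" "v \<in> bcar M i"
  shows "lin \<psi> v \<in> bcar N (i + j)"
  unfolding lin_def using assms
  by (intro bcar_sum bcar_scale pring_mono[OF bcar_lookup[OF assms(3)] assms(2)])
    (auto simp: bcar_def in_keys_iff)

lemma lin_bgrade:
  assumes "\<And>b. b \<in> basis M \<Longrightarrow> \<psi> b \<in> bgrade N (par M b + j) (bdeg M b + l)" "bvars M \<subseteq> bvars N" "v \<in> bgrade M i k"
  shows "lin \<psi> v \<in> bgrade N (i + j) (k + l)"
proof -
  have v: "v \<in> bcar M i" using assms(3) by (rule bgrade_bcar)
  have "scale (Poly_Mapping.lookup v b) (\<psi> b) \<in> bgrade N (i + j) (k + l)" if "b \<in> Poly_Mapping.keys v" for b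
  proof (rule bgrade_scale)
    show "\<psi> b \<in> bgrade N (i + j) (bdeg M b + l)" using assms(1)[of b] that v by (auto simp: bcar_def in_keys_iff)
    show "Poly_Mapping.lookup v b \<in> pring (bvars N)" using pring_mono[OF bcar_lookup[OF v] assms(2)] .
    show "homogeneous (Poly_Mapping.lookup v b) (k - bdeg M b)" using assms(3) by (simp add: bgrade_def)
  qed simp
  then show ?thesis unfolding lin_def by (rule bgrade_sum)
qed

lemma bdiff_bcar: "bfact_ok n w M \<Longrightarrow> v \<in> bcar M i \<Longrightarrow> lin (bdiff M) v \<in> bcar M (i + 1)"
  by (rule lin_bcar) (auto simp: bfact_ok_def bgrade_def)

lemma bdiff_bgrade: "bfact_ok n w M \<Longrightarrow> v \<in> bgrade M i k \<Longrightarrow> lin (bdiff M) v \<in> bgrade M (i + 1) (k + (int n + 1))"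
  by (rule lin_bgrade) (auto simp: bfact_ok_def algebra_simps)

lemma bdiff_bdiff:
  assumes "bfact_ok n w M" "v \<in> bcar M i"
  shows "lin (bdiff M) (lin (bdiff M) v) = scale w v"
proof -
  have "lin (\<lambda>b. lin (bdiff M) (bdiff M b)) v = lin (\<lambda>b. Poly_Mapping.single b w) v"
    using assms by (intro lin_cong) (auto simp: bfact_ok_def bcar_def in_keys_iff)
  then show ?thesis by (simp add: lin_lin)
qed

subsection \<open>Freeness over a smaller polynomial ring\<close>

lemma module_bmodule:
  assumes "V \<subseteq> bvars M"
  shows "Module.module (poly_ring V) (bmodule M i)"
proof (rule moduleI)
  have "p \<in> pring (bvars M)" if "p \<in> pring V" for p
    using pring_mono[OF that assms] .
  then show "p \<odot>\<^bsub>bmodule M i\<^esub> x \<in> carrier (bmodule M i)"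
    if "p \<in> pring V" "x \<in> carrier (bmodule M i)" for p x
    using that by auto
qed (simp_all add: cring_poly_ring abelian_group_bmodule scale_add_left scale_add_right)

definition vhcomp :: "'b bfact \<Rightarrow> int \<Rightarrow> ('b \<Rightarrow>\<^sub>0 qpoly) \<Rightarrow> 'b \<Rightarrow>\<^sub>0 qpoly" where
  "vhcomp M k v = (\<Sum>b\<in>Poly_Mapping.keys v. Poly_Mapping.single b (hcomp (k - bdeg M b) (Poly_Mapping.lookup v b)))"

lemma lookup_vhcomp: "Poly_Mapping.lookup (vhcomp M k v) b = hcomp (k - bdeg M b) (Poly_Mapping.lookup v b)"
  by (auto simp: vhcomp_def lookup_sum lookup_single when_def sum.delta in_keys_iff)

lemma vhcomp_bgrade:
  assumes "v \<in> bcar M i"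
  shows "vhcomp M k v \<in> bgrade M i k"
proof -
  have "Poly_Mapping.lookup v b \<noteq> 0" if "Poly_Mapping.lookup (vhcomp M k v) b \<noteq> 0" for b
    using that by (auto simp: lookup_vhcomp)
  then show ?thesis using assms by (auto simp: bgrade_def bcar_def lookup_vhcomp)
qed

lemma vhcomp_of_bgrade:
  assumes "v \<in> bgrade M i l"
  shows "vhcomp M k v = (if k = l then v else 0)"
proof (rule poly_mapping_eqI)
  fix b
  have "homogeneous (Poly_Mapping.lookup v b) (l - bdeg M b)" using assms by (simp add: bgrade_def)
  from hcomp_homogeneous[OF this, of "k - bdeg M b"]
  show "Poly_Mapping.lookup (vhcomp M k v) b = Poly_Mapping.lookup (if k = l then v else 0) b"
    by (simp add: lookup_vhcomp)
qed

lemma vhcomp_sum: "vhcomp M k (sum f A) = (\<Sum>i\<in>A. vhcomp M k (f i))"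
  by (rule poly_mapping_eqI) (simp add: lookup_vhcomp lookup_sum hcomp_sum)

lemma vhcomp_decomp:
  obtains K where "finite K" "{k. vhcomp M k v \<noteq> 0} \<subseteq> K" "(\<Sum>k\<in>K. vhcomp M k v) = v"
proof
  let ?K = "\<Union>b\<in>Poly_Mapping.keys v. (\<lambda>m. bdeg M b + mono_deg m) ` Poly_Mapping.keys (Poly_Mapping.lookup v b)"
  have K: "vhcomp M k v = 0" if "k \<notin> ?K" for k
  proof (rule poly_mapping_eqI)
    fix b
    have "k - bdeg M b \<notin> mono_deg ` Poly_Mapping.keys (Poly_Mapping.lookup v b)"
    proof
      assume "k - bdeg M b \<in> mono_deg ` Poly_Mapping.keys (Poly_Mapping.lookup v b)"
      then obtain m where "m \<in> Poly_Mapping.keys (Poly_Mapping.lookup v b)" "k = bdeg M b + mono_deg m" by auto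
      moreover from this have "b \<in> Poly_Mapping.keys v" by (auto simp: in_keys_iff)
      ultimately show False using that by auto
    qed
    then show "Poly_Mapping.lookup (vhcomp M k v) b = Poly_Mapping.lookup 0 b"
      by (simp add: lookup_vhcomp hcomp_eq_0)
  qed
  then show "{k. vhcomp M k v \<noteq> 0} \<subseteq> ?K" by blast
  show "finite ?K" by simp
  show "(\<Sum>k\<in>?K. vhcomp M k v) = v"
  proof (rule poly_mapping_eqI)
    fix b
    let ?p = "Poly_Mapping.lookup v b"
    have "(\<Sum>k\<in>?K. hcomp (k - bdeg M b) ?p) = (\<Sum>d\<in>(\<lambda>k. k - bdeg M b) ` ?K. hcomp d ?p)"
      by (subst sum.reindex) (auto simp: inj_on_def)
    also have "\<dots> = ?p"
    proof (rule hcomp_decomp)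
      show "mono_deg ` Poly_Mapping.keys ?p \<subseteq> (\<lambda>k. k - bdeg M b) ` ?K"
      proof
        fix d assume "d \<in> mono_deg ` Poly_Mapping.keys ?p"
        then obtain m where m: "m \<in> Poly_Mapping.keys ?p" "d = mono_deg m" by auto
        then have "b \<in> Poly_Mapping.keys v" by (auto simp: in_keys_iff)
        with m have "bdeg M b + d \<in> ?K" by auto
        then show "d \<in> (\<lambda>k. k - bdeg M b) ` ?K" by (intro image_eqI[of _ _ "bdeg M b + d"]) auto
      qed
    qed simp
    finally show "Poly_Mapping.lookup (\<Sum>k\<in>?K. vhcomp M k v) b = ?p"
      by (simp add: lookup_sum lookup_vhcomp)
  qed
qed

lemma is_graded_bmodule:
  assumes V: "V \<subseteq> bvars M"
  shows "is_graded V (bmodule M i)"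
  unfolding is_graded_def bmodule_simps
proof (intro conjI allI ballI impI)
  fix k
  show "additive_subgroup (bgrade M i k) (bmodule M i)"
  proof (intro additive_subgroup.intro subgroup.intro)
    fix x assume "x \<in> bgrade M i k"
    then show "inv\<^bsub>add_monoid (bmodule M i)\<^esub> x \<in> bgrade M i k"
      using a_inv_bmodule[of x M i] by (auto simp: a_inv_def bgrade_bcar)
  qed (auto simp: bgrade_bcar)
next
  fix k l r x
  assume "r \<in> pring V" "x \<in> bgrade M i l" "homogeneous r k"
  then show "scale r x \<in> bgrade M i (k + l)"
    using pring_mono[OF _ V] by (intro bgrade_scale[of x M i l]) auto
next
  fix x assume x: "x \<in> bcar M i"
  show "\<exists>!c. (\<forall>k. c k \<in> bgrade M i k) \<and> finite {k. c k \<noteq> 0} \<and> x = (\<Oplus>\<^bsub>bmodule M i\<^esub>k\<in>{k. c k \<noteq> 0}. c k)"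
  proof (rule ex1I)
    let ?c = "\<lambda>k. vhcomp M k x"
    obtain K where K: "finite K" "{k. ?c k \<noteq> 0} \<subseteq> K" "(\<Sum>k\<in>K. ?c k) = x"
      by (rule vhcomp_decomp)
    have fin: "finite {k. ?c k \<noteq> 0}" using K finite_subset by blast
    have "(\<Sum>k\<in>{k. ?c k \<noteq> 0}. ?c k) = (\<Sum>k\<in>K. ?c k)"
      using K by (intro sum.mono_neutral_left) auto
    with K(3) show "(\<forall>k. ?c k \<in> bgrade M i k) \<and> finite {k. ?c k \<noteq> 0} \<and> x = (\<Oplus>\<^bsub>bmodule M i\<^esub>k\<in>{k. ?c k \<noteq> 0}. ?c k)"
      using x fin by (subst finsum_bmodule) (auto intro: vhcomp_bgrade bgrade_bcar)
  next
    fix c assume c: "(\<forall>k. c k \<in> bgrade M i k) \<and> finite {k. c k \<noteq> 0} \<and> x = (\<Oplus>\<^bsub>bmodule M i\<^esub>k\<in>{k. c k \<noteq> 0}. c k)"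
    moreover have "(\<Oplus>\<^bsub>bmodule M i\<^esub>k\<in>{k. c k \<noteq> 0}. c k) = (\<Sum>k\<in>{k. c k \<noteq> 0}. c k)"
      using c by (intro finsum_bmodule) (auto intro: bgrade_bcar)
    ultimately have x: "x = (\<Sum>k\<in>{k. c k \<noteq> 0}. c k)" by simp
    have "vhcomp M k x = c k" for k
    proof -
      have "vhcomp M k (c l) = (if k = l then c l else 0)" for l
        using c by (intro vhcomp_of_bgrade) auto
      then have "vhcomp M k x = (\<Sum>l\<in>{k. c k \<noteq> 0}. if k = l then c l else 0)"
        unfolding x vhcomp_sum by (intro sum.cong) auto
      then show ?thesis using c by (simp add: sum.delta)
    qed
    then show "c = (\<lambda>k. vhcomp M k x)" by auto
  qed
qed

declare add_bit_eq_xor [simp del] \<comment> \<open>keeps sums of parities in additive form\<close>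

lemma bit_cases: "i = 0 \<or> i = (1::bit)" by auto
lemma bit_add_self [simp]: "i + i = (0::bit)" using bit_cases[of i] by auto
lemma bit_add_add_self [simp]: "i + j + j = (i::bit)" by (simp add: add.assoc)
lemma bit_diff_eq_add: "i - j = i + (j::bit)" by (simp add: diff_eq_eq)

text \<open>A monomial factors uniquely into a part in the variables of \<open>V\<close> and a part
  in the others, so the coefficients of \<open>p\<close> reappear exactly at the exponents
  \<open>t + m'\<close>.\<close>

lemma lookup_mult_monomial:
  assumes p: "p \<in> pring V" and t: "Poly_Mapping.keys t \<subseteq> V"
    and m: "Poly_Mapping.keys m \<inter> V = {}" "Poly_Mapping.keys m' \<inter> V = {}"
  shows "Poly_Mapping.lookup (p * Poly_Mapping.single m' 1) (t + m) = (if m = m' then Poly_Mapping.lookup p t else 0)"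
proof -
  have eq: "t' + m' = t + m \<longleftrightarrow> t' = t \<and> m' = m" if "t' \<in> Poly_Mapping.keys p" for t'
  proof
    assume *: "t' + m' = t + m"
    have "Poly_Mapping.lookup t' i = Poly_Mapping.lookup t i \<and> Poly_Mapping.lookup m' i = Poly_Mapping.lookup m i" for i
    proof (cases "i \<in> V")
      case True
      then have "Poly_Mapping.lookup m i = 0" "Poly_Mapping.lookup m' i = 0"
        using m by (auto simp: not_in_keys_iff_lookup_eq_zero[symmetric])
      then show ?thesis using arg_cong[OF *, of "\<lambda>x. Poly_Mapping.lookup x i"] by (simp add: lookup_add)
    next
      case False
      then have "Poly_Mapping.lookup t i = 0" "Poly_Mapping.lookup t' i = 0"
        using p t that by (auto simp: pring_iff not_in_keys_iff_lookup_eq_zero[symmetric])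
      then show ?thesis using arg_cong[OF *, of "\<lambda>x. Poly_Mapping.lookup x i"] by (simp add: lookup_add)
    qed
    then show "t' = t \<and> m' = m" by (auto intro: poly_mapping_eqI)
  qed simp
  have "p * Poly_Mapping.single m' 1 =
      (\<Sum>t'\<in>Poly_Mapping.keys p. Poly_Mapping.single (t' + m') (Poly_Mapping.lookup p t'))"
    by (subst poly_mapping_sum_singles) (simp add: sum_distrib_right mult_single)
  then have "Poly_Mapping.lookup (p * Poly_Mapping.single m' 1) (t + m) =
      (\<Sum>t'\<in>Poly_Mapping.keys p. if t' = t then (if m = m' then Poly_Mapping.lookup p t else 0) else 0)"
    by (simp only: lookup_sum lookup_single when_def) (intro sum.cong refl, auto simp: eq)
  then show ?thesis by (auto simp: sum.delta in_keys_iff)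
qed

text \<open>The ring in \<open>bvars M\<close> is free over the ring in \<open>V\<close> on the
  monomials in the remaining variables; these are multiplied with the basis elements of
  \<open>M\<close>. In general the result is infinite.\<close>

definition mono_basis :: "nat set \<Rightarrow> 'b bfact \<Rightarrow> bit \<Rightarrow> ('b \<Rightarrow>\<^sub>0 qpoly) set" where
  "mono_basis V M i =
     {Poly_Mapping.single b (Poly_Mapping.single m 1) |b m.
        b \<in> basis M \<and> par M b = i \<and> Poly_Mapping.keys m \<subseteq> bvars M - V}"

lemma mono_basis_grade: "mono_basis V M i \<subseteq> (\<Union>k. bgrade M i k)"
proof
  fix e assume "e \<in> mono_basis V M i"
  then obtain b m where e: "e = Poly_Mapping.single b (Poly_Mapping.single m 1)"
    and "b \<in> basis M" "par M b = i" "Poly_Mapping.keys m \<subseteq> bvars M - V"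
    by (auto simp: mono_basis_def)
  then have "e \<in> bgrade M i (mono_deg m + bdeg M b)"
    unfolding e by (intro bgrade_single) (auto simp: pring_iff homogeneous_single)
  then show "e \<in> (\<Union>k. bgrade M i k)" by blast
qed

lemma mono_basis_bcar: "e \<in> mono_basis V M i \<Longrightarrow> e \<in> bcar M i"
  using mono_basis_grade bgrade_bcar by blast

definition in_span :: "nat set \<Rightarrow> ('b \<Rightarrow>\<^sub>0 qpoly) set \<Rightarrow> ('b \<Rightarrow>\<^sub>0 qpoly) \<Rightarrow> bool" where
  "in_span V B x \<longleftrightarrow> (\<exists>c. (\<forall>e. c e \<in> pring V) \<and> finite {e. c e \<noteq> 0} \<and> {e. c e \<noteq> 0} \<subseteq> B \<and>
      x = (\<Sum>e\<in>{e. c e \<noteq> 0}. scale (c e) e))"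

lemma in_span_add:
  assumes "in_span V B x" "in_span V B y"
  shows "in_span V B (x + y)"
proof -
  obtain c where c: "\<And>e. c e \<in> pring V" "finite {e. c e \<noteq> 0}" "{e. c e \<noteq> 0} \<subseteq> B"
    "x = (\<Sum>e\<in>{e. c e \<noteq> 0}. scale (c e) e)" using assms(1) by (auto simp: in_span_def)
  obtain d where d: "\<And>e. d e \<in> pring V" "finite {e. d e \<noteq> 0}" "{e. d e \<noteq> 0} \<subseteq> B"
    "y = (\<Sum>e\<in>{e. d e \<noteq> 0}. scale (d e) e)" using assms(2) by (auto simp: in_span_def)
  let ?U = "{e. c e \<noteq> 0} \<union> {e. d e \<noteq> 0}"
  have sub: "{e. c e + d e \<noteq> 0} \<subseteq> ?U" by auto
  have "(\<Sum>e\<in>{e. c e + d e \<noteq> 0}. scale (c e + d e) e) = (\<Sum>e\<in>?U. scale (c e + d e) e)"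
    using c d sub by (intro sum.mono_neutral_left) auto
  also have "\<dots> = (\<Sum>e\<in>?U. scale (c e) e) + (\<Sum>e\<in>?U. scale (d e) e)"
    by (simp add: scale_add_left sum.distrib)
  also have "(\<Sum>e\<in>?U. scale (c e) e) = x" unfolding c(4) using c d by (intro sum.mono_neutral_right) auto
  also have "(\<Sum>e\<in>?U. scale (d e) e) = y" unfolding d(4) using c d by (intro sum.mono_neutral_right) auto
  finally have "x + y = (\<Sum>e\<in>{e. c e + d e \<noteq> 0}. scale (c e + d e) e)" by simp
  moreover have "finite {e. c e + d e \<noteq> 0}" using sub c d finite_subset by blast
  ultimately show ?thesis
    unfolding in_span_def using c d sub by (intro exI[of _ "\<lambda>e. c e + d e"]) auto
qed

lemma in_span_sum: "(\<And>i. i \<in> A \<Longrightarrow> in_span V B (f i)) \<Longrightarrow> in_span V B (sum f A)"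
proof (induction A rule: infinite_finite_induct)
  case (insert x F)
  then show ?case by (simp add: in_span_add)
qed (auto simp: in_span_def intro!: exI[of _ "\<lambda>_. 0"])

lemma in_span_scale: "e \<in> B \<Longrightarrow> p \<in> pring V \<Longrightarrow> in_span V B (scale p e)"
proof (cases "p = 0")
  case True
  then show ?thesis using in_span_sum[of "{}" V B] by simp
next
  case False
  assume "e \<in> B" "p \<in> pring V"
  with False show ?thesis
    unfolding in_span_def by (intro exI[of _ "\<lambda>e'. if e' = e then p else 0"]) auto
qed

lemma in_span_mono_basis:
  assumes x: "x \<in> bcar M i" and V: "V \<subseteq> bvars M"
  shows "in_span V (mono_basis V M i) x"
proof -
  have "in_span V (mono_basis V M i) (Poly_Mapping.single b (Poly_Mapping.single t a))"
    if b: "b \<in> basis M" "par M b = i" and t: "Poly_Mapping.keys t \<subseteq> bvars M" for b t a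
  proof -
    \<comment> \<open>\<open>r W\<close> is the part of the monomial \<open>t\<close> supported on
      \<open>W\<close>. The part on \<open>V\<close> becomes a coefficient, the part off
      \<open>V\<close> belongs to the basis element.\<close>
    define r where "r W = (\<Sum>i\<in>Poly_Mapping.keys t \<inter> W. Poly_Mapping.single i (Poly_Mapping.lookup t i))" for W
    have rt: "r V + r (- V) = t"
      unfolding r_def by (subst sum.union_disjoint[symmetric]) (auto simp flip: Int_Un_distrib poly_mapping_sum_singles)
    have keys_r: "Poly_Mapping.keys (r W) \<subseteq> Poly_Mapping.keys t \<inter> W" for W
      unfolding r_def using keys_sum by (fastforce split: if_splits)
    have "Poly_Mapping.single b (Poly_Mapping.single t a) =
        scale (Poly_Mapping.single (r V) a) (Poly_Mapping.single b (Poly_Mapping.single (r (- V)) 1))"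
      by (simp add: mult_single rt)
    also have "in_span V (mono_basis V M i) \<dots>"
    proof (rule in_span_scale)
      show "Poly_Mapping.single b (Poly_Mapping.single (r (- V)) 1) \<in> mono_basis V M i"
        unfolding mono_basis_def using keys_r[of "- V"] b t
        by (intro CollectI exI conjI refl) auto
      show "Poly_Mapping.single (r V) a \<in> pring V" using keys_r[of V] by (auto simp: pring_iff)
    qed
    finally show ?thesis .
  qed
  moreover have "Poly_Mapping.single b (Poly_Mapping.lookup x b) =
      (\<Sum>t\<in>Poly_Mapping.keys (Poly_Mapping.lookup x b).
        Poly_Mapping.single b (Poly_Mapping.single t (Poly_Mapping.lookup (Poly_Mapping.lookup x b) t)))" for b
  proof -
    have "Poly_Mapping.single b (sum f A) = (\<Sum>t\<in>A. Poly_Mapping.single b (f t))"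
      for f :: "(nat \<Rightarrow>\<^sub>0 nat) \<Rightarrow> qpoly" and A
      by (induction A rule: infinite_finite_induct) (auto simp: single_add)
    from this[symmetric] show ?thesis by (simp flip: poly_mapping_sum_singles)
  qed
  ultimately have "in_span V (mono_basis V M i) (Poly_Mapping.single b (Poly_Mapping.lookup x b))"
    if "b \<in> Poly_Mapping.keys x" for b
    using x that by (auto simp: bcar_def pring_iff in_keys_iff intro!: in_span_sum)
  then have "in_span V (mono_basis V M i) (\<Sum>b\<in>Poly_Mapping.keys x. Poly_Mapping.single b (Poly_Mapping.lookup x b))"
    by (rule in_span_sum)
  then show ?thesis by (simp flip: poly_mapping_sum_singles)
qed

text \<open>The exponent \<open>t + m\<close> in position \<open>b\<close> sees only one basis
  element, and there the coefficient of its multiplier at \<open>t\<close> can be read off. This is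
  the uniqueness half of the basis property.\<close>

lemma mono_basis_coefficient:
  assumes c: "\<And>e. c e \<in> pring V" "finite {e. c e \<noteq> 0}" "{e. c e \<noteq> 0} \<subseteq> mono_basis V M i"
    and m: "Poly_Mapping.keys m \<subseteq> bvars M - V" and t: "Poly_Mapping.keys t \<subseteq> V"
  shows "Poly_Mapping.lookup (Poly_Mapping.lookup (\<Sum>e\<in>{e. c e \<noteq> 0}. scale (c e) e) b) (t + m) =
    Poly_Mapping.lookup (c (Poly_Mapping.single b (Poly_Mapping.single m 1))) t"
proof -
  let ?e = "Poly_Mapping.single b (Poly_Mapping.single m (1::rat))"
  have "Poly_Mapping.lookup (Poly_Mapping.lookup (scale (c e) e) b) (t + m) =
      (if e = ?e then Poly_Mapping.lookup (c ?e) t else 0)" if e: "e \<in> {e. c e \<noteq> 0}" for e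
  proof -
    obtain b' m' where e': "e = Poly_Mapping.single b' (Poly_Mapping.single m' 1)" "Poly_Mapping.keys m' \<subseteq> bvars M - V"
      using e c(3) by (auto simp: mono_basis_def)
    show ?thesis
    proof (cases "b' = b")
      case True
      have "e = ?e \<longleftrightarrow> m' = m"
      proof
        assume "e = ?e"
        then have "Poly_Mapping.single m' (1::rat) = Poly_Mapping.single m 1"
          using True e' by (metis lookup_single_eq)
        then have "Poly_Mapping.keys (Poly_Mapping.single m' (1::rat)) = Poly_Mapping.keys (Poly_Mapping.single m (1::rat))"
          by simp
        then show "m' = m" by simp
      qed (use True e' in simp)
      moreover have "Poly_Mapping.lookup (c e * Poly_Mapping.single m' 1) (t + m) = (if m = m' then Poly_Mapping.lookup (c e) t else 0)"
        using m e'(2) by (intro lookup_mult_monomial[OF c(1) t]) auto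
      ultimately show ?thesis using True e' by auto
    next
      case False
      then have "e \<noteq> ?e" using e' by (metis lookup_single_eq lookup_single_not_eq lookup_zero zero_neq_one)
      with False show ?thesis by (simp add: e' lookup_single_not_eq)
    qed
  qed
  then have "Poly_Mapping.lookup (Poly_Mapping.lookup (\<Sum>e\<in>{e. c e \<noteq> 0}. scale (c e) e) b) (t + m) =
      (\<Sum>e\<in>{e. c e \<noteq> 0}. if e = ?e then Poly_Mapping.lookup (c ?e) t else 0)"
    by (simp add: lookup_sum)
  then show ?thesis using c(2) by (simp add: sum.delta)
qed

lemma free_gmodule_bmodule:
  assumes V: "V \<subseteq> bvars M"
  shows "free_gmodule V (bmodule M i)"
  unfolding free_gmodule_def
proof (intro conjI exI)
  let ?B = "mono_basis V M i"
  show "Module.module (poly_ring V) (bmodule M i)" "is_graded V (bmodule M i)"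
    using V by (auto intro: module_bmodule is_graded_bmodule)
  show "?B \<subseteq> (\<Union>k. grade (bmodule M i) k)" using mono_basis_grade by simp
  have sum_eq: "(\<Oplus>\<^bsub>bmodule M i\<^esub>e\<in>{e. c e \<noteq> 0}. c e \<odot>\<^bsub>bmodule M i\<^esub> e) = (\<Sum>e\<in>{e. c e \<noteq> 0}. scale (c e) e)"
    if "\<And>e. c e \<in> pring V" "finite {e. c e \<noteq> 0}" "{e. c e \<noteq> 0} \<subseteq> ?B" for c
    unfolding bmodule_simps
  proof (rule finsum_bmodule[OF _ that(2)])
    fix e assume "e \<in> {e. c e \<noteq> 0}"
    then show "scale (c e) e \<in> bcar M i"
      using that(3) by (intro bcar_scale[OF mono_basis_bcar pring_mono[OF that(1) V]]) blast
  qed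
  show "is_basis V (bmodule M i) ?B"
    unfolding is_basis_def
  proof (intro conjI ballI)
    show "?B \<subseteq> carrier (bmodule M i)" using mono_basis_bcar by auto
    fix x assume "x \<in> carrier (bmodule M i)"
    then have "in_span V ?B x" using V by (intro in_span_mono_basis) auto
    then obtain c where c: "\<And>e. c e \<in> pring V" "finite {e. c e \<noteq> 0}" "{e. c e \<noteq> 0} \<subseteq> ?B"
      "x = (\<Sum>e\<in>{e. c e \<noteq> 0}. scale (c e) e)" by (auto simp: in_span_def)
    show "\<exists>!c. (\<forall>b. c b \<in> pring V) \<and> finite {b. c b \<noteq> 0} \<and> {b. c b \<noteq> 0} \<subseteq> ?B \<and>
        x = (\<Oplus>\<^bsub>bmodule M i\<^esub>b\<in>{b. c b \<noteq> 0}. c b \<odot>\<^bsub>bmodule M i\<^esub> b)"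
    proof (rule ex1I)
      show "(\<forall>b. c b \<in> pring V) \<and> finite {b. c b \<noteq> 0} \<and> {b. c b \<noteq> 0} \<subseteq> ?B \<and>
        x = (\<Oplus>\<^bsub>bmodule M i\<^esub>b\<in>{b. c b \<noteq> 0}. c b \<odot>\<^bsub>bmodule M i\<^esub> b)"
        using c sum_eq[OF c(1-3)] by simp
    next
      fix d assume *: "(\<forall>b. d b \<in> pring V) \<and> finite {b. d b \<noteq> 0} \<and> {b. d b \<noteq> 0} \<subseteq> ?B \<and>
        x = (\<Oplus>\<^bsub>bmodule M i\<^esub>b\<in>{b. d b \<noteq> 0}. d b \<odot>\<^bsub>bmodule M i\<^esub> b)"
      then have d: "\<And>e. d e \<in> pring V" "finite {e. d e \<noteq> 0}" "{e. d e \<noteq> 0} \<subseteq> ?B" by auto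
      have dx: "x = (\<Sum>e\<in>{e. d e \<noteq> 0}. scale (d e) e)" using * sum_eq[OF d] by simp
      have "d e = c e" for e
      proof (cases "e \<in> ?B")
        case True
        then obtain b m where e: "e = Poly_Mapping.single b (Poly_Mapping.single m 1)"
          and m: "Poly_Mapping.keys m \<subseteq> bvars M - V" by (auto simp: mono_basis_def)
        have "Poly_Mapping.lookup (d e) t = Poly_Mapping.lookup (c e) t" if t: "Poly_Mapping.keys t \<subseteq> V" for t
          using mono_basis_coefficient[OF d m t, of b] mono_basis_coefficient[OF c(1-3) m t, of b] dx c(4) e
          by simp
        moreover have "Poly_Mapping.lookup (d e) t = Poly_Mapping.lookup (c e) t" if "\<not> Poly_Mapping.keys t \<subseteq> V" for t
          using that c(1)[of e] d(1)[of e] by (metis in_keys_iff pring_iff)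
        ultimately show ?thesis by (intro poly_mapping_eqI) blast
      next
        case False
        then have "d e = 0" "c e = 0" using c(3) d(3) by auto
        then show ?thesis by simp
      qed
      then show "d = c" by auto
    qed
  qed
qed

lemma graded_factorization_fact_of:
  assumes ok: "bfact_ok n w M" and V: "V \<subseteq> bvars M" "w \<in> pring V"
  shows "graded_factorization n V w (fact_of M)"
  unfolding graded_factorization_def
proof (intro conjI allI ballI)
  have fin: "finite (bvars M)" "homogeneous w (2 * (int n + 1))" using ok by (auto simp: bfact_ok_def)
  then show "finite V" "homogeneous w (2 * (int n + 1))" using V finite_subset by auto
  show "w \<in> carrier (poly_ring V)" by fact
  fix i
  show "free_gmodule V (module_at (fact_of M) i)" using free_gmodule_bmodule[OF V(1)] by simp
  show "linear_map V (module_at (fact_of M) i) (module_at (fact_of M) (i + 1)) (diff (fact_of M) i)"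
    using bdiff_bcar[OF ok] by (auto simp: linear_map_def lin_add lin_scale)
  show "has_degree (module_at (fact_of M) i) (module_at (fact_of M) (i + 1)) (int n + 1) (diff (fact_of M) i)"
    using bdiff_bgrade[OF ok] by (auto simp: has_degree_def)
  fix x assume "x \<in> carrier (module_at (fact_of M) i)"
  then show "diff (fact_of M) (i + 1) (diff (fact_of M) i x) = w \<odot>\<^bsub>module_at (fact_of M) i\<^esub> x"
    using bdiff_bdiff[OF ok] by simp
qed

subsection \<open>Constructions\<close>

text \<open>A Koszul row with a prescribed degree \<open>d\<close> of the odd generator. No degree
  is read off from the entry \<open>a\<close>, so the row can be used after a substitution without
  knowing that \<open>a\<close> is still nonzero.\<close>

definition rank1_fact :: "nat set \<Rightarrow> int \<Rightarrow> qpoly \<Rightarrow> qpoly \<Rightarrow> bit bfact" where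
  "rank1_fact V d a b =
     \<lparr>bvars = V, basis = UNIV, par = (\<lambda>i. i), bdeg = (\<lambda>i. if i = 0 then 0 else d),
      bdiff = (\<lambda>i. Poly_Mapping.single (i + 1) (if i = 0 then a else b))\<rparr>"

lemma koszul_eq_rank1_fact: "koszul n V a b = rank1_fact V (int n + 1 - poly_deg a) a b"
  by (simp add: koszul_def rank1_fact_def)

lemma bfact_ok_rank1_fact:
  assumes "finite V" "a \<in> pring V" "b \<in> pring V" "homogeneous a (int n + 1 - d)" "homogeneous b (int n + 1 + d)"
  shows "bfact_ok n (a * b) (rank1_fact V d a b)"
proof -
  show ?thesis
    unfolding bfact_ok_def
  proof (intro conjI ballI)
    show "homogeneous (a * b) (2 * (int n + 1))"
      using homogeneous_mult[OF assms(4,5)] by (simp add: algebra_simps)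
    fix i
    show "bdiff (rank1_fact V d a b) i \<in> bgrade (rank1_fact V d a b) (par (rank1_fact V d a b) i + 1)
         (bdeg (rank1_fact V d a b) i + int n + 1)"
      using assms bit_cases[of i] by (auto simp: rank1_fact_def algebra_simps intro!: bgrade_single)
    show "lin (bdiff (rank1_fact V d a b)) (bdiff (rank1_fact V d a b) i) = Poly_Mapping.single i (a * b)"
      using bit_cases[of i] by (auto simp: rank1_fact_def mult.commute)
  qed (use assms in \<open>auto simp: rank1_fact_def\<close>)
qed

lemma bfact_ok_grade_shift:
  assumes "bfact_ok n w M"
  shows "bfact_ok n w (grade_shift m M)"
proof -
  have "bcar (grade_shift m M) i = bcar M i" for i by (simp add: bcar_def grade_shift_def)
  then have "bgrade (grade_shift m M) i (k + m) = bgrade M i k" for i k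
    by (simp add: bgrade_def grade_shift_def)
  from this[of _ "bdeg M _ + int n + 1"] show ?thesis
    using assms by (auto simp: bfact_ok_def grade_shift_def algebra_simps)
qed

lemma bfact_ok_parity_shift:
  assumes "bfact_ok n w M"
  shows "bfact_ok n w (parity_shift M)"
proof -
  have par: "par M b + 1 = i \<longleftrightarrow> par M b = i + 1" for b and i :: bit by (metis bit_add_add_self)
  have "bcar (parity_shift M) i = bcar M (i + 1)" for i
    by (simp add: bcar_def parity_shift_def par)
  then have "bgrade (parity_shift M) i k = bgrade M (i + 1) k" for i k
    by (simp add: bgrade_def parity_shift_def)
  moreover have "lin (\<lambda>b. - \<psi> b) v = - lin \<psi> v" for \<psi> :: "'a \<Rightarrow> 'a \<Rightarrow>\<^sub>0 qpoly" and v
    by (simp add: lin_def scale_uminus_right sum_negf)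
  ultimately show ?thesis
    using assms by (auto simp: bfact_ok_def parity_shift_def lin_uminus bgrade_uminus)
qed

lemma lookup_elem_tensor [simp]:
  "Poly_Mapping.lookup (elem_tensor u v) (b, c) = Poly_Mapping.lookup u b * Poly_Mapping.lookup v c"
proof -
  have "Poly_Mapping.lookup (elem_tensor u v) (b, c) =
      (\<Sum>b'\<in>Poly_Mapping.keys u. if b' = b then (\<Sum>c'\<in>Poly_Mapping.keys v. if c' = c then Poly_Mapping.lookup u b * Poly_Mapping.lookup v c else 0) else 0)"
    unfolding elem_tensor_def lookup_sum by (intro sum.cong refl) (auto simp: lookup_single when_def intro!: sum.cong sum.neutral)
  then show ?thesis by (auto simp: sum.delta in_keys_iff)
qed

lemma elem_tensor_bgrade:
  assumes "u \<in> bgrade M i k" "v \<in> bgrade N j l" "m = k + l" "i' = i + j"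
  shows "elem_tensor u v \<in> bgrade (M \<otimes>\<^sub>f N) i' m"
proof -
  have u: "u \<in> bcar M i" and v: "v \<in> bcar N j" using assms by (auto simp: bgrade_def)
  have "elem_tensor u v \<in> bcar (M \<otimes>\<^sub>f N) (i + j)"
    unfolding bcar_def
  proof (intro CollectI allI impI)
    fix x assume x: "Poly_Mapping.lookup (elem_tensor u v) x \<noteq> 0"
    obtain b c where [simp]: "x = (b, c)" by (cases x)
    have "Poly_Mapping.lookup u b \<noteq> 0" "Poly_Mapping.lookup v c \<noteq> 0" using x by auto
    then have "b \<in> basis M \<and> par M b = i" "c \<in> basis N \<and> par N c = j"
      using u v by (auto simp: bcar_def)
    moreover have "Poly_Mapping.lookup u b * Poly_Mapping.lookup v c \<in> pring (bvars M \<union> bvars N)"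
      using pring_mono[OF bcar_lookup[OF u], of "bvars M \<union> bvars N" b]
        pring_mono[OF bcar_lookup[OF v], of "bvars M \<union> bvars N" c] by auto
    ultimately show "x \<in> basis (M \<otimes>\<^sub>f N) \<and> par (M \<otimes>\<^sub>f N) x = i + j \<and>
        Poly_Mapping.lookup (elem_tensor u v) x \<in> pring (bvars (M \<otimes>\<^sub>f N))"
      by (simp add: tensor_def)
  qed
  then show ?thesis
    using assms by (auto simp: bgrade_def tensor_def intro!: homogeneous_mult'[of _ "k - bdeg M _" _ "l - bdeg N _"])
qed

text \<open>The Leibniz rule. The sign depends on the parity of the left factor, so \<open>u\<close>
  has to be homogeneous in parity while \<open>v\<close> is arbitrary.\<close>

lemma lin_tensor_bdiff:
  assumes par: "\<And>b. b \<in> Poly_Mapping.keys u \<Longrightarrow> par M b = i"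
  shows "lin (bdiff (M \<otimes>\<^sub>f N)) (elem_tensor u v) =
    elem_tensor (lin (bdiff M) u) v + scale (if i = 0 then 1 else - 1) (elem_tensor u (lin (bdiff N) v))"
proof -
  let ?s = "if i = 0 then 1 else - 1 :: qpoly"
  have "lin (bdiff (M \<otimes>\<^sub>f N)) (elem_tensor u v) =
      (\<Sum>b\<in>Poly_Mapping.keys u. \<Sum>c\<in>Poly_Mapping.keys v. scale (Poly_Mapping.lookup u b * Poly_Mapping.lookup v c)
        (elem_tensor (bdiff M b) (Poly_Mapping.single c 1) + scale ?s (elem_tensor (Poly_Mapping.single b 1) (bdiff N c))))"
    unfolding elem_tensor_def[of u v] lin_sum using par
    by (intro sum.cong refl) (simp add: tensor_def)
  also have "\<dots> = elem_tensor (lin (bdiff M) u) v + scale ?s (elem_tensor u (lin (bdiff N) v))"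
  proof (rule poly_mapping_eqI)
    fix x :: "'a \<times> 'b"
    obtain b' c' where [simp]: "x = (b', c')" by (cases x)
    let ?u = "Poly_Mapping.lookup u" and ?v = "Poly_Mapping.lookup v"
    have 1: "(\<Sum>c\<in>Poly_Mapping.keys v. p * ?v c * (q * Poly_Mapping.lookup (Poly_Mapping.single c 1) c')) = p * q * ?v c'" for p q :: qpoly
    proof -
      have "(\<Sum>c\<in>Poly_Mapping.keys v. p * ?v c * (q * Poly_Mapping.lookup (Poly_Mapping.single c 1) c')) =
          (\<Sum>c\<in>Poly_Mapping.keys v. if c = c' then p * q * ?v c' else 0)"
        by (intro sum.cong) (auto simp: lookup_single when_def algebra_simps)
      then show ?thesis by (auto simp: sum.delta in_keys_iff)
    qed
    have 2: "(\<Sum>b\<in>Poly_Mapping.keys u. \<Sum>c\<in>Poly_Mapping.keys v. ?u b * ?v c * (?s * (Poly_Mapping.lookup (Poly_Mapping.single b 1) b' * Poly_Mapping.lookup (bdiff N c) c')))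
        = ?s * (?u b' * (\<Sum>c\<in>Poly_Mapping.keys v. ?v c * Poly_Mapping.lookup (bdiff N c) c'))"
    proof -
      have "(\<Sum>b\<in>Poly_Mapping.keys u. \<Sum>c\<in>Poly_Mapping.keys v. ?u b * ?v c * (?s * (Poly_Mapping.lookup (Poly_Mapping.single b 1) b' * Poly_Mapping.lookup (bdiff N c) c')))
        = (\<Sum>b\<in>Poly_Mapping.keys u. if b = b' then \<Sum>c\<in>Poly_Mapping.keys v. ?s * (?u b' * (?v c * Poly_Mapping.lookup (bdiff N c) c')) else 0)"
        by (intro sum.cong refl) (auto simp: lookup_single when_def algebra_simps intro!: sum.cong)
      then show ?thesis by (auto simp: sum.delta in_keys_iff sum_distrib_left)
    qed
    show "Poly_Mapping.lookup (\<Sum>b\<in>Poly_Mapping.keys u. \<Sum>c\<in>Poly_Mapping.keys v. scale (?u b * ?v c)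
        (elem_tensor (bdiff M b) (Poly_Mapping.single c 1) + scale ?s (elem_tensor (Poly_Mapping.single b 1) (bdiff N c)))) x =
      Poly_Mapping.lookup (elem_tensor (lin (bdiff M) u) v + scale ?s (elem_tensor u (lin (bdiff N) v))) x"
      by (simp only: \<open>x = (b', c')\<close> lookup_sum lookup_scale lookup_add lookup_elem_tensor distrib_left sum.distrib 1 2 lookup_lin sum_distrib_right)
  qed
  finally show ?thesis .
qed

text \<open>In the square of the differential the two mixed terms, d(e_b) tensor d(e_c), carry
  opposite signs because d(e_b) has the parity opposite to that of e_b. The unmixed terms give the
  two potentials.\<close>

lemma bfact_ok_tensor:
  assumes M: "bfact_ok n w M" and N: "bfact_ok n w' N"
  shows "bfact_ok n (w + w') (M \<otimes>\<^sub>f N)"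
  unfolding bfact_ok_def
proof (intro conjI ballI)
  show "finite (bvars (M \<otimes>\<^sub>f N))" "homogeneous (w + w') (2 * (int n + 1))"
    using M N by (auto simp: bfact_ok_def tensor_def)
  show "w + w' \<in> pring (bvars (M \<otimes>\<^sub>f N))"
    using M N pring_mono[of w "bvars M" "bvars M \<union> bvars N"] pring_mono[of w' "bvars N" "bvars M \<union> bvars N"]
    by (auto simp: bfact_ok_def tensor_def)
  fix x assume "x \<in> basis (M \<otimes>\<^sub>f N)"
  then obtain b c where [simp]: "x = (b, c)" and bc: "b \<in> basis M" "c \<in> basis N"
    by (auto simp: tensor_def)
  have db: "bdiff M b \<in> bgrade M (par M b + 1) (bdeg M b + int n + 1)" "lin (bdiff M) (bdiff M b) = Poly_Mapping.single b w"
    using M bc by (auto simp: bfact_ok_def)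
  have dc: "bdiff N c \<in> bgrade N (par N c + 1) (bdeg N c + int n + 1)" "lin (bdiff N) (bdiff N c) = Poly_Mapping.single c w'"
    using N bc by (auto simp: bfact_ok_def)
  have sb: "Poly_Mapping.single b 1 \<in> bgrade M (par M b) (bdeg M b)" "Poly_Mapping.single c 1 \<in> bgrade N (par N c) (bdeg N c)"
    using bc by (auto intro!: bgrade_single)
  show "bdiff (M \<otimes>\<^sub>f N) x \<in> bgrade (M \<otimes>\<^sub>f N) (par (M \<otimes>\<^sub>f N) x + 1) (bdeg (M \<otimes>\<^sub>f N) x + int n + 1)"
  proof -
    have "elem_tensor (bdiff M b) (Poly_Mapping.single c 1) \<in> bgrade (M \<otimes>\<^sub>f N) (par M b + par N c + 1) (bdeg M b + bdeg N c + int n + 1)"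
      by (rule elem_tensor_bgrade[OF db(1) sb(2)]) (auto simp: ac_simps)
    moreover have "elem_tensor (Poly_Mapping.single b 1) (bdiff N c) \<in> bgrade (M \<otimes>\<^sub>f N) (par M b + par N c + 1) (bdeg M b + bdeg N c + int n + 1)"
      by (rule elem_tensor_bgrade[OF sb(1) dc(1)]) (auto simp: ac_simps)
    ultimately show ?thesis
      by (auto simp: tensor_def scale_uminus_left)
  qed
  have "par M b' = par M b + 1" if "b' \<in> Poly_Mapping.keys (bdiff M b)" for b'
    using db(1) that by (auto simp: bgrade_def bcar_def in_keys_iff)
  note 1 = lin_tensor_bdiff[where N = N, OF this]
  have 2: "lin (bdiff (M \<otimes>\<^sub>f N)) (elem_tensor (Poly_Mapping.single b 1) v) =
    elem_tensor (bdiff M b) v + scale (if par M b = 0 then 1 else - 1) (elem_tensor (Poly_Mapping.single b 1) (lin (bdiff N) v))" for v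
    by (subst lin_tensor_bdiff[where i = "par M b"]) auto
  have 3: "elem_tensor (Poly_Mapping.single b p) (Poly_Mapping.single c q) = Poly_Mapping.single (b, c) (p * q)" for p q
    by (rule poly_mapping_eqI) (auto simp: lookup_single when_def split_paired_all)
  have "bdiff (M \<otimes>\<^sub>f N) x = elem_tensor (bdiff M b) (Poly_Mapping.single c 1) + scale (if par M b = 0 then 1 else - 1)
          (elem_tensor (Poly_Mapping.single b 1) (bdiff N c))"
    by (simp add: tensor_def)
  then show "lin (bdiff (M \<otimes>\<^sub>f N)) (bdiff (M \<otimes>\<^sub>f N) x) = Poly_Mapping.single x (w + w')"
    by (cases "par M b = 0")
      (simp_all add: lin_add lin_diff lin_scale 1 2 3 db dc scale_add_right scale_uminus_left single_add single_uminus)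
qed

lemma inject_eq_lin: "inject \<phi> v = lin (\<lambda>b. Poly_Mapping.single (\<phi> b) 1) v"
  by (simp add: inject_def lin_def)

lemma lin_inject: "lin \<psi> (inject \<phi> v) = lin (\<lambda>b. \<psi> (\<phi> b)) v"
  by (simp add: inject_eq_lin lin_lin)

lemma inject_lin: "lin (\<lambda>b. inject \<phi> (\<chi> b)) v = inject \<phi> (lin \<chi> v)"
  by (simp add: inject_eq_lin lin_lin)

lemma inject_single [simp]: "inject \<phi> (Poly_Mapping.single b p) = Poly_Mapping.single (\<phi> b) p"
  by (simp add: inject_eq_lin)

lemma inject_inject: "inject \<phi> (inject \<chi> v) = inject (\<lambda>b. \<phi> (\<chi> b)) v"
  by (simp add: inject_eq_lin lin_lin)

lemma inject_bgrade:
  assumes "v \<in> bgrade M i k" "bvars M \<subseteq> bvars N"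
    and "\<And>b. b \<in> basis M \<Longrightarrow> \<phi> b \<in> basis N \<and> par N (\<phi> b) = par M b \<and> bdeg N (\<phi> b) = bdeg M b"
  shows "inject \<phi> v \<in> bgrade N i k"
proof -
  have "Poly_Mapping.single (\<phi> b) 1 \<in> bgrade N (par M b + 0) (bdeg M b + 0)" if "b \<in> basis M" for b
    using assms(3)[OF that] by (intro bgrade_single) auto
  from lin_bgrade[OF this assms(2,1)] show ?thesis by (simp add: inject_eq_lin)
qed

text \<open>The index set may be empty, and then \<^term>\<open>dsum_family I F\<close> alone is a module over \<open>\<rat>\<close>.\<close>

lemma bfact_ok_dsum_family:
  assumes M: "bfact_ok n w M" and F: "\<And>i. i \<in> I \<Longrightarrow> bfact_ok n w (F i) \<and> bvars (F i) = bvars M"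
  shows "bfact_ok n w (M \<oplus>\<^sub>f dsum_family I F)"
  unfolding bfact_ok_def
proof (intro conjI ballI)
  let ?N = "M \<oplus>\<^sub>f dsum_family I F"
  have vars: "bvars ?N = bvars M" using F by (auto simp: dsum_def dsum_family_def)
  then show "finite (bvars ?N)" "w \<in> pring (bvars ?N)" "homogeneous w (2 * (int n + 1))"
    using M by (auto simp: bfact_ok_def)
  fix x assume "x \<in> basis ?N"
  then consider b where "x = Inl b" "b \<in> basis M" | i c where "x = Inr (i, c)" "i \<in> I" "c \<in> basis (F i)"
    by (auto simp: dsum_def dsum_family_def)
  then have "bdiff ?N x \<in> bgrade ?N (par ?N x + 1) (bdeg ?N x + int n + 1) \<and>
    lin (bdiff ?N) (bdiff ?N x) = Poly_Mapping.single x w"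
  proof cases
    case (1 b)
    then have "inject Inl (bdiff M b) \<in> bgrade ?N (par M b + 1) (bdeg M b + int n + 1)"
      using M vars by (intro inject_bgrade[of _ M]) (auto simp: bfact_ok_def, auto simp: dsum_def)
    then show ?thesis using 1 M
      by (auto simp: dsum_def bfact_ok_def lin_inject inject_lin)
  next
    case (2 i b)
    note Fi = F[OF \<open>i \<in> I\<close>]
    have "inject (\<lambda>b. Inr (i, b)) (bdiff (F i) b) \<in> bgrade ?N (par (F i) b + 1) (bdeg (F i) b + int n + 1)"
      using Fi vars 2 by (intro inject_bgrade[of _ "F i"]) (auto simp: bfact_ok_def, auto simp: dsum_def dsum_family_def)
    then show ?thesis using 2 Fi
      by (auto simp: dsum_def dsum_family_def bfact_ok_def inject_inject lin_inject inject_lin)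
  qed
  then show "bdiff ?N x \<in> bgrade ?N (par ?N x + 1) (bdeg ?N x + int n + 1)"
    "lin (bdiff ?N) (bdiff ?N x) = Poly_Mapping.single x w" by auto
qed

section \<open>Homotopy equivalences\<close>

text \<open>Linearity is required only over \<open>pring V\<close>, which may be smaller than the
  rings of \<open>M\<close> and \<open>N\<close>. Such a map need not be determined by its values on
  \<open>basis M\<close>; the homotopies obtained from division with remainder are of this
  kind.\<close>

definition blin :: "nat set \<Rightarrow> 'b bfact \<Rightarrow> 'c bfact \<Rightarrow> bit \<Rightarrow> bit \<Rightarrow> int \<Rightarrow> (('b \<Rightarrow>\<^sub>0 qpoly) \<Rightarrow> 'c \<Rightarrow>\<^sub>0 qpoly) \<Rightarrow> bool" where
  "blin V M N i j d f \<longleftrightarrow>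
     (\<forall>x\<in>bcar M i. f x \<in> bcar N j) \<and>
     (\<forall>x\<in>bcar M i. \<forall>y\<in>bcar M i. f (x + y) = f x + f y) \<and>
     (\<forall>r\<in>pring V. \<forall>x\<in>bcar M i. f (scale r x) = scale r (f x)) \<and>
     (\<forall>l. \<forall>x\<in>bgrade M i l. f x \<in> bgrade N j (l + d))"

lemma blin_iff:
  "blin V M N i j d f \<longleftrightarrow> linear_map V (bmodule M i) (bmodule N j) f \<and> has_degree (bmodule M i) (bmodule N j) d f"
  unfolding blin_def linear_map_def has_degree_def bmodule_simps Pi_iff image_subset_iff
  by (simp add: conj_assoc)

lemma blinD:
  assumes "blin V M N i j d f"
  shows "x \<in> bcar M i \<Longrightarrow> f x \<in> bcar N j"
    and "x \<in> bcar M i \<Longrightarrow> y \<in> bcar M i \<Longrightarrow> f (x + y) = f x + f y"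
    and "r \<in> pring V \<Longrightarrow> x \<in> bcar M i \<Longrightarrow> f (scale r x) = scale r (f x)"
    and "x \<in> bgrade M i l \<Longrightarrow> f x \<in> bgrade N j (l + d)"
  using assms by (auto simp: blin_def)

lemma blin_0: "blin V M N i j d f \<Longrightarrow> f 0 = 0"
  using blinD(2)[of V M N i j d f 0 0] by simp
lemma blin_minus: "blin V M N i j d f \<Longrightarrow> x \<in> bcar M i \<Longrightarrow> f (- x) = - f x"
  using blinD(2)[of V M N i j d f x "- x"] blin_0[of V M N i j d f]
  by (simp add: bcar_uminus eq_neg_iff_add_eq_0 add.commute)
lemma blin_diff: "blin V M N i j d f \<Longrightarrow> x \<in> bcar M i \<Longrightarrow> y \<in> bcar M i \<Longrightarrow> f (x - y) = f x - f y"
  using blinD(2)[of V M N i j d f x "- y"] blin_minus[of V M N i j d f y] by (simp add: bcar_uminus)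
lemma blin_sum:
  assumes "blin V M N i j d f" "\<And>x. x \<in> A \<Longrightarrow> g x \<in> bcar M i"
  shows "f (sum g A) = (\<Sum>x\<in>A. f (g x))"
  using assms(2)
  by (induction A rule: infinite_finite_induct) (auto simp: blin_0[OF assms(1)] blinD(2)[OF assms(1)] bcar_sum)

lemma blin_comp:
  assumes "blin V M N i j d f" "blin V N P j k e g"
  shows "blin V M P i k (d + e) (\<lambda>x. g (f x))"
  unfolding blin_def
  by (simp add: blinD(1,2,3)[OF assms(1)] blinD(1,2,3)[OF assms(2)])
    (use blinD(4)[OF assms(2) blinD(4)[OF assms(1)]] in \<open>simp add: add.assoc\<close>)

lemma blin_add_fun: "blin V M N i j d f \<Longrightarrow> blin V M N i j d g \<Longrightarrow> blin V M N i j d (\<lambda>x. f x + g x)"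
  unfolding blin_def by (auto simp: scale_add_right)
lemma blin_uminus_fun: "blin V M N i j d f \<Longrightarrow> blin V M N i j d (\<lambda>x. - f x)"
  unfolding blin_def by (auto simp: scale_uminus_right)
lemma blin_diff_fun: "blin V M N i j d f \<Longrightarrow> blin V M N i j d g \<Longrightarrow> blin V M N i j d (\<lambda>x. f x - g x)"
  unfolding blin_def by (auto simp: scale_diff_right)
lemma blin_zero_fun: "blin V M N i j d (\<lambda>x. 0)"
  unfolding blin_def by auto
lemma blin_ident: "blin V M M i i 0 (\<lambda>x. x)"
  unfolding blin_def by auto

lemma blin_bdiff: "bfact_ok n w M \<Longrightarrow> blin V M M i (i + 1) (int n + 1) (lin (bdiff M))"
  unfolding blin_def using bdiff_bcar[of n w M] bdiff_bgrade[of n w M] by (auto simp: lin_add lin_scale)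

definition bmor :: "nat set \<Rightarrow> 'b bfact \<Rightarrow> 'c bfact \<Rightarrow> (bit \<Rightarrow> ('b \<Rightarrow>\<^sub>0 qpoly) \<Rightarrow> 'c \<Rightarrow>\<^sub>0 qpoly) \<Rightarrow> bool" where
  "bmor V M N f \<longleftrightarrow> (\<forall>i. blin V M N i i 0 (f i) \<and>
     (\<forall>x\<in>bcar M i. f (i + 1) (lin (bdiff M) x) = lin (bdiff N) (f i x)))"

lemma bmor_iff: "bmor V M N f \<longleftrightarrow> morphism V (fact_of M) (fact_of N) f"
  by (simp add: bmor_def morphism_def blin_iff conj_assoc)

definition left_homotopy_inverse ::
  "nat \<Rightarrow> nat set \<Rightarrow> 'b bfact \<Rightarrow> (bit \<Rightarrow> ('b \<Rightarrow>\<^sub>0 qpoly) \<Rightarrow> 'c \<Rightarrow>\<^sub>0 qpoly) \<Rightarrow> (bit \<Rightarrow> ('c \<Rightarrow>\<^sub>0 qpoly) \<Rightarrow> 'b \<Rightarrow>\<^sub>0 qpoly) \<Rightarrow> bool" where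
  "left_homotopy_inverse n V M f g \<longleftrightarrow> (\<exists>h. \<forall>i. blin V M M i (i + 1) (- int n - 1) (h i) \<and>
     (\<forall>x\<in>bcar M i. g i (f i x) - x = h (i + 1) (lin (bdiff M) x) + lin (bdiff M) (h i x)))"

definition hequiv :: "nat \<Rightarrow> nat set \<Rightarrow> 'b bfact \<Rightarrow> 'c bfact \<Rightarrow> bool" where
  "hequiv n V M N \<longleftrightarrow> (\<exists>f g. bmor V M N f \<and> bmor V N M g \<and>
     left_homotopy_inverse n V M f g \<and> left_homotopy_inverse n V N g f)"

lemma left_homotopy_inverse_imp_homotopic:
  assumes "left_homotopy_inverse n V M f g" "bmor V M N f" "bmor V N M g"
  shows "homotopic n V (fact_of M) (fact_of M) (\<lambda>i x. g i (f i x)) (\<lambda>i x. x)"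
proof -
  obtain h where h: "\<And>i. blin V M M i (i + 1) (- int n - 1) (h i)"
    "\<And>i x. x \<in> bcar M i \<Longrightarrow> g i (f i x) - x = h (i + 1) (lin (bdiff M) x) + lin (bdiff M) (h i x)"
    using assms(1) by (auto simp: left_homotopy_inverse_def)
  have F: "blin V M N i i 0 (f i)" and G: "blin V N M i i 0 (g i)" for i
    using assms(2,3) by (auto simp: bmor_def)
  show ?thesis
    unfolding homotopic_def
  proof (intro exI[of _ h] allI conjI ballI)
    fix i
    show "linear_map V (module_at (fact_of M) i) (module_at (fact_of M) (i - 1)) (h i)"
      "has_degree (module_at (fact_of M) i) (module_at (fact_of M) (i - 1)) (- int n - 1) (h i)"
      using h(1)[of i] by (simp_all add: blin_iff bit_diff_eq_add)
    fix x assume "x \<in> carrier (module_at (fact_of M) i)"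
    then have x: "x \<in> bcar M i" by simp
    show "g i (f i x) \<ominus>\<^bsub>module_at (fact_of M) i\<^esub> x =
        h (i + 1) (diff (fact_of M) i x) \<oplus>\<^bsub>module_at (fact_of M) i\<^esub> diff (fact_of M) (i - 1) (h i x)"
      using x h(2)[OF x] blinD(1)[OF G blinD(1)[OF F x]] by simp
  qed
qed

text \<open>g g' f' f - 1 = (g f - 1) + g (g' f' - 1) f, so the homotopies h and k of the two pairs
  combine to h + g k f.\<close>

lemma left_homotopy_inverse_comp:
  assumes f: "bmor V M N f" and g: "bmor V N M g" and f': "bmor V N P f'" and g': "bmor V P N g'"
    and h: "left_homotopy_inverse n V M f g" and h': "left_homotopy_inverse n V N f' g'"
    and M: "bfact_ok n w M" and N: "bfact_ok n w N"
  shows "left_homotopy_inverse n V M (\<lambda>i x. f' i (f i x)) (\<lambda>i x. g i (g' i x))"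
proof -
  obtain h where h: "\<And>i. blin V M M i (i + 1) (- int n - 1) (h i)"
    "\<And>i x. x \<in> bcar M i \<Longrightarrow> g i (f i x) - x = h (i + 1) (lin (bdiff M) x) + lin (bdiff M) (h i x)"
    using h by (auto simp: left_homotopy_inverse_def)
  obtain k where k: "\<And>i. blin V N N i (i + 1) (- int n - 1) (k i)"
    "\<And>i x. x \<in> bcar N i \<Longrightarrow> g' i (f' i x) - x = k (i + 1) (lin (bdiff N) x) + lin (bdiff N) (k i x)"
    using h' by (auto simp: left_homotopy_inverse_def)
  have F: "blin V M N i i 0 (f i)" and fd: "x \<in> bcar M i \<Longrightarrow> f (i + 1) (lin (bdiff M) x) = lin (bdiff N) (f i x)" for i x
    using f by (auto simp: bmor_def)
  have G: "blin V N M i i 0 (g i)" and gd: "x \<in> bcar N i \<Longrightarrow> g (i + 1) (lin (bdiff N) x) = lin (bdiff M) (g i x)" for i x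
    using g by (auto simp: bmor_def)
  have F': "blin V N P i i 0 (f' i)" for i using f' by (auto simp: bmor_def)
  have G': "blin V P N i i 0 (g' i)" for i using g' by (auto simp: bmor_def)
  note dM = blin_bdiff[OF M, of V] and dN = blin_bdiff[OF N, of V]
  show ?thesis
    unfolding left_homotopy_inverse_def
  proof (intro exI[of _ "\<lambda>i x. h i x + g (i + 1) (k i (f i x))"] allI conjI ballI)
    fix i
    show "blin V M M i (i + 1) (- int n - 1) (\<lambda>x. h i x + g (i + 1) (k i (f i x)))"
      using blin_comp[OF blin_comp[OF F k(1)] G] by (intro blin_add_fun h(1)) simp
    fix x assume x: "x \<in> bcar M i"
    have fx: "f i x \<in> bcar N i" and dx: "lin (bdiff M) x \<in> bcar M (i + 1)"
      and dfx: "lin (bdiff N) (f i x) \<in> bcar N (i + 1)"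
      using x blinD(1)[OF F] blinD(1)[OF dM] blinD(1)[OF dN] by blast+
    have kfx: "k i (f i x) \<in> bcar N (i + 1)" and kdfx: "k (i + 1) (lin (bdiff N) (f i x)) \<in> bcar N i"
      and dkfx: "lin (bdiff N) (k i (f i x)) \<in> bcar N i"
      using blinD(1)[OF k(1) fx] blinD(1)[OF k(1) dfx] blinD(1)[OF dN, of "k i (f i x)" "i + 1"] by simp_all
    have gf'x: "g' i (f' i (f i x)) \<in> bcar N i" using fx blinD(1)[OF F'] blinD(1)[OF G'] by blast
    have "g i (g' i (f' i (f i x))) = g i (f i x) + g i (g' i (f' i (f i x)) - f i x)"
      by (simp add: blin_diff[OF G gf'x fx])
    also have "g' i (f' i (f i x)) - f i x = k (i + 1) (lin (bdiff N) (f i x)) + lin (bdiff N) (k i (f i x))"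
      using k(2)[OF fx] .
    also have "g i \<dots> = g i (k (i + 1) (lin (bdiff N) (f i x))) + g i (lin (bdiff N) (k i (f i x)))"
      by (rule blinD(2)[OF G kdfx dkfx])
    also have "g i (lin (bdiff N) (k i (f i x))) = lin (bdiff M) (g (i + 1) (k i (f i x)))"
      using gd[OF kfx] by simp
    finally have "g i (g' i (f' i (f i x))) - x =
        (g i (f i x) - x) + g i (k (i + 1) (lin (bdiff N) (f i x))) + lin (bdiff M) (g (i + 1) (k i (f i x)))"
      by simp
    then show "g i (g' i (f' i (f i x))) - x =
        h (i + 1) (lin (bdiff M) x) + g (i + 1 + 1) (k (i + 1) (f (i + 1) (lin (bdiff M) x))) +
        lin (bdiff M) (h i x + g (i + 1) (k i (f i x)))"
      by (simp add: h(2)[OF x] fd[OF x] lin_add)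
  qed
qed

lemma bmor_comp:
  assumes "bmor V M N f" "bmor V N P g"
  shows "bmor V M P (\<lambda>i x. g i (f i x))"
  unfolding bmor_def
proof (intro allI conjI ballI)
  fix i
  have F: "blin V M N i i 0 (f i)" "blin V N P i i 0 (g i)" using assms by (auto simp: bmor_def)
  from blin_comp[OF this] show "blin V M P i i 0 (\<lambda>x. g i (f i x))" by simp
  fix x assume "x \<in> bcar M i"
  then show "g (i + 1) (f (i + 1) (lin (bdiff M) x)) = lin (bdiff P) (g i (f i x))"
    using assms blinD(1)[OF F(1)] by (auto simp: bmor_def)
qed

lemma hequiv_trans:
  assumes "hequiv n V M N" "hequiv n V N P" "bfact_ok n w M" "bfact_ok n w N" "bfact_ok n w P"
  shows "hequiv n V M P"
proof -
  obtain f g where f: "bmor V M N f" "bmor V N M g" "left_homotopy_inverse n V M f g" "left_homotopy_inverse n V N g f"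
    using assms(1) by (auto simp: hequiv_def)
  obtain f' g' where f': "bmor V N P f'" "bmor V P N g'" "left_homotopy_inverse n V N f' g'" "left_homotopy_inverse n V P g' f'"
    using assms(2) by (auto simp: hequiv_def)
  show ?thesis
    unfolding hequiv_def
    using bmor_comp[OF f(1) f'(1)] bmor_comp[OF f'(2) f(2)]
      left_homotopy_inverse_comp[OF f(1,2) f'(1,2) f(3) f'(3) assms(3,4)]
      left_homotopy_inverse_comp[OF f'(2,1) f(2,1) f'(4) f(4) assms(5,4)]
    by blast
qed

text \<open>\<open>K\<close> is a contractible subfactorization of \<open>M\<close> and \<open>\<Psi>\<close> identifies \<open>N\<close> with the quotient
  \<open>M / K\<close>; \<open>\<Psi>\<close> itself need not commute with the differentials. The homotopy inverse of the
  projection is \<open>\<Psi>\<close> followed by \<open>1 - d h - h d\<close>.\<close>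

lemma hequiv_contractible_quotient:
  assumes M: "bfact_ok n w M" and N: "bfact_ok n w N" and V: "V \<subseteq> bvars M" "V \<subseteq> bvars N" "w \<in> pring V"
    and K_add: "\<And>x y. x \<in> K \<Longrightarrow> y \<in> K \<Longrightarrow> x + y \<in> K"
    and K_scale: "\<And>r x. r \<in> pring V \<Longrightarrow> x \<in> K \<Longrightarrow> scale r x \<in> K"
    and h: "\<And>i. blin V M M i (i + 1) (- int n - 1) h"
    and hK: "\<And>i x. x \<in> bcar M i \<Longrightarrow> h x \<in> K"
    and dK: "\<And>i x. x \<in> bcar M i \<Longrightarrow> x \<in> K \<Longrightarrow> lin (bdiff M) x \<in> K"
    and contr: "\<And>i x. x \<in> bcar M i \<Longrightarrow> x \<in> K \<Longrightarrow> x = lin (bdiff M) (h x) + h (lin (bdiff M) x)"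
    and \<Psi>: "\<And>i. blin V N M i i 0 \<Psi>"
    and \<Psi>d: "\<And>i y. y \<in> bcar N i \<Longrightarrow> lin (bdiff M) (\<Psi> y) - \<Psi> (lin (bdiff N) y) \<in> K"
    and ex: "\<And>i k x. x \<in> bgrade M i k \<Longrightarrow> \<exists>y\<in>bgrade N i k. x - \<Psi> y \<in> K"
    and inj: "\<And>i y. y \<in> bcar N i \<Longrightarrow> \<Psi> y \<in> K \<Longrightarrow> y = 0"
  shows "hequiv n V M N"
proof -
  let ?d = "lin (bdiff M)" and ?dN = "lin (bdiff N)"
  have dM: "blin V M M i (i + 1) (int n + 1) ?d" for i by (rule blin_bdiff[OF M])
  have dN: "blin V N N i (i + 1) (int n + 1) ?dN" for i by (rule blin_bdiff[OF N])
  have K_minus: "- x \<in> K" if "x \<in> K" for x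
    using K_scale[of "- 1" x] that pring_uminus[of 1 V] by (simp add: scale_uminus_left)
  have K_diff: "x - y \<in> K" if "x \<in> K" "y \<in> K" for x y
    using K_add[OF that(1) K_minus[OF that(2)]] by simp
  have K_0: "0 \<in> K" using hK[of 0 0] blin_0[OF h] by simp
  \<comment> \<open>Hypothesis \<open>ex\<close> concerns homogeneous elements only; a general
    element is the sum of its components.\<close>
  have ex': "\<exists>y\<in>bcar N i. x - \<Psi> y \<in> K" if x: "x \<in> bcar M i" for i x
  proof -
    obtain A where A: "finite A" "{k. vhcomp M k x \<noteq> 0} \<subseteq> A" "(\<Sum>k\<in>A. vhcomp M k x) = x"
      by (rule vhcomp_decomp)
    have "\<exists>y\<in>bgrade N i k. vhcomp M k x - \<Psi> y \<in> K" for k using ex[OF vhcomp_bgrade[OF x]] .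
    then obtain y where y: "\<And>k. y k \<in> bgrade N i k" "\<And>k. vhcomp M k x - \<Psi> (y k) \<in> K" by metis
    have "(\<Sum>k\<in>A. vhcomp M k x - \<Psi> (y k)) \<in> K"
      using y(2) by (induction A rule: infinite_finite_induct) (auto intro: K_add K_0)
    also have "(\<Sum>k\<in>A. vhcomp M k x - \<Psi> (y k)) = x - \<Psi> (\<Sum>k\<in>A. y k)"
      using bgrade_bcar[OF y(1)] by (subst blin_sum[OF \<Psi>, of _ _ i]) (simp_all add: sum_subtractf A(3))
    finally show ?thesis using bgrade_bcar[OF y(1)] by blast
  qed
  \<comment> \<open>The projection onto the quotient by \<open>K\<close>, read in \<open>N\<close>.
    It preserves degrees because \<open>ex\<close> provides homogeneous representatives.\<close>
  define f where "f i x = (THE y. y \<in> bcar N i \<and> x - \<Psi> y \<in> K)" for i x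
  have uniq: "y = y'" if "y \<in> bcar N i" "y' \<in> bcar N i" "x - \<Psi> y \<in> K" "x - \<Psi> y' \<in> K" for i x y y'
  proof -
    have "\<Psi> (y - y') = (x - \<Psi> y') - (x - \<Psi> y)" by (simp add: blin_diff[OF \<Psi> that(1,2)])
    also have "\<dots> \<in> K" by (rule K_diff[OF that(4,3)])
    finally have "y - y' = 0" by (rule inj[OF bcar_diff[OF that(1,2)]])
    then show ?thesis by simp
  qed
  have f_eq: "f i x = y" if "y \<in> bcar N i" "x - \<Psi> y \<in> K" for i x y
    unfolding f_def using that by (intro the_equality conjI) (blast intro: uniq)+
  have f: "f i x \<in> bcar N i" "x - \<Psi> (f i x) \<in> K" if x: "x \<in> bcar M i" for i x
  proof -
    obtain y where "y \<in> bcar N i" "x - \<Psi> y \<in> K" using ex'[OF x] by blast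
    with f_eq[OF this] show "f i x \<in> bcar N i" "x - \<Psi> (f i x) \<in> K" by simp_all
  qed
  have fK: "f i x = 0" if "x \<in> K" for i x
  proof (rule f_eq)
    show "x - \<Psi> 0 \<in> K" using that blin_0[OF \<Psi>] by simp
  qed simp
  have f_lin: "blin V M N i i 0 (f i)" for i
    unfolding blin_def
  proof (intro conjI ballI allI)
    fix x assume x: "x \<in> bcar M i"
    show "f i x \<in> bcar N i" using f x by blast
    {
      fix y assume y: "y \<in> bcar M i"
      have "x + y - \<Psi> (f i x + f i y) = (x - \<Psi> (f i x)) + (y - \<Psi> (f i y))"
        by (simp add: blinD(2)[OF \<Psi> f(1)[OF x] f(1)[OF y]])
      also have "\<dots> \<in> K" by (rule K_add[OF f(2)[OF x] f(2)[OF y]])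
      finally show "f i (x + y) = f i x + f i y"
        by (intro f_eq bcar_add f(1)[OF x] f(1)[OF y])
    }
    fix r assume r: "r \<in> pring V"
    then have "scale r x - \<Psi> (scale r (f i x)) = scale r (x - \<Psi> (f i x))"
      by (simp add: blinD(3)[OF \<Psi> r f(1)[OF x]] scale_diff_right)
    also have "\<dots> \<in> K" by (rule K_scale[OF r f(2)[OF x]])
    finally show "f i (scale r x) = scale r (f i x)"
      by (intro f_eq bcar_scale f(1)[OF x] pring_mono[OF r V(2)])
  next
    fix l x assume "x \<in> bgrade M i l"
    then obtain y where y: "y \<in> bgrade N i l" "x - \<Psi> y \<in> K" using ex by blast
    then show "f i x \<in> bgrade N i (l + 0)" using f_eq[OF bgrade_bcar[OF y(1)] y(2)] by simp
  qed
  \<comment> \<open>\<open>p\<close> kills \<open>K\<close> by the contraction, so it depends only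
    on classes modulo \<open>K\<close>. Hence \<open>\<Psi>\<close> followed by \<open>p\<close>
    commutes with the differentials although \<open>\<Psi>\<close> does so only modulo
    \<open>K\<close>.\<close>
  define p where "p x = x - ?d (h x) - h (?d x)" for x
  have dh: "?d (h x) \<in> bcar M i" and hd: "h (?d x) \<in> bcar M i" if "x \<in> bcar M i" for i x
    using blinD(1)[OF dM, OF blinD(1)[OF h that]] blinD(1)[OF h, OF blinD(1)[OF dM that]] by simp_all
  have p_lin: "blin V M M i i 0 p" for i
    unfolding p_def using blin_comp[OF h dM, of i] blin_comp[OF dM h, of i]
    by (intro blin_diff_fun) (simp_all add: blin_ident)
  have pK: "p x = 0" if "x \<in> bcar M i" "x \<in> K" for i x
    using contr[OF that] by (simp add: p_def algebra_simps)
  have p_mod: "x - p x \<in> K" if x: "x \<in> bcar M i" for i x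
    using K_add[OF dK[OF blinD(1)[OF h x] hK[OF x]] hK[OF blinD(1)[OF dM x]]] by (simp add: p_def add.commute)
  \<comment> \<open>The terms d h d agree. The other two are h (w x) and w (h x), equal because
    \<open>w\<close> lies in \<open>pring V\<close>.\<close>
  have pd: "p (?d x) = ?d (p x)" if x: "x \<in> bcar M i" for i x
    using bdiff_bdiff[OF M x] bdiff_bdiff[OF M blinD(1)[OF h x]] blinD(3)[OF h V(3) x]
    by (simp add: p_def lin_diff)
  define g where "g i y = p (\<Psi> y)" for i :: bit and y
  have g_lin: "blin V N M i i 0 (g i)" for i
    unfolding g_def using blin_comp[OF \<Psi> p_lin] by simp
  have fg: "f i (g i y) = y" if y: "y \<in> bcar N i" for i y
    using y K_minus[OF p_mod[OF blinD(1)[OF \<Psi> y]]] by (intro f_eq[OF y]) (simp add: g_def)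
  have f_mor: "bmor V M N f"
    unfolding bmor_def
  proof (intro allI conjI ballI f_lin)
    fix i x assume x: "x \<in> bcar M i"
    have "?d x - \<Psi> (?dN (f i x)) = ?d (x - \<Psi> (f i x)) + (?d (\<Psi> (f i x)) - \<Psi> (?dN (f i x)))"
      by (simp add: lin_diff)
    also have "\<dots> \<in> K"
      by (rule K_add[OF dK[OF bcar_diff[OF x blinD(1)[OF \<Psi> f(1)[OF x]]] f(2)[OF x]] \<Psi>d[OF f(1)[OF x]]])
    finally show "f (i + 1) (?d x) = ?dN (f i x)"
      by (rule f_eq[OF blinD(1)[OF dN f(1)[OF x]]])
  qed
  have g_mor: "bmor V N M g"
    unfolding bmor_def
  proof (intro allI conjI ballI g_lin)
    fix i y assume y: "y \<in> bcar N i"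
    have c: "?d (\<Psi> y) \<in> bcar M (i + 1)" "\<Psi> (?dN y) \<in> bcar M (i + 1)"
      using blinD(1)[OF dM blinD(1)[OF \<Psi> y]] blinD(1)[OF \<Psi> blinD(1)[OF dN y]] by auto
    have "p (?d (\<Psi> y) - \<Psi> (?dN y)) = 0"
      by (rule pK[OF bcar_diff[OF c] \<Psi>d[OF y]])
    then show "g (i + 1) (?dN y) = ?d (g i y)"
      using pd[OF blinD(1)[OF \<Psi> y]] by (simp add: g_def blin_diff[OF p_lin c])
  qed
  have "left_homotopy_inverse n V M f g"
    unfolding left_homotopy_inverse_def
  proof (intro exI[of _ "\<lambda>i x. - h x"] allI conjI ballI)
    fix i
    show "blin V M M i (i + 1) (- int n - 1) (\<lambda>x. - h x)" by (rule blin_uminus_fun[OF h])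
    fix x assume x: "x \<in> bcar M i"
    have c: "\<Psi> (f i x) \<in> bcar M i" using blinD(1)[OF \<Psi> f(1)[OF x]] .
    have "p (x - \<Psi> (f i x)) = 0" by (rule pK[OF bcar_diff[OF x c] f(2)[OF x]])
    then have "g i (f i x) = p x" by (simp add: g_def blin_diff[OF p_lin x c])
    then show "g i (f i x) - x = - h (?d x) + ?d (- h x)" by (simp add: p_def lin_uminus)
  qed
  moreover have "left_homotopy_inverse n V N g f"
    unfolding left_homotopy_inverse_def
    by (intro exI[of _ "\<lambda>i x. 0"]) (auto simp: fg blin_zero_fun)
  ultimately show ?thesis using f_mor g_mor by (auto simp: hequiv_def)
qed

subsection \<open>Finite-dimensional cohomology\<close>

lemma irrelevant_part_zero: "0 \<in> irrelevant_part V (bmodule M i)"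
  using generate.one[of "add_monoid (bmodule M i)"] by (simp add: irrelevant_part_def)

lemma irrelevant_part_add:
  "x \<in> irrelevant_part V (bmodule M i) \<Longrightarrow> y \<in> irrelevant_part V (bmodule M i) \<Longrightarrow> x + y \<in> irrelevant_part V (bmodule M i)"
  using generate.eng[of x "add_monoid (bmodule M i)" _ y] by (simp add: irrelevant_part_def)

lemma irrelevant_part_scale:
  "r \<in> irrelevant_ideal V \<Longrightarrow> x \<in> bcar M i \<Longrightarrow> scale r x \<in> irrelevant_part V (bmodule M i)"
  unfolding irrelevant_part_def by (rule generate.incl) auto

text \<open>Inverses in the generated group need no case of their own, since - (r y) = r (-
  y).\<close>

lemma irrelevant_part_induct [consumes 2, case_names zero scale add]:
  assumes "V \<subseteq> bvars M" "x \<in> irrelevant_part V (bmodule M i)"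
    and "P 0" "\<And>r y. r \<in> irrelevant_ideal V \<Longrightarrow> y \<in> bcar M i \<Longrightarrow> P (scale r y)"
    and "\<And>x y. x \<in> irrelevant_part V (bmodule M i) \<Longrightarrow> y \<in> irrelevant_part V (bmodule M i) \<Longrightarrow> P x \<Longrightarrow> P y \<Longrightarrow> P (x + y)"
  shows "P x"
  using assms(2) unfolding irrelevant_part_def
proof (induction rule: generate.induct)
  case (inv h)
  then obtain r y where h: "h = scale r y" "r \<in> irrelevant_ideal V" "y \<in> bcar M i" by auto
  have r: "r \<in> pring (bvars M)" by (rule pring_mono[OF irrelevant_ideal_closed(4)[OF h(2)] assms(1)])
  have "inv\<^bsub>add_monoid (bmodule M i)\<^esub> h = scale r (- y)"
    using a_inv_bmodule[of h M i] h r by (simp add: a_inv_def bcar_scale scale_uminus_right)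
  then show ?case using assms(4)[OF h(2), of "- y"] h(3) by auto
next
  case (eng x y)
  then show ?case using assms(5) by (simp add: irrelevant_part_def)
qed (use assms(3,4) in auto)

lemma irrelevant_part_bcar:
  assumes "V \<subseteq> bvars M" "x \<in> irrelevant_part V (bmodule M i)"
  shows "x \<in> bcar M i"
  using assms
proof (induction rule: irrelevant_part_induct)
  case (scale r y)
  show ?case by (rule bcar_scale[OF scale(2) pring_mono[OF irrelevant_ideal_closed(4)[OF scale(1)] assms(1)]])
qed auto

lemma irrelevant_part_blin:
  assumes f: "blin V M N i j d f" and V: "V \<subseteq> bvars M" and x: "x \<in> irrelevant_part V (bmodule M i)"
  shows "f x \<in> irrelevant_part V (bmodule N j)"
  using V x
proof (induction rule: irrelevant_part_induct)
  case zero
  then show ?case by (simp add: blin_0[OF f] irrelevant_part_zero)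
next
  case (scale r y)
  then show ?case
    unfolding blinD(3)[OF f irrelevant_ideal_closed(4)[OF scale(1)] scale(2)]
    by (intro irrelevant_part_scale blinD(1)[OF f])
next
  case (add x y)
  then show ?case
    unfolding blinD(2)[OF f irrelevant_part_bcar[OF V add(1)] irrelevant_part_bcar[OF V add(2)]]
    by (intro irrelevant_part_add)
qed

lemma irrelevant_part_uminus:
  "V \<subseteq> bvars M \<Longrightarrow> x \<in> irrelevant_part V (bmodule M i) \<Longrightarrow> - x \<in> irrelevant_part V (bmodule M i)"
  using irrelevant_part_blin[OF blin_uminus_fun[OF blin_ident]] by blast

lemma irrelevant_part_diff:
  "V \<subseteq> bvars M \<Longrightarrow> x \<in> irrelevant_part V (bmodule M i) \<Longrightarrow> y \<in> irrelevant_part V (bmodule M i) \<Longrightarrow>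
    x - y \<in> irrelevant_part V (bmodule M i)"
  using irrelevant_part_add[of x V M i "- y"] irrelevant_part_uminus[of V M y i] by simp

lemma cocycles_fact_of:
  "cocycles V (fact_of M) i = {x \<in> bcar M i. lin (bdiff M) x \<in> irrelevant_part V (bmodule M (i + 1))}"
  by (simp add: cocycles_def)

lemma coboundaries_fact_of:
  "coboundaries V (fact_of M) i = {lin (bdiff M) y + u |y u. y \<in> bcar M (i + 1) \<and> u \<in> irrelevant_part V (bmodule M i)}"
  by (simp add: coboundaries_def bit_diff_eq_add)

lemma finite_dim_cohomology_fact_of:
  assumes "V \<subseteq> bvars M"
  shows "finite_dim_cohomology V (fact_of M) \<longleftrightarrow>
    (\<forall>i. \<exists>F. finite F \<and> F \<subseteq> cocycles V (fact_of M) i \<and>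
      (\<forall>z\<in>cocycles V (fact_of M) i. \<exists>c. z - (\<Sum>b\<in>F. scale (Const (c b)) b) \<in> coboundaries V (fact_of M) i))"
proof -
  have "z \<ominus>\<^bsub>bmodule M i\<^esub> (\<Oplus>\<^bsub>bmodule M i\<^esub>b\<in>F. Const (c b) \<odot>\<^bsub>bmodule M i\<^esub> b) = z - (\<Sum>b\<in>F. scale (Const (c b)) b)"
    if "finite F" "F \<subseteq> cocycles V (fact_of M) i" "z \<in> cocycles V (fact_of M) i" for i F z c
  proof -
    have *: "scale (Const (c b)) b \<in> bcar M i" if "b \<in> F" for b
      using \<open>F \<subseteq> _\<close> that by (auto simp: cocycles_fact_of)
    then have "(\<Oplus>\<^bsub>bmodule M i\<^esub>b\<in>F. Const (c b) \<odot>\<^bsub>bmodule M i\<^esub> b) = (\<Sum>b\<in>F. scale (Const (c b)) b)"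
      using that(1) by (simp add: finsum_bmodule)
    moreover have "(\<Sum>b\<in>F. scale (Const (c b)) b) \<in> bcar M i" using * by auto
    ultimately show ?thesis using that(3) by (simp add: cocycles_fact_of)
  qed
  then show ?thesis
    unfolding finite_dim_cohomology_def fact_of_simps
    by (intro iff_allI iff_exI conj_cong ball_cong refl) (simp only:)
qed

text \<open>A spanning set of H(N) is mapped by g to one of H(M), because g f is homotopic to the
  identity. All maps and homotopies are linear over \<open>pring V\<close> and therefore preserve
  the irrelevant parts.\<close>

lemma finite_dim_cohomology_hequiv:
  assumes MN: "hequiv n V M N" and M: "bfact_ok n w M" and N: "bfact_ok n w N"
    and V: "V \<subseteq> bvars M" "V \<subseteq> bvars N" and fin: "finite_dim_cohomology V (fact_of N)"
  shows "finite_dim_cohomology V (fact_of M)"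
  unfolding finite_dim_cohomology_fact_of[OF V(1)]
proof
  fix i
  let ?d = "lin (bdiff M)" and ?dN = "lin (bdiff N)"
  obtain f g where fg: "bmor V M N f" "bmor V N M g" "left_homotopy_inverse n V M f g"
    using MN by (auto simp: hequiv_def)
  have F: "blin V M N i i 0 (f i)" and fd: "x \<in> bcar M i \<Longrightarrow> f (i + 1) (?d x) = ?dN (f i x)" for i x
    using fg by (auto simp: bmor_def)
  have G: "blin V N M i i 0 (g i)" and gd: "x \<in> bcar N i \<Longrightarrow> g (i + 1) (?dN x) = ?d (g i x)" for i x
    using fg by (auto simp: bmor_def)
  obtain h where "\<forall>i. blin V M M i (i + 1) (- int n - 1) (h i) \<and>
     (\<forall>x\<in>bcar M i. g i (f i x) - x = h (i + 1) (?d x) + ?d (h i x))"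
    using fg(3) unfolding left_homotopy_inverse_def by (rule exE)
  then have h: "\<And>i. blin V M M i (i + 1) (- int n - 1) (h i)"
    "\<And>i x. x \<in> bcar M i \<Longrightarrow> g i (f i x) - x = h (i + 1) (?d x) + ?d (h i x)" by simp_all
  obtain A where "finite A \<and> A \<subseteq> cocycles V (fact_of N) i \<and>
     (\<forall>z\<in>cocycles V (fact_of N) i. \<exists>c. z - (\<Sum>b\<in>A. scale (Const (c b)) b) \<in> coboundaries V (fact_of N) i)"
    using fin[unfolded finite_dim_cohomology_fact_of[OF V(2)], THEN spec[of _ i]] by (rule exE)
  then have A: "finite A" "A \<subseteq> cocycles V (fact_of N) i"
    "\<And>z. z \<in> cocycles V (fact_of N) i \<Longrightarrow> \<exists>c. z - (\<Sum>b\<in>A. scale (Const (c b)) b) \<in> coboundaries V (fact_of N) i"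
    by simp_all
  show "\<exists>F. finite F \<and> F \<subseteq> cocycles V (fact_of M) i \<and>
      (\<forall>z\<in>cocycles V (fact_of M) i. \<exists>c. z - (\<Sum>b\<in>F. scale (Const (c b)) b) \<in> coboundaries V (fact_of M) i)"
  proof (intro exI[of _ "g i ` A"] conjI ballI)
    show "finite (g i ` A)" using A by simp
    show "g i ` A \<subseteq> cocycles V (fact_of M) i"
    proof
      fix z assume "z \<in> g i ` A"
      then obtain a where a: "a \<in> bcar N i" "?dN a \<in> irrelevant_part V (bmodule N (i + 1))" "z = g i a"
        using A by (auto simp: cocycles_fact_of)
      then show "z \<in> cocycles V (fact_of M) i"
        using irrelevant_part_blin[OF G V(2) a(2)] gd[OF a(1)] blinD(1)[OF G a(1)] by (simp add: cocycles_fact_of)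
    qed
    fix z assume "z \<in> cocycles V (fact_of M) i"
    then have z: "z \<in> bcar M i" "?d z \<in> irrelevant_part V (bmodule M (i + 1))" by (auto simp: cocycles_fact_of)
    have "f i z \<in> cocycles V (fact_of N) i"
      using irrelevant_part_blin[OF F V(1) z(2)] fd[OF z(1)] blinD(1)[OF F z(1)] by (simp add: cocycles_fact_of)
    then obtain c y u where cy: "f i z - (\<Sum>b\<in>A. scale (Const (c b)) b) = ?dN y + u" "y \<in> bcar N (i + 1)"
      "u \<in> irrelevant_part V (bmodule N i)"
      using A(3)[of "f i z"] unfolding coboundaries_fact_of mem_Collect_eq by blast
    have u: "u \<in> bcar N i" using irrelevant_part_bcar[OF V(2) cy(3)] .
    have dy: "?dN y \<in> bcar N i" using bdiff_bcar[OF N cy(2)] by simp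
    have Ab: "b \<in> bcar N i" if "b \<in> A" for b using A(2) that by (auto simp: cocycles_fact_of)
    have Ac: "scale (Const (c b)) b \<in> bcar N i" if "b \<in> A" for b using Ab[OF that] by auto
    have "f i z = (\<Sum>b\<in>A. scale (Const (c b)) b) + (?dN y + u)" using cy(1) by (simp add: algebra_simps)
    moreover have "g i (\<Sum>b\<in>A. scale (Const (c b)) b) = (\<Sum>b\<in>A. scale (Const (c b)) (g i b))"
    proof -
      have "g i (\<Sum>b\<in>A. scale (Const (c b)) b) = (\<Sum>b\<in>A. g i (scale (Const (c b)) b))"
        by (rule blin_sum[OF G]) (rule Ac)
      then show ?thesis by (simp add: blinD(3)[OF G pring_Const Ab])
    qed
    moreover have "g i (?dN y + u) = ?d (g (i + 1) y) + g i u"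
      using gd[OF cy(2)] blinD(2)[OF G dy u] by simp
    ultimately have "g i (f i z) = (\<Sum>b\<in>A. scale (Const (c b)) (g i b)) + (?d (g (i + 1) y) + g i u)"
      using blinD(2)[OF G bcar_sum bcar_add[OF dy u], of A "\<lambda>b. scale (Const (c b)) b"] Ac by simp
    then have eq: "z - (\<Sum>b\<in>A. scale (Const (c b)) (g i b)) =
        ?d (g (i + 1) y - h i z) + (g i u - h (i + 1) (?d z))"
      using h(2)[OF z(1)] by (simp add: lin_diff algebra_simps)
    have "h (i + 1) (?d z) \<in> irrelevant_part V (bmodule M i)"
      using irrelevant_part_blin[OF h(1) V(1) z(2)] by simp
    from irrelevant_part_diff[OF V(1) irrelevant_part_blin[OF G V(2) cy(3)] this]
    have "z - (\<Sum>b\<in>A. scale (Const (c b)) (g i b)) \<in> coboundaries V (fact_of M) i"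
      unfolding eq coboundaries_fact_of
      using bcar_diff[OF blinD(1)[OF G cy(2)] blinD(1)[OF h(1) z(1)]] by blast
    \<comment> \<open>\<open>g i\<close> may identify elements of \<open>A\<close>, so coefficients
      are added up over its fibres.\<close>
    moreover have "(\<Sum>b\<in>A. scale (Const (c b)) (g i b)) =
        (\<Sum>a\<in>g i ` A. scale (Const (\<Sum>b\<in>{b\<in>A. g i b = a}. c b)) a)"
    proof -
      have scale_sum: "scale (Const (\<Sum>b\<in>B. c b)) a = (\<Sum>b\<in>B. scale (Const (c b)) a)" for B and a :: "'a \<Rightarrow>\<^sub>0 qpoly"
        by (induction B rule: infinite_finite_induct) (auto simp: Const_add scale_add_left)
      show ?thesis
        by (subst sum.image_gen[OF A(1), of _ "g i"]) (auto simp: scale_sum intro!: sum.cong)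
    qed
    ultimately show "\<exists>c. z - (\<Sum>b\<in>g i ` A. scale (Const (c b)) b) \<in> coboundaries V (fact_of M) i"
      by (intro exI[of _ "\<lambda>a. \<Sum>b\<in>{b\<in>A. g i b = a}. c b"]) simp
  qed
qed

text \<open>Modulo the irrelevant part every cocycle has rational coefficients on the basis, so all
  classes come from a subspace of a finite-dimensional rational vector space.\<close>

lemma finite_dim_cohomology_finite_basis:
  assumes N: "bfact_ok n w N" and fin: "finite (basis N)"
  shows "finite_dim_cohomology (bvars N) (fact_of N)"
  unfolding finite_dim_cohomology_fact_of[OF order_refl]
proof
  fix i
  let ?V = "bvars N" and ?d = "lin (bdiff N)"
  let ?Z = "cocycles ?V (fact_of N) i"
  let ?I = "irrelevant_part ?V (bmodule N i)"
  interpret vs: vector_space "\<lambda>c. scale (Const c) :: ('a \<Rightarrow>\<^sub>0 qpoly) \<Rightarrow> _"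
    by unfold_locales (simp_all add: scale_add_right scale_add_left Const_add Const_mult)
  let ?E = "(\<lambda>b. Poly_Mapping.single b 1) ` basis N"
  \<comment> \<open>A basis of the cocycles with rational coefficients; it is finite, being
    independent inside the span of a finite set.\<close>
  obtain B where B: "B \<subseteq> ?Z \<inter> vs.span ?E" "vs.independent B" "?Z \<inter> vs.span ?E \<subseteq> vs.span B"
    using vs.maximal_independent_subset by blast
  have finB: "finite B" using vs.independent_span_bound[of ?E B] B fin by auto
  show "\<exists>F. finite F \<and> F \<subseteq> ?Z \<and> (\<forall>z\<in>?Z. \<exists>c. z - (\<Sum>b\<in>F. scale (Const (c b)) b) \<in> coboundaries ?V (fact_of N) i)"
  proof (intro exI[of _ B] conjI ballI finB)
    show "B \<subseteq> ?Z" using B by blast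
    fix z assume "z \<in> ?Z"
    then have z: "z \<in> bcar N i" "?d z \<in> irrelevant_part ?V (bmodule N (i + 1))" by (auto simp: cocycles_fact_of)
    have "\<exists>c. Poly_Mapping.lookup z b - Const c \<in> irrelevant_ideal ?V" for b
      using constant_part[OF bcar_lookup[OF z(1)]] .
    then obtain c where c: "\<And>b. Poly_Mapping.lookup z b - Const (c b) \<in> irrelevant_ideal ?V" by metis
    define z' where "z' = (\<Sum>b\<in>Poly_Mapping.keys z. scale (Const (c b)) (Poly_Mapping.single b 1))"
    have b: "b \<in> basis N" "par N b = i" if "b \<in> Poly_Mapping.keys z" for b
      using z(1) that by (auto simp: bcar_def in_keys_iff)
    have "z - z' = (\<Sum>b\<in>Poly_Mapping.keys z. scale (Poly_Mapping.lookup z b - Const (c b)) (Poly_Mapping.single b 1))"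
      unfolding z'_def by (subst poly_mapping_sum_singles[of z]) (simp flip: sum_subtractf single_diff)
    also have "\<dots> \<in> ?I"
    proof -
      have sumI: "sum t A \<in> ?I" if "\<And>b. b \<in> A \<Longrightarrow> t b \<in> ?I" for A and t :: "'a \<Rightarrow> 'a \<Rightarrow>\<^sub>0 qpoly"
        using that by (induction A rule: infinite_finite_induct) (auto intro: irrelevant_part_zero irrelevant_part_add)
      show ?thesis
        by (rule sumI, intro irrelevant_part_scale c bcar_single b pring_one)
    qed
    finally have zz': "z - z' \<in> ?I" .
    have z'_bcar: "z' \<in> bcar N i" unfolding z'_def using b by (auto intro!: bcar_single)
    have "?d z' = ?d z - ?d (z - z')" by (simp add: lin_diff)
    also have "\<dots> \<in> irrelevant_part ?V (bmodule N (i + 1))"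
      using z(2) irrelevant_part_blin[OF blin_bdiff[OF N] order_refl zz'] by (intro irrelevant_part_diff) auto
    finally have "z' \<in> ?Z" using z'_bcar by (simp add: cocycles_fact_of)
    moreover have "z' \<in> vs.span ?E"
      unfolding z'_def using b by (intro vs.span_sum vs.span_scale vs.span_base) auto
    ultimately have "z' \<in> vs.span B" using B by blast
    then obtain u where u: "z' = (\<Sum>b\<in>B. scale (Const (u b)) b)"
      using vs.span_finite[OF finB] by auto
    have "z - z' = ?d 0 + (z - z')" by simp
    then have "z - z' \<in> coboundaries ?V (fact_of N) i"
      unfolding coboundaries_fact_of using zz' bcar_zero by blast
    then show "\<exists>c. z - (\<Sum>b\<in>B. scale (Const (c b)) b) \<in> coboundaries ?V (fact_of N) i"
      by (intro exI[of _ u]) (simp add: u)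
  qed
qed

text \<open>Finite rank is demanded of \<open>N\<close> only. The cohomology of \<open>M\<close> is
  finite-dimensional by homotopy invariance, even when \<open>M\<close> has infinite rank over
  \<open>pring V\<close>.\<close>

lemma hmf_iso_of_hequiv:
  assumes "hequiv n V M N" "bfact_ok n w M" "bfact_ok n w N" "w \<in> pring V"
    and "V \<subseteq> bvars M" "bvars N = V" "finite (basis N)"
  shows "hmf_iso n V w (fact_of M) (fact_of N)"
proof -
  have fin: "finite_dim_cohomology V (fact_of N)"
    using finite_dim_cohomology_finite_basis[OF assms(3,7)] assms(6) by simp
  have "hmf_object n V w (fact_of M)" "hmf_object n V w (fact_of N)"
    unfolding hmf_object_def
    using fin finite_dim_cohomology_hequiv[OF assms(1-3) _ _ fin] assms
    by (auto intro: graded_factorization_fact_of)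
  moreover obtain f g where fg: "bmor V M N f" "bmor V N M g" "left_homotopy_inverse n V M f g" "left_homotopy_inverse n V N g f"
    using assms(1) by (auto simp: hequiv_def)
  ultimately show ?thesis
    unfolding hmf_iso_def bmor_iff[symmetric]
    using left_homotopy_inverse_imp_homotopic[OF fg(3,1,2)] left_homotopy_inverse_imp_homotopic[OF fg(4,2,1)]
    by (intro conjI exI[of _ f] exI[of _ g])
qed

section \<open>Elimination of a row\<close>

instance bit :: finite
proof
  have "(UNIV :: bit set) = {0, 1}" by auto
  then show "finite (UNIV :: bit set)" by (metis finite.emptyI finite.insertI)
qed

text \<open>Division with remainder by \<open>\<beta>\<close> in \<open>S\<close>:
  \<open>Rem\<close> is a complement of the multiples of \<open>\<beta>\<close>, stable under the
  ground ring \<open>V\<close> (here a set of polynomials, not of variables) and under homogeneous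
  components. It is used for \<open>\<beta>\<close> linear in the mark to be removed, with
  remainders free of that mark, and for \<open>\<beta>\<close> of degree \<open>n - 1\<close> with
  rational leading coefficient, with remainders of smaller degree.\<close>

locale division =
  fixes V S Rem :: "qpoly set" and \<beta> :: qpoly and e :: int and W :: "nat set"
  assumes S: "S = pring W" and V: "V \<subseteq> S"
    and \<beta>: "\<beta> \<noteq> 0" "\<beta> \<in> S" "homogeneous \<beta> e"
    and ex_division: "s \<in> S \<Longrightarrow> \<exists>q\<in>S. s - \<beta> * q \<in> Rem"
    and unique_division: "q \<in> S \<Longrightarrow> \<beta> * q \<in> Rem \<Longrightarrow> q = 0"
    and Rem_add: "r \<in> Rem \<Longrightarrow> r' \<in> Rem \<Longrightarrow> r + r' \<in> Rem"
    and Rem_mult: "c \<in> V \<Longrightarrow> r \<in> Rem \<Longrightarrow> c * r \<in> Rem"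
    and Rem_hcomp: "r \<in> Rem \<Longrightarrow> hcomp d r \<in> Rem"
    and uminus_one: "- 1 \<in> V"
begin

definition quot :: "qpoly \<Rightarrow> qpoly" where
  "quot s = (THE q. q \<in> S \<and> s - \<beta> * q \<in> Rem)"

lemma Rem_diff: "r \<in> Rem \<Longrightarrow> r' \<in> Rem \<Longrightarrow> r - r' \<in> Rem"
  using Rem_add[of r "- r'"] Rem_mult[OF uminus_one, of r'] by simp

lemma quot_eqI:
  assumes "q \<in> S" "s - \<beta> * q \<in> Rem"
  shows "quot s = q"
  unfolding quot_def
proof (rule the_equality)
  fix q' assume q': "q' \<in> S \<and> s - \<beta> * q' \<in> Rem"
  have "\<beta> * (q' - q) = (s - \<beta> * q) - (s - \<beta> * q')" by (simp add: algebra_simps)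
  also have "\<dots> \<in> Rem" using Rem_diff assms q' by blast
  finally have "q' - q = 0" using assms q' by (intro unique_division) (auto simp: S)
  then show "q' = q" by simp
qed (use assms in simp)

lemma quot: "s \<in> S \<Longrightarrow> quot s \<in> S" "s \<in> S \<Longrightarrow> s - \<beta> * quot s \<in> Rem"
  using ex_division[of s] quot_eqI[of _ s] by auto

lemma quot_add:
  assumes "s \<in> S" "t \<in> S"
  shows "quot (s + t) = quot s + quot t"
proof (rule quot_eqI)
  show "quot s + quot t \<in> S" using quot(1)[OF assms(1)] quot(1)[OF assms(2)] by (auto simp: S)
  have "s + t - \<beta> * (quot s + quot t) = (s - \<beta> * quot s) + (t - \<beta> * quot t)" by (simp add: algebra_simps)
  also have "\<dots> \<in> Rem" using Rem_add quot(2) assms by blast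
  finally show "s + t - \<beta> * (quot s + quot t) \<in> Rem" .
qed

lemma quot_mult:
  assumes "s \<in> S" "c \<in> V"
  shows "quot (c * s) = c * quot s"
proof (rule quot_eqI)
  show "c * quot s \<in> S" using quot(1)[OF assms(1)] assms(2) V by (auto simp: S)
  have "c * s - \<beta> * (c * quot s) = c * (s - \<beta> * quot s)" by (simp add: algebra_simps)
  also have "\<dots> \<in> Rem" using Rem_mult quot(2) assms by blast
  finally show "c * s - \<beta> * (c * quot s) \<in> Rem" .
qed

lemma zero_Rem: "0 \<in> Rem"
  using quot(2)[of 0] Rem_diff[of "0 - \<beta> * quot 0" "0 - \<beta> * quot 0"] by (simp add: S)

lemma quot_multiple: "q \<in> S \<Longrightarrow> quot (\<beta> * q) = q"
  using zero_Rem by (intro quot_eqI) auto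

lemma quot_zero [simp]: "quot 0 = 0"
  using quot_multiple[of 0] by (simp add: S)

text \<open>Since \<open>Rem\<close> is stable under components, the component of degree
  \<open>k - e\<close> of the quotient leaves a remainder in \<open>Rem\<close> too; uniqueness
  identifies it with the quotient.\<close>

lemma quot_homogeneous:
  assumes "s \<in> S" "homogeneous s k"
  shows "homogeneous (quot s) (k - e)"
proof -
  have "quot s = hcomp (k - e) (quot s)"
  proof (rule quot_eqI)
    show "hcomp (k - e) (quot s) \<in> S" using quot(1)[OF assms(1)] by (auto simp: S)
    have "s - \<beta> * hcomp (k - e) (quot s) = hcomp k (s - \<beta> * quot s)"
      using hcomp_add[of k s "- (\<beta> * quot s)"] assms(2)
      by (simp add: hcomp_uminus hcomp_mult_left[OF \<beta>(3)] homogeneous_iff)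
    also have "\<dots> \<in> Rem" using Rem_hcomp quot(2)[OF assms(1)] by blast
    finally show "s - \<beta> * hcomp (k - e) (quot s) \<in> Rem" .
  qed
  then show ?thesis by (metis homogeneous_hcomp)
qed

end

lemma sum_single_UNIV:
  fixes v :: "'b::finite \<Rightarrow>\<^sub>0 qpoly"
  shows "v = (\<Sum>b\<in>UNIV. Poly_Mapping.single b (Poly_Mapping.lookup v b))"
  by (rule poly_mapping_eqI) (simp add: lookup_sum lookup_single when_def sum.delta)

text \<open>The block \<open>P \<rightarrow> Q\<close> of the differential, where \<open>P\<close> is the complement of \<open>Q\<close>, is a signed
  multiple of \<open>\<beta>\<close>; dividing the components in \<open>Q\<close> by \<open>\<beta>\<close> contracts the submodule of those
  \<open>x\<close> whose components in \<open>Q\<close> are divisible by \<open>\<beta>\<close>.\<close>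

lemma hequiv_elimination:
  fixes M :: "'b::finite bfact" and N :: "'c bfact" and Q :: "'b set" and \<tau> :: "'b \<Rightarrow> 'b" and \<epsilon> :: "'b \<Rightarrow> qpoly"
  assumes div: "division (pring V) S Rem \<beta> e (bvars M)"
    and M: "bfact_ok n w M" "basis M = UNIV" and N: "bfact_ok n w N" and VM: "V \<subseteq> bvars M" "V \<subseteq> bvars N" "w \<in> pring V"
    and \<tau>: "\<And>b. \<tau> (\<tau> b) = b" "\<And>b. \<tau> b \<in> Q \<longleftrightarrow> b \<notin> Q" "\<And>b. par M (\<tau> b) = par M b + 1"
    and deg: "\<And>b. b \<in> Q \<Longrightarrow> bdeg M b + e = bdeg M (\<tau> b) + int n + 1"
    and \<epsilon>: "\<And>b. \<epsilon> b = 1 \<or> \<epsilon> b = - 1"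
    and block: "\<And>i u b. u \<in> bcar M i \<Longrightarrow> (\<And>b. b \<in> Q \<Longrightarrow> Poly_Mapping.lookup u b = 0) \<Longrightarrow> b \<in> Q \<Longrightarrow>
        Poly_Mapping.lookup (lin (bdiff M) u) b = \<epsilon> b * \<beta> * Poly_Mapping.lookup u (\<tau> b)"
    and K: "K = {x. \<forall>b\<in>Q. \<exists>s\<in>S. Poly_Mapping.lookup x b = \<beta> * s}"
    and \<Psi>: "\<And>i. blin V N M i i 0 \<Psi>"
    and \<Psi>d: "\<And>i y. y \<in> bcar N i \<Longrightarrow> lin (bdiff M) (\<Psi> y) - \<Psi> (lin (bdiff N) y) \<in> K"
    and ex: "\<And>k b r. b \<in> Q \<Longrightarrow> r \<in> Rem \<Longrightarrow> r \<in> S \<Longrightarrow> homogeneous r k \<Longrightarrow>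
        \<exists>y\<in>bgrade N (par M b) (k + bdeg M b). Poly_Mapping.single b r - \<Psi> y \<in> K"
    and inj: "\<And>i y. y \<in> bcar N i \<Longrightarrow> \<Psi> y \<in> K \<Longrightarrow> y = 0"
  shows "hequiv n V M N"
proof -
  interpret division "pring V" S Rem \<beta> e "bvars M" by (rule div)
  let ?d = "lin (bdiff M)"
  have dM: "blin V M M i (i + 1) (int n + 1) ?d" for i by (rule blin_bdiff[OF M(1)])
  have K_add: "x + y \<in> K" if xy: "x \<in> K" "y \<in> K" for x y
    unfolding K
  proof (intro CollectI ballI)
    fix b assume "b \<in> Q"
    then obtain s t where "s \<in> S" "t \<in> S" "Poly_Mapping.lookup x b = \<beta> * s" "Poly_Mapping.lookup y b = \<beta> * t"
      using xy unfolding K by blast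
    then show "\<exists>s\<in>S. Poly_Mapping.lookup (x + y) b = \<beta> * s"
      by (intro bexI[of _ "s + t"]) (auto simp: lookup_add distrib_left S)
  qed
  have K_scale: "scale r x \<in> K" if rx: "r \<in> S" "x \<in> K" for x r
    unfolding K
  proof (intro CollectI ballI)
    fix b assume "b \<in> Q"
    then obtain s where "s \<in> S" "Poly_Mapping.lookup x b = \<beta> * s"
      using rx(2) unfolding K by blast
    then show "\<exists>s\<in>S. Poly_Mapping.lookup (scale r x) b = \<beta> * s"
      using rx(1) by (intro bexI[of _ "r * s"]) (auto simp: S)
  qed
  have K_zero: "x \<in> K" if "\<And>b. b \<in> Q \<Longrightarrow> Poly_Mapping.lookup x b = 0" for x
    using that unfolding K by (auto simp: S intro!: bexI[of _ 0])
  have K_sum: "sum f A \<in> K" if "\<And>x. x \<in> A \<Longrightarrow> f x \<in> K" for f and A :: "'b set"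
    using that by (induction A rule: infinite_finite_induct) (auto intro: K_add K_zero)
  \<comment> \<open>Inverts the block from the complement into \<open>Q\<close>: the coefficient at
    \<open>\<tau> p\<close>, for \<open>p\<close> outside \<open>Q\<close>, is divided by
    \<open>\<beta>\<close> and its sign is undone. On all of \<open>M\<close> this division leaves
    remainders, so in general it is linear over \<open>V\<close> only.\<close>
  define h :: "('b \<Rightarrow>\<^sub>0 qpoly) \<Rightarrow> 'b \<Rightarrow>\<^sub>0 qpoly" where
    "h x = (\<Sum>p\<in>UNIV. Poly_Mapping.single p (if p \<in> Q then 0 else \<epsilon> (\<tau> p) * quot (Poly_Mapping.lookup x (\<tau> p))))" for x
  have h: "Poly_Mapping.lookup (h x) p = (if p \<in> Q then 0 else \<epsilon> (\<tau> p) * quot (Poly_Mapping.lookup x (\<tau> p)))" for x p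
    by (simp add: h_def lookup_sum lookup_single when_def sum.delta)
  have \<epsilon>S: "\<epsilon> b \<in> S" "homogeneous (\<epsilon> b) 0" "\<epsilon> b * (\<epsilon> b * s) = s" for b s
    using \<epsilon>[of b] pring_uminus[OF pring_one] homogeneous_uminus[OF homogeneous_one] by (auto simp: S)
  have xS: "Poly_Mapping.lookup x b \<in> S" if "x \<in> bcar M i" for x i b
    using bcar_lookup[OF that] by (simp add: S)
  have h_bcar: "h x \<in> bcar M (i + 1)" if x: "x \<in> bcar M i" for x i
    unfolding bcar_def
  proof (intro CollectI allI impI)
    fix p assume p: "Poly_Mapping.lookup (h x) p \<noteq> 0"
    then have "p \<notin> Q" "Poly_Mapping.lookup x (\<tau> p) \<noteq> 0" by (auto simp: h split: if_splits)
    then have "par M p = i + 1" using x \<tau>(1)[of p] \<tau>(3)[of "\<tau> p"] by (auto simp: bcar_def)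
    moreover have "Poly_Mapping.lookup (h x) p \<in> pring (bvars M)"
      using \<epsilon>S(1)[of "\<tau> p"] quot(1)[OF xS[OF x]] by (auto simp: h S)
    ultimately show "p \<in> basis M \<and> par M p = i + 1 \<and> Poly_Mapping.lookup (h x) p \<in> pring (bvars M)"
      using M(2) by simp
  qed
  have h_lin: "blin V M M i (i + 1) (- int n - 1) h" for i
    unfolding blin_def
  proof (intro conjI ballI allI)
    fix x assume x: "x \<in> bcar M i"
    show "h x \<in> bcar M (i + 1)" by (rule h_bcar[OF x])
    show "h (x + y) = h x + h y" if y: "y \<in> bcar M i" for y
      by (rule poly_mapping_eqI) (simp add: h lookup_add quot_add[OF xS[OF x] xS[OF y]] distrib_left)
    show "h (scale r x) = scale r (h x)" if r: "r \<in> pring V" for r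
      by (rule poly_mapping_eqI) (simp add: h quot_mult[OF xS[OF x] r])
  next
    fix l x assume x: "x \<in> bgrade M i l"
    have "homogeneous (Poly_Mapping.lookup (h x) p) (l + (- int n - 1) - bdeg M p)" for p
    proof (cases "p \<in> Q")
      case False
      have "homogeneous (quot (Poly_Mapping.lookup x (\<tau> p))) (l - bdeg M (\<tau> p) - e)"
        using x by (intro quot_homogeneous xS[OF bgrade_bcar]) (auto simp: bgrade_def)
      then show ?thesis
        using False deg[of "\<tau> p"] \<tau>(1,2) \<epsilon>S(2) unfolding h by (auto intro!: homogeneous_mult'[of _ 0 _ "l - bdeg M (\<tau> p) - e"])
    qed (simp add: h)
    then show "h x \<in> bgrade M (i + 1) (l + (- int n - 1))"
      using h_bcar[OF bgrade_bcar[OF x]] by (simp add: bgrade_def)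
  qed
  have hQ: "h x = 0" if "\<And>b. b \<in> Q \<Longrightarrow> Poly_Mapping.lookup x b = 0" for x
    using that \<tau>(2) by (intro poly_mapping_eqI) (auto simp: h)
  have key: "?d (h x) + h (?d x) = x \<and> ?d x \<in> K" if x: "x \<in> bcar M i" "x \<in> K" for x i
  proof -
    have hx: "h x \<in> bcar M (i + 1)" by (rule h_bcar[OF x(1)])
    have Q: "Poly_Mapping.lookup (?d (h x)) b = Poly_Mapping.lookup x b" if b: "b \<in> Q" for b
    proof -
      obtain s where s: "s \<in> S" "Poly_Mapping.lookup x b = \<beta> * s" using x(2) b unfolding K by blast
      have "Poly_Mapping.lookup (?d (h x)) b = \<epsilon> b * \<beta> * (\<epsilon> b * quot (Poly_Mapping.lookup x b))"
        using block[OF hx _ b] b \<tau>(1,2) by (simp add: h)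
      also have "quot (Poly_Mapping.lookup x b) = s" using quot_multiple[OF s(1)] s(2) by simp
      also have "\<epsilon> b * \<beta> * (\<epsilon> b * s) = \<epsilon> b * (\<epsilon> b * (\<beta> * s))" by (simp add: ac_simps)
      finally show ?thesis by (simp only: \<epsilon>S(3) s(2))
    qed
    \<comment> \<open>Splits \<open>x\<close> as d (h x) + r, where \<open>r\<close> has no
      components in \<open>Q\<close>. Then d x = w (h x) + d r; the map h kills the first summand
      and returns \<open>r\<close> on the second.\<close>
    define r where "r = x - ?d (h x)"
    have r0: "Poly_Mapping.lookup r b = 0" if "b \<in> Q" for b using Q[OF that] by (simp add: r_def lookup_minus)
    have r: "r \<in> bcar M i" unfolding r_def using blinD(1)[OF dM hx] x(1) by auto
    have dr: "Poly_Mapping.lookup (?d r) b = \<epsilon> b * \<beta> * Poly_Mapping.lookup r (\<tau> b)" if "b \<in> Q" for b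
      by (rule block[OF r r0 that])
    have dx: "?d x = scale w (h x) + ?d r"
      using bdiff_bdiff[OF M(1) hx] by (simp add: r_def lin_diff)
    have "?d r \<in> K"
      unfolding K using dr xS[OF r] \<epsilon>S(1)
      by (auto intro!: bexI[of _ "\<epsilon> _ * Poly_Mapping.lookup r (\<tau> _)"] simp: S ac_simps)
    moreover have "scale w (h x) \<in> K" by (rule K_zero) (simp add: h)
    ultimately have "?d x \<in> K" unfolding dx using K_add by blast
    moreover have "h (?d x) = r"
    proof -
      have dr_bcar: "?d r \<in> bcar M (i + 1)" using blinD(1)[OF dM r] .
      have "h (?d x) = h (scale w (h x)) + h (?d r)"
        unfolding dx using VM(3) hx pring_mono[OF VM(3,1)] by (intro blinD(2)[OF h_lin _ dr_bcar]) auto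
      also have "h (scale w (h x)) = 0" by (rule hQ) (simp add: h)
      also have "h (?d r) = r"
      proof (rule poly_mapping_eqI)
        fix p
        show "Poly_Mapping.lookup (h (?d r)) p = Poly_Mapping.lookup r p"
        proof (cases "p \<in> Q")
          case False
          then have "quot (Poly_Mapping.lookup (?d r) (\<tau> p)) = quot (\<beta> * (\<epsilon> (\<tau> p) * Poly_Mapping.lookup r p))"
            using dr[of "\<tau> p"] \<tau>(1,2) by (simp add: ac_simps)
          also have "\<dots> = \<epsilon> (\<tau> p) * Poly_Mapping.lookup r p"
            using \<epsilon>S(1) xS[OF r] by (intro quot_multiple) (auto simp: S)
          finally show ?thesis using False by (simp add: h \<epsilon>S(3))
        qed (simp add: h r0)
      qed
      finally show ?thesis by simp
    qed
    ultimately show ?thesis by (simp add: r_def)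
  qed
  show ?thesis
  proof (rule hequiv_contractible_quotient[OF M(1) N VM, where K = K and h = h and \<Psi> = \<Psi>])
    show "scale r x \<in> K" if "r \<in> pring V" "x \<in> K" for r x using that V K_scale division.V[OF div] by blast
    show "h x \<in> K" for x by (rule K_zero) (simp add: h)
    show "x = ?d (h x) + h (?d x)" "?d x \<in> K" if "x \<in> bcar M i" "x \<in> K" for x i using key[OF that] by simp_all
    fix i k x assume x: "x \<in> bgrade M i k"
    have x': "x \<in> bcar M i" by (rule bgrade_bcar[OF x])
    have "\<exists>y\<in>bgrade N i k. Poly_Mapping.single b (Poly_Mapping.lookup x b) - \<Psi> y \<in> K" for b
    proof (cases "b \<in> Q \<and> Poly_Mapping.lookup x b \<noteq> 0")
      case True
      then have par: "par M b = i" using x' by (auto simp: bcar_def)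
      let ?s = "Poly_Mapping.lookup x b"
      \<comment> \<open>The multiple of \<open>\<beta>\<close> lies in \<open>K\<close>, so only the
        remainder has to be attained by \<open>\<Psi>\<close>.\<close>
      let ?r = "?s - \<beta> * quot ?s"
      have hom: "homogeneous ?s (k - bdeg M b)" using x by (simp add: bgrade_def)
      have "homogeneous (\<beta> * quot ?s) (k - bdeg M b)"
        by (rule homogeneous_mult'[OF \<beta>(3) quot_homogeneous[OF xS[OF x'] hom]]) simp
      then have "homogeneous ?r (k - bdeg M b)" using hom by blast
      moreover have "?r \<in> Rem" "?r \<in> S"
        using quot[OF xS[OF x']] xS[OF x'] \<beta>(2) by (auto simp: S)
      ultimately obtain y where y: "y \<in> bgrade N i k" "Poly_Mapping.single b ?r - \<Psi> y \<in> K"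
        using ex[of b ?r "k - bdeg M b"] True par by auto
      have "Poly_Mapping.single b (\<beta> * quot ?s) \<in> K"
        unfolding K
      proof (intro CollectI ballI)
        fix b'
        show "\<exists>t\<in>S. Poly_Mapping.lookup (Poly_Mapping.single b (\<beta> * quot ?s)) b' = \<beta> * t"
          using quot(1)[OF xS[OF x'], of b]
          by (intro bexI[of _ "if b' = b then quot ?s else 0"]) (auto simp: lookup_single when_def S)
      qed
      from K_add[OF y(2) this] have "Poly_Mapping.single b ?s - \<Psi> y \<in> K"
        by (simp add: single_diff algebra_simps)
      with y(1) show ?thesis by blast
    next
      case False
      have "\<Psi> 0 = 0" by (rule blin_0[OF \<Psi>])
      then have "Poly_Mapping.single b (Poly_Mapping.lookup x b) - \<Psi> 0 \<in> K"
        using False by (intro K_zero) (auto simp: lookup_single when_def)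
      then show ?thesis by blast
    qed
    then obtain y where y: "\<And>b. y b \<in> bgrade N i k" "\<And>b. Poly_Mapping.single b (Poly_Mapping.lookup x b) - \<Psi> (y b) \<in> K"
      by metis
    have "(\<Sum>b\<in>UNIV. Poly_Mapping.single b (Poly_Mapping.lookup x b) - \<Psi> (y b)) \<in> K"
      by (rule K_sum) (rule y(2))
    also have "(\<Sum>b\<in>UNIV. Poly_Mapping.single b (Poly_Mapping.lookup x b) - \<Psi> (y b)) = x - \<Psi> (\<Sum>b\<in>UNIV. y b)"
      unfolding sum_subtractf blin_sum[OF \<Psi>, OF bgrade_bcar[OF y(1)]] by (simp flip: sum_single_UNIV)
    finally show "\<exists>y\<in>bgrade N i k. x - \<Psi> y \<in> K" using bgrade_sum[of UNIV y N i k] y(1) by blast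
  qed (use K_add h_lin \<Psi> \<Psi>d inj in blast)+
qed

section \<open>The entries of wide edges and arcs\<close>

text \<open>Newton's recursion for x^k + y^k in terms of s = x + y and p = x y; for
  \<open>k = n + 1\<close> it is the polynomial g.\<close>

fun powsum :: "nat \<Rightarrow> 'a::comm_ring_1 \<Rightarrow> 'a \<Rightarrow> 'a" where
  "powsum 0 s p = 2"
| "powsum (Suc 0) s p = s"
| "powsum (Suc (Suc k)) s p = s * powsum (Suc k) s p - p * powsum k s p"

text \<open>The divided differences of \<^term>\<open>powsum k\<close> in its first and in its second variable.\<close>

fun powsum_dd1 :: "nat \<Rightarrow> 'a::comm_ring_1 \<Rightarrow> 'a \<Rightarrow> 'a \<Rightarrow> 'a" where
  "powsum_dd1 0 s s' p = 0"
| "powsum_dd1 (Suc 0) s s' p = 1"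
| "powsum_dd1 (Suc (Suc k)) s s' p = s * powsum_dd1 (Suc k) s s' p + powsum (Suc k) s' p - p * powsum_dd1 k s s' p"

fun powsum_dd2 :: "nat \<Rightarrow> 'a::comm_ring_1 \<Rightarrow> 'a \<Rightarrow> 'a \<Rightarrow> 'a" where
  "powsum_dd2 0 s p p' = 0"
| "powsum_dd2 (Suc 0) s p p' = 0"
| "powsum_dd2 (Suc (Suc k)) s p p' = s * powsum_dd2 (Suc k) s p p' - p * powsum_dd2 k s p p' - powsum k s p'"

lemma powsum_eq: "powsum k (x + y) (x * y) = x ^ k + y ^ k"
  by (induction k "x + y" "x * y" rule: powsum.induct) (simp_all add: algebra_simps)

text \<open>The product rule s f - s' f' = s (f - f') + (s - s') f' is the recursion that defines
  \<open>powsum_dd1\<close>.\<close>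

lemma powsum_dd1: "(s - s') * powsum_dd1 k s s' p = powsum k s p - powsum k s' p"
proof (induction k s s' p rule: powsum_dd1.induct)
  case (3 k s s' p)
  have "(s - s') * powsum_dd1 (Suc (Suc k)) s s' p =
    s * ((s - s') * powsum_dd1 (Suc k) s s' p) + (s - s') * powsum (Suc k) s' p - p * ((s - s') * powsum_dd1 k s s' p)"
    by (simp add: algebra_simps)
  then show ?case by (simp only: 3) (simp add: algebra_simps)
qed simp_all

lemma powsum_dd2: "(p - p') * powsum_dd2 k s p p' = powsum k s p - powsum k s p'"
proof (induction k s p p' rule: powsum_dd2.induct)
  case (3 k s p p')
  have "(p - p') * powsum_dd2 (Suc (Suc k)) s p p' =
    s * ((p - p') * powsum_dd2 (Suc k) s p p') - p * ((p - p') * powsum_dd2 k s p p') - (p - p') * powsum k s p'"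
    by (simp add: algebra_simps)
  then show ?case by (simp only: 3) (simp add: algebra_simps)
qed simp_all

lemma subst_powsum: "subst \<sigma> (powsum k s p) = powsum k (subst \<sigma> s) (subst \<sigma> p)"
  by (induction k s p rule: powsum.induct) (simp_all add: subst_ring_simps)
lemma subst_powsum_dd1: "subst \<sigma> (powsum_dd1 k s s' p) = powsum_dd1 k (subst \<sigma> s) (subst \<sigma> s') (subst \<sigma> p)"
  by (induction k s s' p rule: powsum_dd1.induct) (simp_all add: subst_ring_simps subst_powsum)
lemma subst_powsum_dd2: "subst \<sigma> (powsum_dd2 k s p p') = powsum_dd2 k (subst \<sigma> s) (subst \<sigma> p) (subst \<sigma> p')"
  by (induction k s p p' rule: powsum_dd2.induct) (simp_all add: subst_ring_simps subst_powsum)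

lemma pring_numeral [simp, intro]: "numeral k \<in> pring V"
  using pring_Const[of "numeral k" V] by (simp only: Const_numeral)
lemma homogeneous_numeral [simp, intro]: "homogeneous (numeral k) 0"
  using homogeneous_Const[of "numeral k"] by (simp only: Const_numeral)

lemma pring_powsum: "s \<in> pring V \<Longrightarrow> p \<in> pring V \<Longrightarrow> powsum k s p \<in> pring V"
  by (induction k s p rule: powsum.induct) auto
lemma pring_powsum_dd1: "s \<in> pring V \<Longrightarrow> s' \<in> pring V \<Longrightarrow> p \<in> pring V \<Longrightarrow> powsum_dd1 k s s' p \<in> pring V"
  by (induction k s s' p rule: powsum_dd1.induct) (auto intro: pring_powsum)
lemma pring_powsum_dd2: "s \<in> pring V \<Longrightarrow> p \<in> pring V \<Longrightarrow> p' \<in> pring V \<Longrightarrow> powsum_dd2 k s p p' \<in> pring V"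
  by (induction k s p p' rule: powsum_dd2.induct) (auto intro: pring_powsum)

lemma homogeneous_powsum: "homogeneous s 2 \<Longrightarrow> homogeneous p 4 \<Longrightarrow> homogeneous (powsum k s p) (2 * int k)"
proof (induction k s p rule: powsum.induct)
  case (3 k s p)
  have "homogeneous (s * powsum (Suc k) s p) (2 * int (Suc (Suc k)))" "homogeneous (p * powsum k s p) (2 * int (Suc (Suc k)))"
    by (rule homogeneous_mult'[OF 3(3) 3(1)], use 3 in simp_all) (rule homogeneous_mult'[OF 3(4) 3(2)], use 3 in simp_all)
  then show ?case by auto
qed simp_all

lemma homogeneous_powsum_dd1:
  "homogeneous s 2 \<Longrightarrow> homogeneous s' 2 \<Longrightarrow> homogeneous p 4 \<Longrightarrow> homogeneous (powsum_dd1 k s s' p) (2 * int k - 2)"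
proof (induction k s s' p rule: powsum_dd1.induct)
  case (3 k s s' p)
  have "homogeneous (s * powsum_dd1 (Suc k) s s' p) (2 * int (Suc (Suc k)) - 2)"
    by (rule homogeneous_mult'[OF 3(3) 3(1)]) (use 3 in simp_all)
  moreover have "homogeneous (p * powsum_dd1 k s s' p) (2 * int (Suc (Suc k)) - 2)"
    by (rule homogeneous_mult'[OF 3(5) 3(2)]) (use 3 in simp_all)
  moreover have "homogeneous (powsum (Suc k) s' p) (2 * int (Suc (Suc k)) - 2)"
    using homogeneous_powsum[OF 3(4,5), of "Suc k"] by (simp del: powsum.simps)
  ultimately show ?case by auto
qed simp_all

lemma homogeneous_powsum_dd2:
  "homogeneous s 2 \<Longrightarrow> homogeneous p 4 \<Longrightarrow> homogeneous p' 4 \<Longrightarrow> homogeneous (powsum_dd2 k s p p') (2 * int k - 4)"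
proof (induction k s p p' rule: powsum_dd2.induct)
  case (3 k s p p')
  have "homogeneous (s * powsum_dd2 (Suc k) s p p') (2 * int (Suc (Suc k)) - 4)"
    by (rule homogeneous_mult'[OF 3(3) 3(1)]) (use 3 in simp_all)
  moreover have "homogeneous (p * powsum_dd2 k s p p') (2 * int (Suc (Suc k)) - 4)"
    by (rule homogeneous_mult'[OF 3(4) 3(2)]) (use 3 in simp_all)
  moreover have "homogeneous (powsum k s p') (2 * int (Suc (Suc k)) - 4)"
    using homogeneous_powsum[OF 3(3,5), of k] by simp
  ultimately show ?case by auto
qed simp_all

text \<open>Algebraic independence of x_1 + x_2 and x_1 x_2. After expansion in the second of them,
  setting x_2 = 0 leaves only the constant term, and then x_1 x_2 can be cancelled. This makes the
  polynomial g unique.\<close>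

lemma symmetric_subst_eq_0:
  assumes g: "g \<in> pring {1, 2}" and eq: "subst (\<lambda>i. if i = 1 then X 1 + X 2 else X 1 * X 2) g = 0"
  shows "g = 0"
proof -
  let ?\<sigma> = "\<lambda>i. if i = 1 then X 1 + X 2 else X 1 * X 2"
  have "poly P (X 2) = 0" if "P \<in> polys_over {1}" "subst ?\<sigma> (poly P (X 2)) = 0" for P
    using that
  proof (induction P)
    case (pCons a P)
    have a: "a \<in> pring {1}" and P: "P \<in> polys_over {1}" using polys_over_pConsD[OF pCons.prems(1)] by auto
    have *: "subst ?\<sigma> a + X 1 * X 2 * subst ?\<sigma> (poly P (X 2)) = 0"
      using pCons.prems(2) by (simp add: subst_add subst_mult)
    then have "subst1 2 0 (subst ?\<sigma> a + X 1 * X 2 * subst ?\<sigma> (poly P (X 2))) = 0" by simp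
    then have "subst1 2 0 (subst ?\<sigma> a) = 0" by (simp add: subst_add subst_mult)
    moreover have "subst1 2 0 (subst ?\<sigma> a) = a"
      unfolding subst_subst using a by (intro subst_ident) (auto simp: subst_add)
    ultimately have "a = 0" by simp
    with * pCons.IH[OF P] show ?case by simp
  qed simp
  moreover obtain P where "P \<in> polys_over {1}" "g = poly P (X 2 - 0)"
    using pring_insert_eq_poly[of g 2 "{1}" 0] g by (auto simp: insert_commute)
  ultimately show ?thesis using eq by simp
qed

lemma g_poly_eq: "g_poly n = powsum (n + 1) (X 1) (X 2)"
  unfolding g_poly_def
proof (rule the_equality)
  let ?\<sigma> = "\<lambda>i::nat. if i = 1 then X 1 + X 2 else X 1 * X 2"
  have eq: "subst ?\<sigma> (powsum (n + 1) (X 1) (X 2)) = X 1 ^ (n + 1) + X 2 ^ (n + 1)"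
    by (simp only: subst_powsum subst_X powsum_eq if_True refl) (simp add: powsum_eq)
  have mem: "powsum (n + 1) (X 1) (X 2) \<in> pring {1, 2}" by (intro pring_powsum) auto
  show "powsum (n + 1) (X 1) (X 2) \<in> pring {1, 2} \<and> subst ?\<sigma> (powsum (n + 1) (X 1) (X 2)) = X 1 ^ (n + 1) + X 2 ^ (n + 1)"
    using eq mem by blast
  fix g assume g: "g \<in> pring {1, 2} \<and> subst ?\<sigma> g = X 1 ^ (n + 1) + X 2 ^ (n + 1)"
  have "g - powsum (n + 1) (X 1) (X 2) = 0"
  proof (rule symmetric_subst_eq_0)
    show "g - powsum (n + 1) (X 1) (X 2) \<in> pring {1, 2}" using g mem by (intro pring_diff) auto
    show "subst ?\<sigma> (g - powsum (n + 1) (X 1) (X 2)) = 0"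
      unfolding subst_diff eq conjunct2[OF g] by simp
  qed
  then show "g = powsum (n + 1) (X 1) (X 2)" by simp
qed

lemma g_at_eq: "g_at n s p = powsum (n + 1) s p"
  by (simp add: g_at_def g_poly_eq subst_powsum del: powsum.simps)

definition pi_sum :: "nat \<Rightarrow> qpoly \<Rightarrow> qpoly \<Rightarrow> qpoly" where
  "pi_sum n x y = (\<Sum>i<Suc n. y ^ (n - i) * x ^ i)"

lemma pi_sum: "(x - y) * pi_sum n x y = x ^ (n + 1) - y ^ (n + 1)"
  using power_diff_sumr2[of x "Suc n" y] by (simp add: pi_sum_def)

lemma subst_sum: "subst \<sigma> (sum f A) = (\<Sum>i\<in>A. subst \<sigma> (f i))"
  by (induction A rule: infinite_finite_induct) (auto simp: subst_add)

lemma subst_pi_sum: "subst \<sigma> (pi_sum n x y) = pi_sum n (subst \<sigma> x) (subst \<sigma> y)"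
  by (simp add: pi_sum_def subst_sum subst_mult subst_power del: sum.lessThan_Suc)

lemma pring_pi_sum: "x \<in> pring V \<Longrightarrow> y \<in> pring V \<Longrightarrow> pi_sum n x y \<in> pring V"
  unfolding pi_sum_def by (intro pring_sum pring_mult pring_power)

lemma homogeneous_pi_sum: "homogeneous x 2 \<Longrightarrow> homogeneous y 2 \<Longrightarrow> homogeneous (pi_sum n x y) (2 * int n)"
  unfolding pi_sum_def
  by (intro homogeneous_sum homogeneous_mult'[OF homogeneous_power homogeneous_power]) (auto simp: of_nat_diff algebra_simps)

lemma arc_eq:
  assumes "i \<noteq> j"
  shows "arc n i j = rank1_fact {i, j} (1 - int n) (pi_sum n (X i) (X j)) (X i - X j)"
proof -
  \<comment> \<open>Setting \<open>X i\<close> to 0 leaves minus a power of \<open>X j\<close>.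
    Divisor and entry must be nonzero, since \<open>exact_quot\<close> and \<open>poly_deg\<close>
    are meaningful only then.\<close>
  have "subst1 i 0 (X i ^ (n + 1) - X j ^ (n + 1)) \<noteq> 0"
    using assms by (simp add: subst_ring_simps)
  then have "(X i - X j) * pi_sum n (X i) (X j) \<noteq> 0" unfolding pi_sum by auto
  then have ne: "X i - X j \<noteq> 0" "pi_sum n (X i) (X j) \<noteq> 0" by auto
  have "exact_quot (X i ^ (n + 1) - X j ^ (n + 1)) (X i - X j) = pi_sum n (X i) (X j)"
    by (rule exact_quot_eqI[OF ne(1)]) (simp only: pi_sum)
  moreover have "poly_deg (pi_sum n (X i) (X j)) = 2 * int n"
    using ne(2) by (intro poly_deg_homogeneous homogeneous_pi_sum) auto
  ultimately show ?thesis by (simp add: arc_def koszul_eq_rank1_fact)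
qed

lemma powsum_zero: "powsum (Suc k) 0 0 = (0::'a::comm_ring_1)"
  by (induction k) simp_all
lemma powsum_left: "powsum (Suc k) s 0 = (s::'a::comm_ring_1) ^ Suc k"
  by (induction k) simp_all
lemma powsum_dd1_left: "powsum_dd1 (Suc k) s 0 0 = (s::'a::comm_ring_1) ^ k"
  by (induction k) (simp_all add: powsum_zero)
text \<open>At p = p' = 0 the divided difference is the partial derivative in p, that is, the
  coefficient of p in x^(k+2) + y^(k+2).\<close>

lemma powsum_dd2_left: "powsum_dd2 (Suc (Suc k)) s 0 0 = - of_nat (k + 2) * (s::'a::comm_ring_1) ^ k"
proof (induction k)
  case (Suc k)
  have "powsum_dd2 (Suc (Suc (Suc k))) s 0 0 = s * powsum_dd2 (Suc (Suc k)) s 0 0 - powsum (Suc k) s 0"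
    by (simp only: powsum_dd2.simps(3) mult_zero_left diff_0_right)
  then show ?case by (simp only: Suc powsum_left) (simp add: algebra_simps)
qed simp

lemma wide_edge_eq:
  assumes "distinct [i1, i2, i3, i4]" "n \<ge> 1"
  shows "wide_edge n i1 i2 i3 i4 = grade_shift (- 1)
    (rank1_fact {i1, i2, i3, i4} (1 - int n) (powsum_dd1 (n + 1) (X i1 + X i2) (X i3 + X i4) (X i1 * X i2)) (X i1 + X i2 - (X i3 + X i4)) \<otimes>\<^sub>f
     rank1_fact {i1, i2, i3, i4} (3 - int n) (powsum_dd2 (n + 1) (X i3 + X i4) (X i1 * X i2) (X i3 * X i4)) (X i1 * X i2 - X i3 * X i4))"
proof -
  let ?s = "X i1 + X i2" and ?s' = "X i3 + X i4" and ?p = "X i1 * X i2" and ?p' = "X i3 * X i4"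
  let ?u1 = "powsum_dd1 (n + 1) ?s ?s' ?p" and ?u2 = "powsum_dd2 (n + 1) ?s' ?p ?p'"
  obtain m where m: "n = Suc m" using assms(2) by (cases n) auto
  \<comment> \<open>Substitutions that witness nonvanishing: variables with index in
    \<open>A\<close> go to x = \<open>X i1\<close>, all others to 0. They turn \<open>?u1\<close>
    into x^n, \<open>?u2\<close> into - (n + 1) x^(n-1), the linear divisor into x and the quadratic
    one into x^2.\<close>
  let ?\<sigma> = "\<lambda>A i. if i \<in> A then X i1 else 0"
  have "subst (?\<sigma> {i1}) ?u1 \<noteq> 0" "subst (?\<sigma> {i3}) ?u2 \<noteq> 0" "subst (?\<sigma> {i1}) (?s - ?s') \<noteq> 0" "subst (?\<sigma> {i1, i2}) (?p - ?p') \<noteq> 0"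
    using assms(1) powsum_dd1_left[of n "X i1"] powsum_dd2_left[of m "X i1"]
    by (auto simp: subst_ring_simps subst_powsum_dd1 subst_powsum_dd2 m simp del: powsum_dd1.simps powsum_dd2.simps of_nat_Suc of_nat_add)
  then have ne: "?u1 \<noteq> 0" "?u2 \<noteq> 0" "?s - ?s' \<noteq> 0" "?p - ?p' \<noteq> 0"
    by (metis subst_zero)+
  have "exact_quot (g_at n ?s ?p - g_at n ?s' ?p) (?s - ?s') = ?u1"
    by (rule exact_quot_eqI[OF ne(3)]) (simp only: powsum_dd1 g_at_eq)
  moreover have "exact_quot (g_at n ?s' ?p - g_at n ?s' ?p') (?p - ?p') = ?u2"
    by (rule exact_quot_eqI[OF ne(4)]) (simp only: powsum_dd2 g_at_eq)
  moreover have "poly_deg ?u1 = 2 * int (n + 1) - 2"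
    using ne by (intro poly_deg_homogeneous homogeneous_powsum_dd1 homogeneous_mult'[of _ 2 _ 2]) auto
  moreover have "poly_deg ?u2 = 2 * int (n + 1) - 4"
    using ne by (intro poly_deg_homogeneous homogeneous_powsum_dd2 homogeneous_mult'[of _ 2 _ 2]) auto
  ultimately show ?thesis
    by (simp add: wide_edge_def Let_def koszul_eq_rank1_fact del: powsum_dd1.simps powsum_dd2.simps)
qed

section \<open>Leading coefficients in the internal mark\<close>

lemma coeff_linear_mult: "coeff ([:a, b:] * Q) i = a * coeff Q i + b * (case i of 0 \<Rightarrow> 0 | Suc j \<Rightarrow> coeff Q j)"
  by (cases i) (simp_all add: mult_pCons_left)

lemma coeff_two: "coeff 2 i = (if i = 0 then 2 else 0)"
  by (simp only: numeral_poly coeff_pCons) (simp split: nat.split)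

text \<open>For s = a + T and p = b + c T the term with s dominates the recursion: p is also linear
  in T, but it multiplies a power sum two steps lower. The leading coefficient is 1, except for the
  constant 2 at \<open>k = 0\<close>.\<close>

lemma coeff_powsum_linear:
  "(i > k \<longrightarrow> coeff (powsum k [:a, 1:] [:b, c:]) i = 0) \<and>
   coeff (powsum k [:a, 1:] [:b, c:]) k = (if k = 0 then 2 else 1)"
proof (induction k "[:a, 1:]" "[:b, c:]" arbitrary: i rule: powsum.induct)
  case 1
  show ?case by (simp add: coeff_two)
next
  case 2
  show ?case by (auto simp: coeff_pCons split: nat.split)
next
  case (3 k)
  have "coeff (powsum (Suc k) [:a, 1:] [:b, c:]) (Suc (Suc k)) = 0" using 3(1)[of "Suc (Suc k)"] by simp
  moreover have "coeff (powsum k [:a, 1:] [:b, c:]) (Suc (Suc k)) = 0" "coeff (powsum k [:a, 1:] [:b, c:]) (Suc k) = 0"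
    using 3(2) by auto
  moreover have "coeff (powsum (Suc k) [:a, 1:] [:b, c:]) (Suc k) = 1" using 3(1) by simp
  moreover have "coeff (powsum (Suc k) [:a, 1:] [:b, c:]) j = 0" if "j > Suc k" for j using 3(1)[of j] that by simp
  moreover have "coeff (powsum k [:a, 1:] [:b, c:]) j = 0" if "j > k" for j using 3(2)[of j] that by simp
  ultimately show ?case
    by (auto simp: coeff_linear_mult simp del: mult_pCons_left split: nat.split)
qed

text \<open>In the step to \<open>Suc (Suc k)\<close> the leading coefficient receives - (k + 1)
  from the term with s and - 1 from the power sum; for \<open>k = 0\<close> it is - 2, coming from
  \<open>powsum 0\<close> alone.\<close>

lemma coeff_powsum_dd2_linear:
  "(i + 2 > k \<longrightarrow> coeff (powsum_dd2 k [:a, 1:] [:b, c:] [:b', c':]) i = 0) \<and>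
   (k \<ge> 2 \<longrightarrow> coeff (powsum_dd2 k [:a, 1:] [:b, c:] [:b', c':]) (k - 2) = - of_nat k)"
proof (induction k "[:a, 1:]" "[:b, c:]" "[:b', c':]" arbitrary: i rule: powsum_dd2.induct)
  case (3 k)
  let ?D = "\<lambda>k. powsum_dd2 k [:a, 1:] [:b, c:] [:b', c':]" and ?P = "powsum k [:a, 1:] [:b', c':]"
  have 1: "coeff (?D (Suc k)) j = 0" if "j + 2 > Suc k" for j using 3(1)[of j] that by blast
  have 2: "coeff (?D k) j = 0" if "j + 2 > k" for j using 3(2)[of j] that by blast
  have 4: "coeff ?P j = 0" if "j > k" for j using coeff_powsum_linear[of k j] that by blast
  have 5: "coeff ?P k = (if k = 0 then 2 else 1)" using coeff_powsum_linear[of k k] by blast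
  have 6: "coeff (?D (Suc k)) (k - 1) = - of_nat (Suc k)" if "k > 0" using 3(1)[of k] that by auto
  show ?case
  proof
    show "i + 2 > Suc (Suc k) \<longrightarrow> coeff (?D (Suc (Suc k))) i = 0"
      using 1 2 4 by (auto simp: coeff_linear_mult simp del: mult_pCons_left split: nat.split)
    show "Suc (Suc k) \<ge> 2 \<longrightarrow> coeff (?D (Suc (Suc k))) (Suc (Suc k) - 2) = - of_nat (Suc (Suc k))"
      using 1[of k] 2[of k] 2[of "k - 1"] 5 6
      by (cases k) (auto simp: coeff_linear_mult simp del: mult_pCons_left)
  qed
qed simp_all

lemma poly_powsum: "poly (powsum k s p) y = powsum k (poly s y) (poly p y)"
  by (induction k s p rule: powsum.induct) simp_all
lemma poly_powsum_dd2: "poly (powsum_dd2 k s p p') y = powsum_dd2 k (poly s y) (poly p y) (poly p' y)"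
  by (induction k s p p' rule: powsum_dd2.induct) (simp_all add: poly_powsum)

lemma polys_over_powsum: "s \<in> polys_over V \<Longrightarrow> p \<in> polys_over V \<Longrightarrow> powsum k s p \<in> polys_over V"
proof (induction k s p rule: powsum.induct)
  case 1
  show ?case by (simp add: polys_over_def coeff_two)
qed auto
lemma polys_over_powsum_dd2:
  "s \<in> polys_over V \<Longrightarrow> p \<in> polys_over V \<Longrightarrow> p' \<in> polys_over V \<Longrightarrow> powsum_dd2 k s p p' \<in> polys_over V"
  by (induction k s p p' rule: powsum_dd2.induct) (auto intro: polys_over_powsum)

section \<open>Elimination of the first internal mark\<close>

text \<open>The differential as an operator on coefficient functions. It collects what flows into
  \<open>b\<close>, so that coefficients in an iterated tensor product of rows are computed by
  \<open>dop_tensor\<close> and \<open>dop_rank1_fact\<close>.\<close>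

definition dop :: "'b::finite bfact \<Rightarrow> ('b \<Rightarrow> qpoly) \<Rightarrow> 'b \<Rightarrow> qpoly" where
  "dop M f b = (\<Sum>b'\<in>UNIV. f b' * Poly_Mapping.lookup (bdiff M b') b)"

lemma lookup_bdiff: "Poly_Mapping.lookup (lin (bdiff M) x) b = dop M (Poly_Mapping.lookup x) b"
  unfolding lookup_lin dop_def by (rule sum.mono_neutral_left) (auto simp: in_keys_iff)

lemma dop_grade_shift [simp]: "dop (grade_shift m M) = dop M"
  by (simp add: dop_def grade_shift_def fun_eq_iff)

lemma UNIV_bit_eq: "(UNIV :: bit set) = {0, 1}" by auto

lemma dop_rank1_fact: "dop (rank1_fact V d a b) f i = f (i + 1) * (if i = 0 then b else a)"
  using bit_cases[of i] by (auto simp: dop_def rank1_fact_def UNIV_bit_eq lookup_single when_def)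

lemma sum_UNIV_Times: "sum f (UNIV :: ('a::finite \<times> 'b::finite) set) = (\<Sum>a\<in>UNIV. \<Sum>b\<in>UNIV. f (a, b))"
  by (simp add: sum.cartesian_product flip: UNIV_Times_UNIV)

lemma dop_tensor:
  "dop (M \<otimes>\<^sub>f N) f (b, c) = dop M (\<lambda>b'. f (b', c)) b + (if par M b = 0 then 1 else - 1) * dop N (\<lambda>c'. f (b, c')) c"
proof -
  let ?s = "\<lambda>b'. if par M b' = 0 then 1 else - 1 :: qpoly"
  have "dop (M \<otimes>\<^sub>f N) f (b, c) =
      (\<Sum>b'\<in>UNIV. \<Sum>c'\<in>UNIV. f (b', c') * (Poly_Mapping.lookup (bdiff M b') b * (if c' = c then 1 else 0) +
        ?s b' * ((if b' = b then 1 else 0) * Poly_Mapping.lookup (bdiff N c') c)))"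
    unfolding dop_def sum_UNIV_Times
    by (intro sum.cong refl) (auto simp: tensor_def lookup_add lookup_single when_def)
  also have "\<dots> = (\<Sum>b'\<in>UNIV. \<Sum>c'\<in>UNIV. (if c' = c then f (b', c) * Poly_Mapping.lookup (bdiff M b') b else 0) +
        (if b' = b then ?s b * (f (b, c') * Poly_Mapping.lookup (bdiff N c') c) else 0))"
    by (intro sum.cong refl) (auto simp: algebra_simps)
  also have "\<dots> = (\<Sum>b'\<in>UNIV. \<Sum>c'\<in>UNIV. if c' = c then f (b', c) * Poly_Mapping.lookup (bdiff M b') b else 0) +
      (\<Sum>c'\<in>UNIV. \<Sum>b'\<in>UNIV. if b' = b then ?s b * (f (b, c') * Poly_Mapping.lookup (bdiff N c') c) else 0)"
    by (simp only: sum.distrib) (intro arg_cong2[where f = "(+)"] refl sum.swap)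
  also have "\<dots> = dop M (\<lambda>b'. f (b', c)) b + ?s b * dop N (\<lambda>c'. f (b, c')) c"
    by (simp add: dop_def sum_distrib_left sum.delta)
  finally show ?thesis .
qed

lemma par_simps [simp]:
  "par (rank1_fact V d a b) i = i" "par (M \<otimes>\<^sub>f N) (b', c) = par M b' + par N c"
  "par (grade_shift m M) = par M" "par (parity_shift M) x = par M x + 1"
  "par (M \<oplus>\<^sub>f N) (Inl b') = par M b'" "par (M \<oplus>\<^sub>f N) (Inr c) = par N c"
  "par (dsum_family I F) (j, x) = par (F j) x"
  by (simp_all add: rank1_fact_def tensor_def grade_shift_def parity_shift_def dsum_def dsum_family_def)

lemma bdeg_simps [simp]:
  "bdeg (rank1_fact V d a b) i = (if i = 0 then 0 else d)" "bdeg (M \<otimes>\<^sub>f N) (b', c) = bdeg M b' + bdeg N c"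
  "bdeg (grade_shift m M) x = bdeg M x + m" "bdeg (parity_shift M) = bdeg M"
  "bdeg (M \<oplus>\<^sub>f N) (Inl b') = bdeg M b'" "bdeg (M \<oplus>\<^sub>f N) (Inr c) = bdeg N c"
  "bdeg (dsum_family I F) (j, x) = bdeg (F j) x"
  by (simp_all add: rank1_fact_def tensor_def grade_shift_def parity_shift_def dsum_def dsum_family_def)

lemma basis_simps [simp]:
  "basis (rank1_fact V d a b) = UNIV" "basis (M \<otimes>\<^sub>f N) = basis M \<times> basis N"
  "basis (grade_shift m M) = basis M" "basis (parity_shift M) = basis M"
  "basis (M \<oplus>\<^sub>f N) = basis M <+> basis N" "basis (dsum_family I F) = (SIGMA i:I. basis (F i))"
  by (simp_all add: rank1_fact_def tensor_def grade_shift_def parity_shift_def dsum_def dsum_family_def)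

lemma bvars_simps [simp]:
  "bvars (rank1_fact V d a b) = V" "bvars (M \<otimes>\<^sub>f N) = bvars M \<union> bvars N"
  "bvars (grade_shift m M) = bvars M" "bvars (parity_shift M) = bvars M"
  "bvars (M \<oplus>\<^sub>f N) = bvars M \<union> bvars N" "bvars (dsum_family I F) = (\<Union>i\<in>I. bvars (F i))"
  by (simp_all add: rank1_fact_def tensor_def grade_shift_def parity_shift_def dsum_def dsum_family_def)

text \<open>The two divided differences telescope through the power sum at (z + t, x y).\<close>

lemma wide_edge_potential:
  "powsum_dd1 k (x + y) (z + t) (x * y) * (x + y - (z + t)) + powsum_dd2 k (z + t) (x * y) (z * t) * (x * y - z * t) =
    x ^ k + y ^ k - z ^ k - t ^ k"
proof -
  have "powsum_dd1 k (x + y) (z + t) (x * y) * (x + y - (z + t)) + powsum_dd2 k (z + t) (x * y) (z * t) * (x * y - z * t) =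
      (x + y - (z + t)) * powsum_dd1 k (x + y) (z + t) (x * y) + (x * y - z * t) * powsum_dd2 k (z + t) (x * y) (z * t)"
    by (simp only: mult.commute)
  also have "\<dots> = x ^ k + y ^ k - z ^ k - t ^ k"
    unfolding powsum_dd1 powsum_dd2 powsum_eq by simp
  finally show ?thesis .
qed

text \<open>The bound excludes \<open>n = 1\<close>: there the entry \<open>a4\<close> is the
  constant - 2, which makes the square contractible, whereas the factorization of Gamma_2 has
  nonzero cohomology.\<close>

locale square =
  fixes n :: nat
  assumes n: "n \<ge> 2"
begin

abbreviation V4 :: "nat set" where "V4 \<equiv> {1, 2, 3, 4}"
abbreviation V5 :: "nat set" where "V5 \<equiv> {1, 2, 3, 4, 5}"
abbreviation V6 :: "nat set" where "V6 \<equiv> {1, 2, 3, 4, 5, 6}"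

definition w :: qpoly where
  "w = X 1 ^ (n + 1) - X 2 ^ (n + 1) + X 3 ^ (n + 1) - X 4 ^ (n + 1)"

text \<open>The entries of the four rows of the square, with \<open>\<xi>\<close> in place of \<open>x\<^sub>6\<close>.\<close>

definition "a1 = powsum_dd1 (n + 1) (X 1 + X 5) (X 6 + X 4) (X 1 * X 5)"
definition "b1 = X 1 + X 5 - (X 6 + X 4)"
definition "a2 \<xi> = powsum_dd2 (n + 1) (\<xi> + X 4) (X 1 * X 5) (\<xi> * X 4)"
definition "b2 \<xi> = X 1 * X 5 - \<xi> * X 4"
definition "a3 \<xi> = powsum_dd1 (n + 1) (X 3 + \<xi>) (X 5 + X 2) (X 3 * \<xi>)"
definition "b3 \<xi> = X 3 + \<xi> - (X 5 + X 2)"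
definition "a4 \<xi> = powsum_dd2 (n + 1) (X 5 + X 2) (X 3 * \<xi>) (X 5 * X 2)"
definition "b4 \<xi> = X 3 * \<xi> - X 5 * X 2"

definition x6 :: qpoly where "x6 = X 1 + X 5 - X 4"

lemma C_square_eq:
  "C_square n =
    grade_shift (- 1) (rank1_fact {1, 5, 6, 4} (1 - int n) a1 b1 \<otimes>\<^sub>f rank1_fact {1, 5, 6, 4} (3 - int n) (a2 (X 6)) (b2 (X 6))) \<otimes>\<^sub>f
    grade_shift (- 1) (rank1_fact {3, 6, 5, 2} (1 - int n) (a3 (X 6)) (b3 (X 6)) \<otimes>\<^sub>f rank1_fact {3, 6, 5, 2} (3 - int n) (a4 (X 6)) (b4 (X 6)))"
  using n by (simp add: C_square_def wide_edge_eq a1_def b1_def a2_def b2_def a3_def b3_def a4_def b4_def)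

text \<open>Of the first row only the even generator, of degree 0, remains; the shift by - 2
  collects the shifts of the two wide edges.\<close>

definition C_reduced :: "(bit \<times> bit \<times> bit) bfact" where
  "C_reduced = grade_shift (- 2) (rank1_fact V5 (3 - int n) (a2 x6) (b2 x6) \<otimes>\<^sub>f
    (rank1_fact V5 (1 - int n) (a3 x6) (b3 x6) \<otimes>\<^sub>f rank1_fact V5 (3 - int n) (a4 x6) (b4 x6)))"

lemma pring_entries:
  "\<lbrakk>\<xi> \<in> pring U; 1 \<in> U; 4 \<in> U; 5 \<in> U\<rbrakk> \<Longrightarrow> a2 \<xi> \<in> pring U" "\<lbrakk>\<xi> \<in> pring U; 1 \<in> U; 4 \<in> U; 5 \<in> U\<rbrakk> \<Longrightarrow> b2 \<xi> \<in> pring U"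
  "\<lbrakk>\<xi> \<in> pring U; 2 \<in> U; 3 \<in> U; 5 \<in> U\<rbrakk> \<Longrightarrow> a3 \<xi> \<in> pring U" "\<lbrakk>\<xi> \<in> pring U; 2 \<in> U; 3 \<in> U; 5 \<in> U\<rbrakk> \<Longrightarrow> b3 \<xi> \<in> pring U"
  "\<lbrakk>\<xi> \<in> pring U; 2 \<in> U; 3 \<in> U; 5 \<in> U\<rbrakk> \<Longrightarrow> a4 \<xi> \<in> pring U" "\<lbrakk>\<xi> \<in> pring U; 2 \<in> U; 3 \<in> U; 5 \<in> U\<rbrakk> \<Longrightarrow> b4 \<xi> \<in> pring U"
  unfolding a2_def b2_def a3_def b3_def a4_def b4_def
  by (intro pring_powsum_dd1 pring_powsum_dd2 pring_add pring_diff pring_mult pring_X; assumption)+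

lemma homogeneous_XX: "homogeneous x 2 \<Longrightarrow> homogeneous y 2 \<Longrightarrow> homogeneous (x * y) 4"
  by (rule homogeneous_mult'[of _ 2 _ 2]) auto

lemma homogeneous_entries:
  assumes "homogeneous \<xi> 2"
  shows "homogeneous (a2 \<xi>) (2 * int n - 2)" "homogeneous (b2 \<xi>) 4"
    "homogeneous (a3 \<xi>) (2 * int n)" "homogeneous (b3 \<xi>) 2"
    "homogeneous (a4 \<xi>) (2 * int n - 2)" "homogeneous (b4 \<xi>) 4"
  unfolding a2_def b2_def a3_def b3_def a4_def b4_def
  using homogeneous_powsum_dd1[of "X 3 + \<xi>" "X 5 + X 2" "X 3 * \<xi>" "n + 1"]
    homogeneous_powsum_dd2[of "\<xi> + X 4" "X 1 * X 5" "\<xi> * X 4" "n + 1"]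
    homogeneous_powsum_dd2[of "X 5 + X 2" "X 3 * \<xi>" "X 5 * X 2" "n + 1"] assms
  by (auto intro: homogeneous_XX)

lemma x6_mem: "x6 \<in> pring V5" "homogeneous x6 2"
  by (auto simp: x6_def)

lemma bfact_ok_square: "bfact_ok n w (C_square n)"
proof -
  have m: "a1 \<in> pring {1, 5, 6, 4}" "b1 \<in> pring {1, 5, 6, 4}"
    unfolding a1_def b1_def by (intro pring_powsum_dd1 pring_add pring_diff pring_mult pring_X; simp)+
  have h: "homogeneous a1 (2 * int n)" "homogeneous b1 2"
    using homogeneous_powsum_dd1[of "X 1 + X 5" "X 6 + X 4" "X 1 * X 5" "n + 1"]
    by (auto simp: a1_def b1_def intro: homogeneous_XX)
  have X6: "X 6 \<in> pring U" if "6 \<in> U" for U using that by auto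
  have "w = (a1 * b1 + a2 (X 6) * b2 (X 6)) + (a3 (X 6) * b3 (X 6) + a4 (X 6) * b4 (X 6))"
    unfolding a1_def b1_def a2_def b2_def a3_def b3_def a4_def b4_def wide_edge_potential w_def by simp
  moreover have "bfact_ok n (a1 * b1) (rank1_fact {1, 5, 6, 4} (1 - int n) a1 b1)"
    using m h by (intro bfact_ok_rank1_fact) simp_all
  moreover have "bfact_ok n (a2 (X 6) * b2 (X 6)) (rank1_fact {1, 5, 6, 4} (3 - int n) (a2 (X 6)) (b2 (X 6)))"
    using homogeneous_entries[OF homogeneous_X[of 6]] by (intro bfact_ok_rank1_fact pring_entries X6) simp_all
  moreover have "bfact_ok n (a3 (X 6) * b3 (X 6)) (rank1_fact {3, 6, 5, 2} (1 - int n) (a3 (X 6)) (b3 (X 6)))"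
    using homogeneous_entries[OF homogeneous_X[of 6]] by (intro bfact_ok_rank1_fact pring_entries X6) simp_all
  moreover have "bfact_ok n (a4 (X 6) * b4 (X 6)) (rank1_fact {3, 6, 5, 2} (3 - int n) (a4 (X 6)) (b4 (X 6)))"
    using homogeneous_entries[OF homogeneous_X[of 6]] by (intro bfact_ok_rank1_fact pring_entries X6) simp_all
  ultimately show ?thesis
    unfolding C_square_eq by (auto intro: bfact_ok_tensor bfact_ok_grade_shift)
qed

lemma bfact_ok_reduced: "bfact_ok n w C_reduced"
proof -
  \<comment> \<open>Since x_6 + x_4 = x_1 + x_5 now holds, the first divided difference drops out of
    the potential of the first wide edge, and the row of \<open>a2\<close> and \<open>b2\<close>
    carries all of it.\<close>
  have s: "x6 + X 4 = X 1 + X 5" by (simp add: x6_def)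
  have "a2 x6 * b2 x6 = (X 1 * X 5 - x6 * X 4) * powsum_dd2 (n + 1) (X 1 + X 5) (X 1 * X 5) (x6 * X 4)"
    by (simp only: a2_def b2_def s mult.commute)
  also have "\<dots> = powsum (n + 1) (X 1 + X 5) (X 1 * X 5) - powsum (n + 1) (x6 + X 4) (x6 * X 4)"
    by (simp only: powsum_dd2 s)
  finally have "a2 x6 * b2 x6 = X 1 ^ (n + 1) + X 5 ^ (n + 1) - (x6 ^ (n + 1) + X 4 ^ (n + 1))"
    by (simp only: powsum_eq)
  then have "w = a2 x6 * b2 x6 + (a3 x6 * b3 x6 + a4 x6 * b4 x6)"
    unfolding a3_def b3_def a4_def b4_def wide_edge_potential w_def by simp
  moreover note homogeneous_entries[OF x6_mem(2)]
  then have "bfact_ok n (a2 x6 * b2 x6) (rank1_fact V5 (3 - int n) (a2 x6) (b2 x6))"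
    "bfact_ok n (a3 x6 * b3 x6) (rank1_fact V5 (1 - int n) (a3 x6) (b3 x6))"
    "bfact_ok n (a4 x6 * b4 x6) (rank1_fact V5 (3 - int n) (a4 x6) (b4 x6))"
    by (intro bfact_ok_rank1_fact pring_entries x6_mem; simp)+
  ultimately show ?thesis
    unfolding C_reduced_def by (auto intro: bfact_ok_tensor bfact_ok_grade_shift)
qed

text \<open>The remainder is obtained by replacing x_6 with \<open>x6\<close>, since b1 = - (X 6 -
  x6). A multiple of \<open>b1\<close> that is free of x_6 is both fixed and killed by this
  substitution.\<close>

lemma division_linear:
  "division (pring V4) (pring V6) (pring V5) b1 2 V6"
proof
  have b1: "b1 = - (X 6 - x6)" by (simp add: b1_def x6_def)
  have x6_V6: "x6 \<in> pring V6" using x6_mem(1) by (rule pring_mono) auto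
  have V54: "r \<in> pring V5" if "r \<in> pring V4" for r using that by (rule pring_mono) auto
  show "pring V4 \<subseteq> pring V6" using pring_mono by blast
  have "subst (\<lambda>i. if i = 1 then X 1 else 0) b1 \<noteq> 0" by (simp add: b1_def subst_ring_simps)
  then show "b1 \<noteq> 0" by auto
  show "b1 \<in> pring V6" unfolding b1_def by (intro pring_add pring_diff pring_X) auto
  show "homogeneous b1 2" unfolding b1_def by auto
  show "\<exists>q\<in>pring V6. s - b1 * q \<in> pring V5" if s: "s \<in> pring V6" for s
  proof -
    obtain q where q: "q \<in> pring V6" "s - subst1 6 x6 s = (X 6 - x6) * q"
      using linear_division[OF s x6_V6] by blast
    have "s - b1 * (- q) = subst1 6 x6 s" using q(2) by (simp add: b1 algebra_simps)
    also have "\<dots> \<in> pring V5" using s x6_mem(1) by (intro pring_subst[of s V6]) auto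
    finally show ?thesis using q(1) by blast
  qed
  show "q = 0" if "q \<in> pring V6" "b1 * q \<in> pring V5" for q
  proof -
    have x6: "subst1 6 x6 x6 = x6" using x6_mem(1) by (rule subst_ident) auto
    have "subst1 6 x6 (b1 * q) = b1 * q" using that(2) by (rule subst_ident) auto
    moreover have "subst1 6 x6 (b1 * q) = 0" by (simp add: b1 subst_ring_simps x6)
    ultimately show ?thesis using \<open>b1 \<noteq> 0\<close> by simp
  qed
  show "c * r \<in> pring V5" if "c \<in> pring V4" "r \<in> pring V5" for c r using that V54 by blast
  show "- 1 \<in> pring V4" by auto
qed auto

definition flip1 :: "(bit \<times> bit) \<times> (bit \<times> bit) \<Rightarrow> (bit \<times> bit) \<times> (bit \<times> bit)" where
  "flip1 b = ((fst (fst b) + 1, snd (fst b)), snd b)"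

definition incl :: "bit \<times> bit \<times> bit \<Rightarrow> (bit \<times> bit) \<times> (bit \<times> bit)" where
  "incl b = ((0, fst b), snd b)"

lemma lookup_inject_incl:
  "Poly_Mapping.lookup (inject incl y) ((p, q), c) = (if p = 0 then Poly_Mapping.lookup y (q, c) else 0)"
proof -
  have "Poly_Mapping.lookup (inject incl y) ((p, q), c) =
      (\<Sum>b\<in>Poly_Mapping.keys y. if b = (q, c) then (if p = 0 then Poly_Mapping.lookup y (q, c) else 0) else 0)"
    unfolding inject_def lookup_sum
    by (intro sum.cong refl) (auto simp: lookup_single when_def incl_def split_paired_all)
  then show ?thesis by (auto simp: sum.delta in_keys_iff)
qed

text \<open>\<open>Q\<close> consists of the generators that are even in the first row. They are
  entered from the odd ones by \<open>b1\<close>, with sign + because this row is the leftmost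
  tensor factor. Replacing x_6 changes the entries of the other rows by multiples of
  \<open>b1\<close>, which only matter inside the contractible part.\<close>

lemma hequiv_square_reduced: "hequiv n V4 (C_square n) C_reduced"
proof (rule hequiv_elimination[where Q = "{b. fst (fst b) = 0}" and \<tau> = flip1 and \<epsilon> = "\<lambda>_. 1"
      and S = "pring V6" and Rem = "pring V5" and \<beta> = b1 and e = 2 and w = w and \<Psi> = "inject incl"
      and K = "{x. \<forall>b\<in>{b. fst (fst b) = 0}. \<exists>s\<in>pring V6. Poly_Mapping.lookup x b = b1 * s}"])
  have bv: "bvars (C_square n) = V6" unfolding C_square_eq by auto
  have bv': "bvars C_reduced = V5" unfolding C_reduced_def by auto
  show "division (pring V4) (pring V6) (pring V5) b1 2 (bvars (C_square n))"
    unfolding bv by (rule division_linear)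
  show "bfact_ok n w (C_square n)" "bfact_ok n w C_reduced" by (rule bfact_ok_square bfact_ok_reduced)+
  show "basis (C_square n) = UNIV" unfolding C_square_eq by simp
  show "V4 \<subseteq> bvars (C_square n)" "V4 \<subseteq> bvars C_reduced" unfolding bv bv' by auto
  show "w \<in> pring V4" unfolding w_def by (intro pring_add pring_diff pring_power pring_X) auto
  show "flip1 (flip1 b) = b" for b by (simp add: flip1_def)
  show "(flip1 b \<in> {b. fst (fst b) = 0}) = (b \<notin> {b. fst (fst b) = 0})" for b
    using bit_cases[of "fst (fst b)"] by (auto simp: flip1_def)
  show "par (C_square n) (flip1 b) = par (C_square n) b + 1" for b
    unfolding C_square_eq by (cases b) (auto simp: flip1_def ac_simps)
  show "bdeg (C_square n) b + 2 = bdeg (C_square n) (flip1 b) + int n + 1"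
    if "b \<in> {b. fst (fst b) = 0}" for b
    using that unfolding C_square_eq by (cases b) (auto simp: flip1_def)
  show "(1::qpoly) = 1 \<or> (1::qpoly) = - 1" by simp
  show "Poly_Mapping.lookup (lin (bdiff (C_square n)) u) b = 1 * b1 * Poly_Mapping.lookup u (flip1 b)"
    if uQ: "\<And>b. b \<in> {b. fst (fst b) = 0} \<Longrightarrow> Poly_Mapping.lookup u b = 0" and bQ: "b \<in> {b. fst (fst b) = 0}" for u b
  proof -
    obtain q r s where b: "b = ((0, q), (r, s))" using bQ by (cases b) auto
    have "Poly_Mapping.lookup u ((0, q'), c) = 0" for q' c using uQ[of "((0, q'), c)"] by simp
    then show ?thesis
      unfolding b lookup_bdiff C_square_eq by (simp add: dop_tensor dop_rank1_fact flip1_def)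
  qed
  show "blin V4 C_reduced (C_square n) i i 0 (inject incl)" for i
    unfolding blin_def
  proof (intro conjI ballI allI)
    have incl: "Poly_Mapping.single (incl b) 1 \<in> bgrade (C_square n) (par C_reduced b + 0) (bdeg C_reduced b + 0)" for b
      by (cases b, rule bgrade_single) (simp_all add: C_square_eq C_reduced_def incl_def)
    show "inject incl x \<in> bcar (C_square n) i" if "x \<in> bcar C_reduced i" for x
      using lin_bcar[OF bgrade_bcar[OF incl] _ that] bv bv' by (auto simp: inject_eq_lin)
    show "inject incl x \<in> bgrade (C_square n) i (l + 0)" if "x \<in> bgrade C_reduced i l" for x l
      using lin_bgrade[OF incl _ that] bv bv' by (auto simp: inject_eq_lin)
  qed (simp_all add: inject_eq_lin lin_add lin_scale)
  have "X 6 \<in> pring V6" by auto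
  have x6_V6: "x6 \<in> pring V6" using x6_mem(1) by (rule pring_mono) auto
  have mult: "\<exists>s\<in>pring V6. p (X 6) = p x6 + b1 * s"
    if p: "p (X 6) \<in> pring V6" "subst1 6 x6 (p (X 6)) = p x6" for p
  proof -
    obtain s where s: "s \<in> pring V6" "p (X 6) - p x6 = (X 6 - x6) * s"
      using linear_division[OF p(1) x6_V6, of 6] unfolding p(2) by blast
    then show ?thesis by (intro bexI[of _ "- s"]) (auto simp: b1_def x6_def algebra_simps)
  qed
  have sub: "subst1 6 x6 (a2 (X 6)) = a2 x6" "subst1 6 x6 (b2 (X 6)) = b2 x6" "subst1 6 x6 (a3 (X 6)) = a3 x6"
    "subst1 6 x6 (b3 (X 6)) = b3 x6" "subst1 6 x6 (a4 (X 6)) = a4 x6" "subst1 6 x6 (b4 (X 6)) = b4 x6"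
    unfolding a2_def b2_def a3_def b3_def a4_def b4_def
    by (simp_all add: subst_ring_simps subst_powsum_dd1 subst_powsum_dd2 del: powsum_dd1.simps powsum_dd2.simps)
  have mem: "a2 (X 6) \<in> pring V6" "b2 (X 6) \<in> pring V6" "a3 (X 6) \<in> pring V6" "b3 (X 6) \<in> pring V6"
    "a4 (X 6) \<in> pring V6" "b4 (X 6) \<in> pring V6"
    by (intro pring_entries pring_X; simp)+
  obtain sa2 where sa2: "sa2 \<in> pring V6" "a2 (X 6) = a2 x6 + b1 * sa2"
    using mult[OF mem(1) sub(1)] by (rule bexE)
  obtain sb2 where sb2: "sb2 \<in> pring V6" "b2 (X 6) = b2 x6 + b1 * sb2"
    using mult[OF mem(2) sub(2)] by (rule bexE)
  obtain sa3 where sa3: "sa3 \<in> pring V6" "a3 (X 6) = a3 x6 + b1 * sa3"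
    using mult[OF mem(3) sub(3)] by (rule bexE)
  obtain sb3 where sb3: "sb3 \<in> pring V6" "b3 (X 6) = b3 x6 + b1 * sb3"
    using mult[OF mem(4) sub(4)] by (rule bexE)
  obtain sa4 where sa4: "sa4 \<in> pring V6" "a4 (X 6) = a4 x6 + b1 * sa4"
    using mult[OF mem(5) sub(5)] by (rule bexE)
  obtain sb4 where sb4: "sb4 \<in> pring V6" "b4 (X 6) = b4 x6 + b1 * sb4"
    using mult[OF mem(6) sub(6)] by (rule bexE)
  note s = sa2 sb2 sa3 sb3 sa4 sb4
  show "lin (bdiff (C_square n)) (inject incl y) - inject incl (lin (bdiff C_reduced) y)
      \<in> {x. \<forall>b\<in>{b. fst (fst b) = 0}. \<exists>s\<in>pring V6. Poly_Mapping.lookup x b = b1 * s}"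
    if y: "y \<in> bcar C_reduced i" for i y
  proof (intro CollectI ballI)
    fix b assume "b \<in> {b :: (bit \<times> bit) \<times> (bit \<times> bit). fst (fst b) = 0}"
    then obtain p q r where b: "b = ((0, p), (q, r))" by (cases b) auto
    let ?y = "\<lambda>c. Poly_Mapping.lookup y c"
    have y6: "?y c \<in> pring V6" for c using bcar_lookup[OF y, of c] bv' by (intro pring_mono[of _ V5 V6]) auto
    \<comment> \<open>The quotient of the defect by \<open>b1\<close>: the quotients of the three
      remaining rows, with the signs of the tensor product.\<close>
    let ?t = "?y (p + 1, q, r) * (if p = 0 then sb2 else sa2) +
      (if p = 0 then 1 else - 1) * (?y (p, q + 1, r) * (if q = 0 then sb3 else sa3)) +
      (if p + q = 0 then 1 else - 1) * (?y (p, q, r + 1) * (if r = 0 then sb4 else sa4))"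
    have "Poly_Mapping.lookup (lin (bdiff (C_square n)) (inject incl y) - inject incl (lin (bdiff C_reduced) y)) b = b1 * ?t"
      using bit_cases[of p] bit_cases[of q] bit_cases[of r]
      by (auto simp: b lookup_minus lookup_inject_incl lookup_bdiff C_square_eq C_reduced_def dop_tensor dop_rank1_fact s(2,4,6,8,10,12) algebra_simps)
    moreover have "?t \<in> pring V6"
      using y6 s(1,3,5,7,9,11) by (intro pring_add pring_mult) auto
    ultimately show "\<exists>s\<in>pring V6. Poly_Mapping.lookup (lin (bdiff (C_square n)) (inject incl y) - inject incl (lin (bdiff C_reduced) y)) b = b1 * s"
      by blast
  qed
  show "\<exists>y\<in>bgrade C_reduced (par (C_square n) b) (k + bdeg (C_square n) b). Poly_Mapping.single b r - inject incl y
      \<in> {x. \<forall>b\<in>{b. fst (fst b) = 0}. \<exists>s\<in>pring V6. Poly_Mapping.lookup x b = b1 * s}"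
    if bQ: "b \<in> {b. fst (fst b) = 0}" and r: "r \<in> pring V5" "homogeneous r k" for k b r
  proof -
    obtain q c where b: "b = ((0, q), c)" using bQ by (cases b) auto
    have "Poly_Mapping.single (q, c) r \<in> bgrade C_reduced (par (C_square n) b) (k + bdeg (C_square n) b)"
      using r bv' by (cases c, intro bgrade_single) (auto simp: b C_reduced_def C_square_eq)
    then show ?thesis
      by (rule bexI[rotated]) (auto simp: b incl_def intro!: bexI[of _ 0])
  qed
  show "y = 0"
    if y: "y \<in> bcar C_reduced i" and *: "inject incl y \<in> {x. \<forall>b\<in>{b. fst (fst b) = 0}. \<exists>s\<in>pring V6. Poly_Mapping.lookup x b = b1 * s}"
    for i y
  proof (rule poly_mapping_eqI)
    fix c :: "bit \<times> bit \<times> bit"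
    obtain q r where c: "c = (q, r)" by (cases c)
    have "\<exists>s\<in>pring V6. Poly_Mapping.lookup (inject incl y) ((0, q), r) = b1 * s" using * by (cases r) auto
    then obtain s where s: "s \<in> pring V6" "Poly_Mapping.lookup y c = b1 * s" by (auto simp: lookup_inject_incl c)
    then have "b1 * s \<in> pring V5" using bcar_lookup[OF y, of c] bv' by auto
    then have "s = 0" using s(1) division.unique_division[OF division_linear] by blast
    then show "Poly_Mapping.lookup y c = Poly_Mapping.lookup 0 c" using s(2) by simp
  qed
qed simp
end

section \<open>Identities between the entries\<close>

lemma homogeneous_prod:
  "finite A \<Longrightarrow> (\<And>i. i \<in> A \<Longrightarrow> homogeneous (f i) (d i)) \<Longrightarrow> homogeneous (prod f A) (sum d A)"
  by (induction A rule: finite_induct) (auto intro: homogeneous_mult)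

lemma homogeneous_subst:
  assumes "homogeneous p k" "\<And>i. homogeneous (\<sigma> i) 2"
  shows "homogeneous (subst \<sigma> p) k"
  unfolding subst_def
proof (rule homogeneous_sum)
  fix m assume "m \<in> Poly_Mapping.keys p"
  then have k: "k = mono_deg m" using assms(1) by (simp add: homogeneous_def)
  have "homogeneous (\<Prod>i\<in>Poly_Mapping.keys m. \<sigma> i ^ Poly_Mapping.lookup m i)
      (\<Sum>i\<in>Poly_Mapping.keys m. int (Poly_Mapping.lookup m i) * 2)"
    using assms(2) by (intro homogeneous_prod homogeneous_power) auto
  then show "homogeneous (Const (Poly_Mapping.lookup p m) * (\<Prod>i\<in>Poly_Mapping.keys m. \<sigma> i ^ Poly_Mapping.lookup m i)) k"
    by (rule homogeneous_mult'[OF homogeneous_Const]) (simp add: k mono_deg_def sum_distrib_left mult.commute)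
qed

lemma poly_low_sum:
  fixes C :: "'a::comm_ring_1 poly"
  assumes "\<And>i. i \<ge> k \<Longrightarrow> coeff C i = 0"
  shows "poly C y = (\<Sum>i<k. coeff C i * y ^ i)"
proof -
  have "poly C y = (\<Sum>i\<le>max k (degree C). coeff C i * y ^ i)"
    unfolding poly_altdef by (intro sum.mono_neutral_left) (auto simp: coeff_eq_0)
  also have "\<dots> = (\<Sum>i<k. coeff C i * y ^ i)"
    using assms by (intro sum.mono_neutral_right) auto
  finally show ?thesis .
qed

text \<open>Used with d = \<open>delta\<close>, b = \<open>B3\<close>, p = \<open>P 3 2\<close>, a =
  \<open>A3\<close>, f = \<open>A4\<close>, e = x_3 - x_5 and x = x_5; r is the sum
  \<open>pi_sum\<close> at x_6 and x_5, and c_i stands for x_i^(n+1). From the conclusion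
  \<open>B3_cancel\<close> extracts \<open>t\<close>.\<close>

lemma quotient_identity1:
  fixes d :: "'a::comm_ring_1"
  assumes "d * p = b * p - (c3 - c2)" "a * b + f * (d * e + x * b) = c3 + c6 - c5 - c2" "d * r = c6 - c5"
  shows "d * (p - r + e * f) = b * (p - a - x * f)"
proof -
  have "d * (p - r + e * f) - b * (p - a - x * f) =
      (d * p - (b * p - (c3 - c2))) + (a * b + f * (d * e + x * b) - (c3 + c6 - c5 - c2)) - (d * r - (c6 - c5))"
    by (simp add: algebra_simps)
  then show ?thesis unfolding assms by simp
qed

text \<open>Used with d = \<open>delta\<close>, e = x_3 - x_4, b = \<open>B3\<close>, a =
  \<open>a40\<close>, t = \<open>t0\<close>, and with \<open>P 3 2\<close>, \<open>P 1 2\<close>,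
  \<open>P 1 4\<close>, \<open>P 3 4\<close> for p, q, p', q'. From the conclusion
  \<open>B3_cancel\<close> extracts \<open>v\<close>.\<close>

lemma quotient_identity2:
  fixes d :: "'a::comm_ring_1"
  assumes "b * p - d * p = c3 - c2" "b * q = c1 - c2 + e * q" "d * p' = c1 - c4" "e * q' = c3 - c4"
    "p - p' + e * a = b * t"
  shows "e * (q' - q - d * a) = b * (p - d * t - q)"
proof -
  have "e * (q' - q - d * a) - b * (p - d * t - q) =
      (e * q' - (c3 - c4)) + (b * q - (c1 - c2 + e * q)) - (b * p - d * p - (c3 - c2)) -
      (d * p' - (c1 - c4)) - d * (p - p' + e * a - b * t)"
    by (simp add: algebra_simps)
  then show ?thesis unfolding assms by simp
qed

text \<open>Subtracts the relation for \<open>t\<close> at y = 0 from the relation for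
  \<open>t\<close> itself and inserts t - t0 = y u and y z = g - f. The factor y stays on both
  sides, because in a general ring it cannot be cancelled.\<close>

lemma quotient_identity3:
  fixes a :: "'a::comm_ring_1"
  assumes "a * y = p - r" "q - r + (x3 - x5) * f = b * t" "q - p + (x3 - x4) * g = b * t0" "t - t0 = y * u"
    "y * z = g - f" "y = x5 - x4"
  shows "y * a = y * (b * u + (x3 - x4) * z + f)"
proof -
  have "y * a - y * (b * u + (x3 - x4) * z + f) =
      (a * y - (p - r)) + b * ((t - t0) - y * u) + (q - r + (x3 - x5) * f - b * t) -
      (q - p + (x3 - x4) * g - b * t0) - (x3 - x4) * (y * z - (g - f)) - (y - (x5 - x4)) * f"
    by (simp add: algebra_simps)
  then show ?thesis unfolding assms(1-5) by (simp add: assms(6))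
qed

context square
begin

abbreviation y :: qpoly where "y \<equiv> X 5 - X 4"
abbreviation delta :: qpoly where "delta \<equiv> X 1 - X 4"
abbreviation A2 :: qpoly where "A2 \<equiv> a2 x6"
abbreviation A3 :: qpoly where "A3 \<equiv> a3 x6"
abbreviation A4 :: qpoly where "A4 \<equiv> a4 x6"
abbreviation P :: "nat \<Rightarrow> nat \<Rightarrow> qpoly" where "P i j \<equiv> pi_sum n (X i) (X j)"
definition "B3 = X 1 + X 3 - X 2 - X 4"

lemma b2_x6: "b2 x6 = delta * y"
  by (simp add: b2_def x6_def algebra_simps)
lemma b3_x6: "b3 x6 = B3"
  by (simp add: b3_def x6_def B3_def algebra_simps)
lemma b4_x6: "b4 x6 = delta * (X 3 - X 5) + X 5 * B3"
  by (simp add: b4_def x6_def B3_def algebra_simps)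

text \<open>\<open>A4\<close> as a polynomial in y: by x_5 = x_4 + y and x_6 = x_1 + y, the sum x_5
  + x_2 and the products x_3 x_6 and x_5 x_2 are linear in y.\<close>

definition B :: "qpoly poly" where
  "B = powsum_dd2 (n + 1) [:X 4 + X 2, 1:] [:X 3 * X 1, X 3:] [:X 4 * X 2, X 2:]"

lemma poly_B: "poly B y = A4"
proof -
  have "poly [:X 4 + X 2, 1:] y = X 5 + X 2" "poly [:X 3 * X 1, X 3:] y = X 3 * x6" "poly [:X 4 * X 2, X 2:] y = X 5 * X 2"
    by (simp_all add: x6_def algebra_simps)
  then show ?thesis by (simp only: B_def a4_def poly_powsum_dd2)
qed

lemma coeff_B: "i \<ge> n \<Longrightarrow> coeff B i = 0" "coeff B (n - 1) = - of_nat (n + 1)"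
  using coeff_powsum_dd2_linear[of "n + 1" i "X 4 + X 2" "X 3 * X 1" "X 3" "X 4 * X 2" "X 2"] n
  by (auto simp: B_def simp del: powsum_dd2.simps of_nat_Suc of_nat_add)

lemma B_over: "B \<in> polys_over V4"
  unfolding B_def by (intro polys_over_powsum_dd2 polys_over_pCons pring_add pring_mult pring_X) auto

lemma B_lead: "degree B = n - 1" "lead_coeff B = Const (- of_nat (n + 1))" "B \<noteq> 0"
proof -
  have ne: "coeff B (n - 1) \<noteq> 0" unfolding coeff_B(2) by (simp del: of_nat_Suc of_nat_add)
  have "degree B \<le> n - 1" by (intro degree_le allI impI coeff_B(1)) auto
  with ne show deg: "degree B = n - 1" using le_degree[OF ne] by simp
  show "lead_coeff B = Const (- of_nat (n + 1))"
    unfolding deg coeff_B(2) by (simp only: Const_uminus Const_of_nat)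
  show "B \<noteq> 0" using ne by auto
qed

text \<open>\<open>a40\<close>, \<open>Z\<close> and \<open>z\<close> are made so that A4 = a40 - y
  z, with \<open>a40\<close> the value of \<open>A4\<close> at y = 0. Modulo \<open>A4\<close> the
  product y z is thus the element \<open>a40\<close> of R, the exceptional diagonal entry of
  multiplication by y.\<close>

definition a40 :: qpoly where "a40 = coeff B 0"
definition Z :: "qpoly poly" where "Z = - (poly_shift 1 B)"
definition z :: qpoly where "z = poly Z y"

lemma coeff_Z: "coeff Z i = - coeff B (Suc i)"
  by (simp add: Z_def coeff_poly_shift)

lemma Z_over: "Z \<in> polys_over V4"
  using B_over by (auto simp: polys_over_def coeff_Z)

lemma yz: "y * z = a40 - A4"
proof -
  have "B = pCons a40 (- Z)"
    by (rule poly_eqI) (auto simp: coeff_pCons coeff_Z a40_def split: nat.split)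
  then have "A4 = a40 - y * z" unfolding poly_B[symmetric] z_def by (metis poly_pCons poly_minus diff_conv_add_uminus mult_minus_right)
  then show ?thesis by simp
qed

lemma A_mem: "A2 \<in> pring V5" "A3 \<in> pring V5" "A4 \<in> pring V5" "y \<in> pring V5" "B3 \<in> pring V4" "delta \<in> pring V4"
  and A_hom: "homogeneous A2 (2 * int n - 2)" "homogeneous A3 (2 * int n)" "homogeneous A4 (2 * int n - 2)"
    "homogeneous y 2" "homogeneous B3 2" "homogeneous delta 2"
  using pring_entries[OF x6_mem(1)] homogeneous_entries[OF x6_mem(2)] unfolding B3_def
  by (auto intro!: pring_add pring_diff pring_X)

lemma a40_mem: "a40 \<in> pring V4"
  using B_over by (simp add: a40_def polys_over_def)

lemma V45: "p \<in> pring V4 \<Longrightarrow> p \<in> pring V5"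
  by (rule pring_mono) auto

lemma subst5_V4: "p \<in> pring V4 \<Longrightarrow> subst1 5 (X 4) p = p"
  by (rule subst_ident) auto

lemma subst5_A4: "subst1 5 (X 4) A4 = a40"
  using arg_cong[OF yz, of "subst1 5 (X 4)"] subst5_V4[OF a40_mem] by (simp add: subst_ring_simps)

lemma a40_hom: "homogeneous a40 (2 * int n - 2)"
  unfolding subst5_A4[symmetric] by (rule homogeneous_subst[OF A_hom(3)]) auto

lemma y_ne: "y \<noteq> 0" "delta \<noteq> 0" "B3 \<noteq> 0" "X 3 - X 4 \<noteq> 0"
  unfolding B3_def using subst_zero[of "\<lambda>i. if i = 1 then X 1 else 0"] subst_zero[of "\<lambda>i. if i = 5 then X 1 else 0"]
  by (auto simp: subst_ring_simps dest: arg_cong[where f = "subst (\<lambda>i. if i = 1 then X 1 else 0)"])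

lemma z_mem: "z \<in> pring V5" and z_hom: "homogeneous z (2 * int n - 4)"
proof -
  show "z \<in> pring V5" unfolding z_def by (rule poly_pring[OF Z_over A_mem(4)]) auto
  have "homogeneous (y * z) (2 * int n - 2)" unfolding yz using A_hom(3) a40_hom by auto
  from homogeneous_quotient[OF A_hom(4) y_ne(1) this] show "homogeneous z (2 * int n - 4)" by simp
qed

text \<open>\<^term>\<open>B3\<close> is prime and does not divide \<open>d\<close>; divisibility by \<^term>\<open>B3\<close> is tested by the substitution
  \<open>x\<^sub>2 := x\<^sub>1 + x\<^sub>3 - x\<^sub>4\<close>.\<close>

lemma B3_cancel:
  assumes f: "f \<in> pring U" and U: "{1, 3, 4} \<subseteq> U" and eq: "d * f = B3 * g"
    and d: "d \<in> pring {1, 3, 4}" "d \<noteq> 0"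
  obtains q where "q \<in> pring U" "f = B3 * q" "g = d * q"
proof -
  let ?c = "X 1 + X 3 - X 4"
  have d': "subst1 2 ?c d = d" using d(1) by (rule subst_ident) auto
  have B3': "subst1 2 ?c B3 = 0" by (simp add: B3_def subst_ring_simps)
  have "d * subst1 2 ?c f = subst1 2 ?c (d * f)" by (simp add: subst_mult d')
  also have "\<dots> = 0" unfolding eq by (simp add: subst_mult B3')
  finally have f0: "subst1 2 ?c f = 0" using d(2) by simp
  have "?c \<in> pring U" using U by (intro pring_add pring_diff pring_X) auto
  then obtain q where q: "q \<in> pring U" "f - subst1 2 ?c f = (X 2 - ?c) * q" using linear_division[OF f] by blast
  have f_eq: "f = B3 * (- q)" using q(2) unfolding f0 by (simp add: B3_def algebra_simps)
  have "B3 * g = B3 * (d * (- q))" using eq by (simp add: f_eq algebra_simps)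
  then have "g = d * (- q)" using y_ne(3) by (simp only: mult_cancel_left) auto
  with f_eq q(1) show ?thesis using that[of "- q"] by auto
qed

text \<open>Modulo \<open>A4\<close> the potential is A2 y delta + A3 B3. As x_3 - x_2 = B3 - delta,
  Gamma_1 writes it as (P_14 - P_32) delta + P_32 B3, and the two pairs of a-entries differ by (B3
  t, - delta t). As x_1 - x_2 = B3 - (x_3 - x_4), Gamma_2 writes it as (P_34 - P_12) (x_3 - x_4) +
  P_12 B3, and this comparison gives \<open>u\<close> and \<open>v\<close>. The multiples of
  \<open>A4\<close> are kept exactly: they become the quotients that place a defect in
  \<open>K\<close>.\<close>

lemma square_identities:
  obtains t u v where "t \<in> pring V5" "u \<in> pring V5" "v \<in> pring V4"
    "homogeneous t (2 * int n - 2)" "homogeneous u (2 * int n - 4)" "homogeneous v (2 * int n - 2)"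
    "A2 * y = B3 * t + P 1 4 - P 3 2 - (X 3 - X 5) * A4"
    "A3 = P 3 2 - delta * t - X 5 * A4"
    "delta * y * z + B3 * v = P 3 4 - P 1 2 - delta * A4"
    "A2 = B3 * u + (X 3 - X 4) * z + A4"
    "A3 = P 1 2 + (X 3 - X 4) * v - delta * y * u - X 5 * A4"
proof -
  let ?p65 = "pi_sum n x6 (X 5)"
  have p65: "delta * ?p65 = x6 ^ (n + 1) - X 5 ^ (n + 1)"
    unfolding pi_sum[symmetric] by (simp add: x6_def)
  have P_mem: "P i j \<in> pring U" if "i \<in> U" "j \<in> U" for i j U using that by (intro pring_pi_sum pring_X)
  have P_hom: "homogeneous (P i j) (2 * int n)" for i j by (intro homogeneous_pi_sum) auto
  \<comment> \<open>The potential of the first wide edge is divided by delta, which is both x_1 -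
    x_4 and x_6 - x_5.\<close>
  have "delta * (A2 * y) = A2 * b2 x6" unfolding b2_x6 by (simp add: algebra_simps)
  also have "\<dots> = (X 1 * X 5 - x6 * X 4) * powsum_dd2 (n + 1) (x6 + X 4) (X 1 * X 5) (x6 * X 4)"
    unfolding a2_def b2_def by (simp only: mult.commute)
  also have "\<dots> = powsum (n + 1) (X 1 + X 5) (X 1 * X 5) - powsum (n + 1) (x6 + X 4) (x6 * X 4)"
    unfolding powsum_dd2 by (simp add: x6_def del: powsum.simps)
  also have "\<dots> = delta * (P 1 4 - ?p65)"
    unfolding powsum_eq right_diff_distrib p65 unfolding pi_sum by simp
  finally have A2y: "A2 * y = P 1 4 - ?p65" using y_ne(2) by simp
  have "A3 * b3 x6 + A4 * b4 x6 = X 3 ^ (n + 1) + x6 ^ (n + 1) - X 5 ^ (n + 1) - X 2 ^ (n + 1)"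
    unfolding a3_def b3_def a4_def b4_def wide_edge_potential ..
  then have A34: "A3 * B3 + A4 * (delta * (X 3 - X 5) + X 5 * B3) = X 3 ^ (n + 1) + x6 ^ (n + 1) - X 5 ^ (n + 1) - X 2 ^ (n + 1)"
    unfolding b3_x6 b4_x6 .
  have delta_mem: "delta \<in> pring {1, 3, 4}" "X 3 - X 4 \<in> pring {1, 3, 4}" by (auto intro!: pring_diff pring_X)
  obtain t where t: "t \<in> pring V5" "P 3 2 - ?p65 + (X 3 - X 5) * A4 = B3 * t" "P 3 2 - A3 - X 5 * A4 = delta * t"
  proof (rule B3_cancel)
    show "P 3 2 - ?p65 + (X 3 - X 5) * A4 \<in> pring V5"
      using A_mem(3) x6_mem by (intro pring_add pring_diff pring_mult pring_X pring_pi_sum) auto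
    have "delta * P 3 2 = B3 * P 3 2 - (X 3 - X 2) * P 3 2" by (simp add: B3_def algebra_simps)
    then have "delta * P 3 2 = B3 * P 3 2 - (X 3 ^ (n + 1) - X 2 ^ (n + 1))" unfolding pi_sum .
    then show "delta * (P 3 2 - ?p65 + (X 3 - X 5) * A4) = B3 * (P 3 2 - A3 - X 5 * A4)"
      by (rule quotient_identity1[OF _ A34 p65])
  qed (use delta_mem y_ne in auto)
  \<comment> \<open>At x_5 = x_4 one has y = 0, x_6 = x_1 and A4 = a40, so the relation for
    \<open>t\<close> becomes one over R.\<close>
  define t0 where "t0 = subst1 5 (X 4) t"
  have t0_mem: "t0 \<in> pring V4" unfolding t0_def using t(1) by (intro pring_subst[of t V5]) auto
  have sx6: "subst1 5 (X 4) x6 = X 1" by (simp add: x6_def subst_ring_simps)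
  have sB3: "subst1 5 (X 4) B3 = B3" by (rule subst5_V4[OF A_mem(5)])
  have t0: "P 3 2 - P 1 4 + (X 3 - X 4) * a40 = B3 * t0"
    using arg_cong[OF t(2), of "subst1 5 (X 4)"]
    by (simp add: subst_ring_simps subst_pi_sum sx6 subst5_A4 sB3 t0_def)
  obtain v where v: "v \<in> pring V4" "P 3 4 - P 1 2 - delta * a40 = B3 * v" "P 3 2 - delta * t0 - P 1 2 = (X 3 - X 4) * v"
  proof (rule B3_cancel)
    show "P 3 4 - P 1 2 - delta * a40 \<in> pring V4"
      using a40_mem A_mem(6) by (intro pring_diff pring_mult P_mem) auto
    have "B3 * P 3 2 - delta * P 3 2 = X 3 ^ (n + 1) - X 2 ^ (n + 1)" unfolding pi_sum[symmetric] by (simp add: B3_def algebra_simps)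
    moreover have "B3 * P 1 2 = (X 1 - X 2) * P 1 2 + (X 3 - X 4) * P 1 2" by (simp add: B3_def algebra_simps)
    then have "B3 * P 1 2 = X 1 ^ (n + 1) - X 2 ^ (n + 1) + (X 3 - X 4) * P 1 2" unfolding pi_sum .
    moreover have "delta * P 1 4 = X 1 ^ (n + 1) - X 4 ^ (n + 1)" "(X 3 - X 4) * P 3 4 = X 3 ^ (n + 1) - X 4 ^ (n + 1)"
      by (rule pi_sum)+
    ultimately show "(X 3 - X 4) * (P 3 4 - P 1 2 - delta * a40) = B3 * (P 3 2 - delta * t0 - P 1 2)"
      by (intro quotient_identity2[OF _ _ _ _ t0])
  qed (use delta_mem y_ne in auto)
  \<comment> \<open>\<open>u\<close> is the divided difference of \<open>t\<close> in x_5; it exists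
    by the factor theorem.\<close>
  obtain u where u: "u \<in> pring V5" "t - t0 = y * u"
    using linear_division[OF t(1), of "X 4" 5] unfolding t0_def[symmetric] by auto
  have t_hom: "homogeneous t (2 * int n - 2)"
  proof -
    have "homogeneous ((X 3 - X 5) * A4) (2 * int n)"
      by (rule homogeneous_mult'[OF _ A_hom(3), of _ 2]) auto
    moreover have "homogeneous ?p65 (2 * int n)" using x6_mem by (intro homogeneous_pi_sum) auto
    ultimately have "homogeneous (B3 * t) (2 * int n)"
      unfolding t(2)[symmetric] using P_hom by (intro homogeneous_add homogeneous_diff)
    from homogeneous_quotient[OF A_hom(5) y_ne(3) this] show ?thesis .
  qed
  have u_hom: "homogeneous u (2 * int n - 4)"
  proof -
    have "homogeneous t0 (2 * int n - 2)" unfolding t0_def by (rule homogeneous_subst[OF t_hom]) auto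
    then have "homogeneous (y * u) (2 * int n - 2)" unfolding u(2)[symmetric] using t_hom by auto
    from homogeneous_quotient[OF A_hom(4) y_ne(1) this] show ?thesis by simp
  qed
  have v_hom: "homogeneous v (2 * int n - 2)"
  proof -
    have "homogeneous (delta * a40) (2 * int n)" by (rule homogeneous_mult'[OF A_hom(6) a40_hom]) simp
    then have "homogeneous (B3 * v) (2 * int n)" unfolding v(2)[symmetric] using P_hom by (intro homogeneous_diff)
    from homogeneous_quotient[OF A_hom(5) y_ne(3) this] show ?thesis .
  qed
  have yA2: "y * A2 = y * (B3 * u + (X 3 - X 4) * z + A4)"
    by (rule quotient_identity3[OF A2y t(2) t0 u(2) yz refl])
  show ?thesis
  proof (rule that[OF t(1) u(1) v(1) t_hom u_hom v_hom])
    show "A2 * y = B3 * t + P 1 4 - P 3 2 - (X 3 - X 5) * A4" unfolding A2y t(2)[symmetric] by (simp add: algebra_simps)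
    show "A3 = P 3 2 - delta * t - X 5 * A4" using t(3) by (simp add: algebra_simps)
    show "delta * y * z + B3 * v = P 3 4 - P 1 2 - delta * A4" unfolding mult.assoc yz v(2)[symmetric] by (simp add: algebra_simps)
    show "A2 = B3 * u + (X 3 - X 4) * z + A4" using yA2 y_ne(1) by simp
    show "A3 = P 1 2 + (X 3 - X 4) * v - delta * y * u - X 5 * A4" using t(3) unfolding v(3)[symmetric] mult.assoc u(2)[symmetric] by (simp add: algebra_simps)
  qed
qed

section \<open>Two R-bases of R[x_5] modulo \<open>A4\<close>\<close>

definition Rem :: "qpoly set" where
  "Rem = {r. \<exists>c. (\<forall>i. c i \<in> pring V4) \<and> r = (\<Sum>i<n - 1. c i * y ^ i)}"

text \<open>\<open>A4\<close> has degree n - 1 in y, so 1, y, ..., y^(n-2) are independent over R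
  modulo \<open>A4\<close>.\<close>

lemma low_sum_multiple:
  assumes "\<And>i. i < n - 1 \<Longrightarrow> c i \<in> pring V4" "q \<in> pring V5" "A4 * q = (\<Sum>i<n - 1. c i * y ^ i)"
  shows "q = 0" "i < n - 1 \<Longrightarrow> c i = 0"
proof -
  let ?C = "\<Sum>i<n - 1. monom (c i) i"
  have coeff: "coeff ?C i = (if i < n - 1 then c i else 0)" for i
    by (simp add: coeff_sum if_distrib[where f = "\<lambda>x. x * _"] sum.delta)
  have "?C \<in> low_polys V4 (n - 1)" unfolding low_polys_def polys_over_def mem_Collect_eq coeff using assms(1) by auto
  moreover have "poly ?C y = (\<Sum>i<n - 1. c i * y ^ i)" by (simp add: poly_sum poly_monom)
  moreover have "insert 5 V4 = V5" by auto
  ultimately have "?C = 0 \<and> q = 0"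
    using low_poly_multiple_eq_0[OF B_over B_lead(1,3), of 5 "X 4" q ?C] assms(2,3) poly_B by auto
  then show "q = 0" "i < n - 1 \<Longrightarrow> c i = 0" using coeff[of i] by auto
qed

lemma division_A4: "division (pring V4) (pring V5) Rem A4 (2 * int n - 2) V5"
proof
  show "pring V4 \<subseteq> pring V5" using V45 by blast
  show "A4 \<noteq> 0"
  proof
    assume "A4 = 0"
    \<comment> \<open>With all coefficients zero, uniqueness of the quotient would force 1 =
      0.\<close>
    then have "A4 * 1 = (\<Sum>i<n - 1. 0 * y ^ i)" by simp
    from low_sum_multiple(1)[OF _ _ this] show False by auto
  qed
  show "A4 \<in> pring V5" "homogeneous A4 (2 * int n - 2)" by (rule A_mem A_hom)+
  show "\<exists>q\<in>pring V5. s - A4 * q \<in> Rem" if s: "s \<in> pring V5" for s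
  proof -
    have V5: "V5 = insert 5 V4" by auto
    obtain S where S: "S \<in> polys_over V4" "s = poly S y"
      using pring_insert_eq_poly[of s 5 V4 "X 4"] s unfolding V5 by auto
    obtain Q C where Q: "Q \<in> polys_over V4" and C: "C \<in> low_polys V4 (n - 1)" and eq: "S = B * Q + C"
      using poly_division_unit_lead[OF B_over B_lead(1,2) _ S(1)] by (auto simp del: of_nat_Suc of_nat_add)
    have "s - A4 * poly Q y = poly C y" by (simp add: S eq poly_B)
    also have "\<dots> = (\<Sum>i<n - 1. coeff C i * y ^ i)" using C by (intro poly_low_sum) (auto simp: low_polys_def)
    finally have "s - A4 * poly Q y \<in> Rem" using C by (auto simp: Rem_def low_polys_def polys_over_def)
    moreover have "poly Q y \<in> pring V5" by (rule poly_pring[OF Q A_mem(4)]) auto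
    ultimately show ?thesis by blast
  qed
  show "q = 0" if "q \<in> pring V5" "A4 * q \<in> Rem" for q
    using that low_sum_multiple(1)[of _ q] by (auto simp: Rem_def)
  show "r + r' \<in> Rem" if rr: "r \<in> Rem" "r' \<in> Rem" for r r'
  proof -
    obtain c c' where "\<forall>i. c i \<in> pring V4" "r = (\<Sum>i<n - 1. c i * y ^ i)" "\<forall>i. c' i \<in> pring V4" "r' = (\<Sum>i<n - 1. c' i * y ^ i)"
      using rr by (auto simp: Rem_def)
    then show ?thesis unfolding Rem_def by (intro CollectI exI[of _ "\<lambda>i. c i + c' i"]) (auto simp: distrib_right sum.distrib)
  qed
  show "a * r \<in> Rem" if ar: "a \<in> pring V4" "r \<in> Rem" for a r
  proof -
    obtain c where "\<forall>i. c i \<in> pring V4" "r = (\<Sum>i<n - 1. c i * y ^ i)" using ar by (auto simp: Rem_def)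
    then show ?thesis using ar(1) unfolding Rem_def
      by (intro CollectI exI[of _ "\<lambda>i. a * c i"]) (auto simp: sum_distrib_left mult.assoc)
  qed
  show "hcomp d r \<in> Rem" if r: "r \<in> Rem" for d r
  proof -
    obtain c where c: "\<forall>i. c i \<in> pring V4" "r = (\<Sum>i<n - 1. c i * y ^ i)" using r by (auto simp: Rem_def)
    have "hcomp d (c i * y ^ i) = hcomp (d - int i * 2) (c i) * y ^ i" for i
      using hcomp_mult_left[OF homogeneous_power[OF A_hom(4)], of d i "c i"] by (simp add: mult.commute)
    then show ?thesis using c unfolding Rem_def
      by (intro CollectI exI[of _ "\<lambda>i. hcomp (d - int i * 2) (c i)"]) (auto simp: hcomp_sum)
  qed
  show "- 1 \<in> pring V4" by auto
qed auto

text \<open>As y is homogeneous, the component of degree \<open>k\<close> can be taken coefficient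
  by coefficient.\<close>

lemma Rem_homogeneous:
  assumes "r \<in> Rem" "homogeneous r k"
  obtains c where "\<And>i. c i \<in> pring V4" "\<And>i. homogeneous (c i) (k - int i * 2)" "r = (\<Sum>i<n - 1. c i * y ^ i)"
proof -
  obtain c where c: "\<forall>i. c i \<in> pring V4" "r = (\<Sum>i<n - 1. c i * y ^ i)" using assms(1) by (auto simp: Rem_def)
  have "hcomp k (c i * y ^ i) = hcomp (k - int i * 2) (c i) * y ^ i" for i
    using hcomp_mult_left[OF homogeneous_power[OF A_hom(4)], of k i "c i"] by (simp add: mult.commute)
  then have "r = (\<Sum>i<n - 1. hcomp (k - int i * 2) (c i) * y ^ i)"
    using assms(2) c(2) by (simp add: homogeneous_iff hcomp_sum)
  then show ?thesis using that[of "\<lambda>i. hcomp (k - int i * 2) (c i)"] c(1) by auto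
qed

lemma z_sum: "z = (\<Sum>i<n - 1. coeff Z i * y ^ i)"
  unfolding z_def using coeff_B(1) by (intro poly_low_sum) (simp add: coeff_Z)

lemma coeff_Z_mem: "coeff Z i \<in> pring V4"
  using Z_over by (simp add: polys_over_def)

text \<open>A nonzero rational as coefficient of y^(n-2) lets \<open>z\<close> replace that power in
  the basis.\<close>

lemma lead_Z: "coeff Z (n - 2) = of_nat (n + 1)"
proof -
  have "Suc (n - 2) = n - 1" using n by simp
  then show ?thesis unfolding coeff_Z using coeff_B(2) by (simp del: of_nat_Suc of_nat_add)
qed

text \<open>The basis for the targets of multiplication by y: 1 belongs to Gamma_2 and y^(j+1) to
  the copy j of Gamma_1.\<close>

lemma independent_powers:
  assumes "c \<in> pring V4" "\<And>j. j < n - 2 \<Longrightarrow> d j \<in> pring V4" "s \<in> pring V5"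
    and "c + (\<Sum>j<n - 2. d j * y ^ Suc j) = A4 * s"
  shows "c = 0" "j < n - 2 \<Longrightarrow> d j = 0"
proof -
  define e where "e i = (case i of 0 \<Rightarrow> c | Suc j \<Rightarrow> d j)" for i
  have n1: "n - 1 = Suc (n - 2)" using n by simp
  have "A4 * s = (\<Sum>i<n - 1. e i * y ^ i)"
    unfolding n1 sum.lessThan_Suc_shift using assms(4) by (simp add: e_def)
  moreover have "e i \<in> pring V4" if "i < n - 1" for i using that assms(1,2) n1 by (auto simp: e_def split: nat.split)
  ultimately have "e i = 0" if "i < n - 1" for i using low_sum_multiple(2)[of e s] assms(3) that by blast
  from this[of 0] this[of "Suc j"] show "c = 0" "j < n - 2 \<Longrightarrow> d j = 0" using n1 by (auto simp: e_def)
qed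

text \<open>The basis for the sources of multiplication by y. The coefficient of y^(n-2) is c (n +
  1), so \<open>c\<close> vanishes and only powers remain.\<close>

lemma independent_z:
  assumes "c \<in> pring V4" "\<And>j. j < n - 2 \<Longrightarrow> d j \<in> pring V4" "s \<in> pring V5"
    and "c * z + (\<Sum>j<n - 2. d j * y ^ j) = A4 * s"
  shows "c = 0" "j < n - 2 \<Longrightarrow> d j = 0"
proof -
  define e where "e i = c * coeff Z i + (if i < n - 2 then d i else 0)" for i
  have n1: "n - 1 = Suc (n - 2)" using n by simp
  have "(\<Sum>i<n - 1. (if i < n - 2 then d i else 0) * y ^ i) = (\<Sum>j<n - 2. d j * y ^ j)"
    unfolding n1 sum.lessThan_Suc by (simp cong: sum.cong_simp) 
  then have "A4 * s = (\<Sum>i<n - 1. e i * y ^ i)"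
    unfolding assms(4)[symmetric] z_sum by (simp add: e_def distrib_right sum.distrib sum_distrib_left mult.assoc)
  moreover have "e i \<in> pring V4" for i using assms(1,2) coeff_Z_mem by (auto simp: e_def)
  ultimately have e: "e i = 0" if "i < n - 1" for i using low_sum_multiple(2)[of e s] assms(3) that by blast
  have "c * of_nat (n + 1) = 0" using e[of "n - 2"] n1 by (simp add: e_def lead_Z del: of_nat_Suc of_nat_add)
  then show c: "c = 0" by (simp del: of_nat_Suc of_nat_add)
  show "d j = 0" if "j < n - 2" using e[of j] c that by (simp add: e_def)
qed
end

section \<open>Elimination of the second internal mark\<close>

context square
begin

text \<open>Elements supported on the odd generator of the last row: \<open>A4\<close> leads from
  the even generator to the odd one, so the quotient lives on the odd one, whereas \<open>b1\<close>
  leads the other way. The arguments are the components at (0, 0), (1, 0), (0, 1), (1, 1) in the two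
  remaining rows.\<close>

definition quad :: "qpoly \<Rightarrow> qpoly \<Rightarrow> qpoly \<Rightarrow> qpoly \<Rightarrow> (bit \<times> bit \<times> bit) \<Rightarrow>\<^sub>0 qpoly" where
  "quad e00 e10 e01 e11 = Poly_Mapping.single (0, 0, 1) e00 + Poly_Mapping.single (1, 0, 1) e10 +
     Poly_Mapping.single (0, 1, 1) e01 + Poly_Mapping.single (1, 1, 1) e11"

lemma lookup_quad:
  "Poly_Mapping.lookup (quad e00 e10 e01 e11) (p, q, r) =
    (if r = 1 then if p = 0 then if q = 0 then e00 else e01 else if q = 0 then e10 else e11 else 0)"
  using bit_cases[of p] bit_cases[of q] bit_cases[of r]
  by (auto simp: quad_def lookup_add lookup_single when_def)

lemma quad_arith:
  "quad a b c d + quad a' b' c' d' = quad (a + a') (b + b') (c + c') (d + d')"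
  "quad a b c d - quad a' b' c' d' = quad (a - a') (b - b') (c - c') (d - d')"
  "- quad a b c d = quad (- a) (- b) (- c) (- d)"
  "scale r (quad a b c d) = quad (r * a) (r * b) (r * c) (r * d)"
  by (rule poly_mapping_eqI; auto simp: lookup_quad lookup_add lookup_minus split: prod.split)+

lemma bvars_reduced: "bvars C_reduced = V5"
  by (auto simp: C_reduced_def)

lemma quad_odd:
  assumes "e00 \<in> pring V5" "e11 \<in> pring V5" "homogeneous e00 (k - (1 - int n))" "homogeneous e11 (k - (5 - 3 * int n))"
  shows "quad e00 0 0 e11 \<in> bgrade C_reduced 1 k"
proof -
  have "Poly_Mapping.single (0, 0, 1) e00 \<in> bgrade C_reduced 1 k"
    using assms by (intro bgrade_single) (simp_all add: C_reduced_def algebra_simps)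
  moreover have "Poly_Mapping.single (1, 1, 1) e11 \<in> bgrade C_reduced 1 k"
    using assms by (intro bgrade_single) (simp_all add: C_reduced_def algebra_simps)
  ultimately show ?thesis unfolding quad_def by auto
qed

lemma quad_even:
  assumes "e10 \<in> pring V5" "e01 \<in> pring V5" "homogeneous e10 (k - (4 - 2 * int n))" "homogeneous e01 (k - (2 - 2 * int n))"
  shows "quad 0 e10 e01 0 \<in> bgrade C_reduced 0 k"
proof -
  have "Poly_Mapping.single (1, 0, 1) e10 \<in> bgrade C_reduced 0 k"
    using assms by (intro bgrade_single) (simp_all add: C_reduced_def algebra_simps)
  moreover have "Poly_Mapping.single (0, 1, 1) e01 \<in> bgrade C_reduced 0 k"
    using assms by (intro bgrade_single) (simp_all add: C_reduced_def algebra_simps)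
  ultimately show ?thesis unfolding quad_def by auto
qed

text \<open>The last row changes the last index and does not contribute here, which leaves the
  Koszul differential of the other two rows.\<close>

lemma lookup_bdiff_quad:
  "Poly_Mapping.lookup (lin (bdiff C_reduced) (quad e00 e10 e01 e11)) (0, 0, 1) = delta * y * e10 + B3 * e01"
  "Poly_Mapping.lookup (lin (bdiff C_reduced) (quad e00 e10 e01 e11)) (1, 0, 1) = A2 * e00 - B3 * e11"
  "Poly_Mapping.lookup (lin (bdiff C_reduced) (quad e00 e10 e01 e11)) (0, 1, 1) = A3 * e00 + delta * y * e11"
  "Poly_Mapping.lookup (lin (bdiff C_reduced) (quad e00 e10 e01 e11)) (1, 1, 1) = - A3 * e10 + A2 * e01"
  by (simp_all add: lookup_bdiff C_reduced_def dop_tensor dop_rank1_fact lookup_quad b2_x6 b3_x6 algebra_simps)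

definition K :: "((bit \<times> bit \<times> bit) \<Rightarrow>\<^sub>0 qpoly) set" where
  "K = {x. \<forall>b\<in>{b. snd (snd b) = 1}. \<exists>s\<in>pring V5. Poly_Mapping.lookup x b = A4 * s}"

lemma K_iff:
  "x \<in> K \<longleftrightarrow>
    (\<exists>s\<in>pring V5. Poly_Mapping.lookup x (0, 0, 1) = A4 * s) \<and> (\<exists>s\<in>pring V5. Poly_Mapping.lookup x (1, 0, 1) = A4 * s) \<and>
    (\<exists>s\<in>pring V5. Poly_Mapping.lookup x (0, 1, 1) = A4 * s) \<and> (\<exists>s\<in>pring V5. Poly_Mapping.lookup x (1, 1, 1) = A4 * s)"
proof -
  have "{b :: bit \<times> bit \<times> bit. snd (snd b) = 1} = {(0, 0, 1), (1, 0, 1), (0, 1, 1), (1, 1, 1)}"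
  proof (rule Set.set_eqI)
    fix b :: "bit \<times> bit \<times> bit"
    obtain p q r where [simp]: "b = (p, q, r)" by (metis surj_pair)
    show "b \<in> {b. snd (snd b) = 1} \<longleftrightarrow> b \<in> {(0, 0, 1), (1, 0, 1), (0, 1, 1), (1, 1, 1)}"
      using bit_cases[of p] bit_cases[of q] by auto
  qed
  then show ?thesis by (simp add: K_def)
qed

lemma K_add:
  assumes "x \<in> K" "x' \<in> K"
  shows "x + x' \<in> K"
  unfolding K_def
proof (intro CollectI ballI)
  fix b :: "bit \<times> bit \<times> bit" assume "b \<in> {b. snd (snd b) = 1}"
  then obtain s s' where "s \<in> pring V5" "s' \<in> pring V5" "Poly_Mapping.lookup x b = A4 * s" "Poly_Mapping.lookup x' b = A4 * s'"
    using assms unfolding K_def by blast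
  then show "\<exists>s\<in>pring V5. Poly_Mapping.lookup (x + x') b = A4 * s"
    by (intro bexI[of _ "s + s'"]) (auto simp: lookup_add distrib_left)
qed

lemma K_scale:
  assumes "x \<in> K" "r \<in> pring V5"
  shows "scale r x \<in> K"
  unfolding K_def
proof (intro CollectI ballI)
  fix b :: "bit \<times> bit \<times> bit" assume "b \<in> {b. snd (snd b) = 1}"
  then obtain s where "s \<in> pring V5" "Poly_Mapping.lookup x b = A4 * s"
    using assms unfolding K_def by blast
  then show "\<exists>s\<in>pring V5. Poly_Mapping.lookup (scale r x) b = A4 * s"
    using assms(2) by (intro bexI[of _ "r * s"]) auto
qed

lemma K_zero: "0 \<in> K" by (auto simp: K_def intro!: bexI[of _ 0])

lemma K_sum: "(\<And>b. b \<in> A \<Longrightarrow> f b \<in> K) \<Longrightarrow> sum f A \<in> K"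
  by (induction A rule: infinite_finite_induct) (auto intro: K_add K_zero)

definition target :: "((bit \<times> bit) + (int \<times> (bit \<times> bit))) bfact" where
  "target = C_arcs2 n \<oplus>\<^sub>f dsum_family {0..int n - 3} (\<lambda>i. grade_shift (3 - int n + 2 * i) (parity_shift (C_arcs1 n)))"

lemma arcs1: "C_arcs1 n = rank1_fact {1, 4} (1 - int n) (P 1 4) (X 1 - X 4) \<otimes>\<^sub>f rank1_fact {3, 2} (1 - int n) (P 3 2) (X 3 - X 2)"
  and arcs2: "C_arcs2 n = rank1_fact {1, 2} (1 - int n) (P 1 2) (X 1 - X 2) \<otimes>\<^sub>f rank1_fact {3, 4} (1 - int n) (P 3 4) (X 3 - X 4)"
  by (simp_all add: C_arcs1_def C_arcs2_def arc_eq)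

lemma bvars_target: "bvars target = V4"
  unfolding target_def arcs1 arcs2 by auto

lemma basis_target: "basis target = UNIV <+> ({0..int n - 3} \<times> UNIV)"
  unfolding target_def arcs1 arcs2 by auto

lemma bfact_ok_target: "bfact_ok n w target"
proof -
  have P_hom: "homogeneous (P i j) (2 * int n)" for i j by (intro homogeneous_pi_sum) auto
  have ok: "bfact_ok n (P i j * (X i - X j)) (rank1_fact {i, j} (1 - int n) (P i j) (X i - X j))" for i j
    using P_hom by (intro bfact_ok_rank1_fact pring_pi_sum pring_diff pring_X) auto
  have PX: "P i j * (X i - X j) = X i ^ (n + 1) - X j ^ (n + 1)" for i j
    using pi_sum[of "X i" "X j" n] by (simp only: mult.commute)
  have w1: "w = P 1 4 * (X 1 - X 4) + P 3 2 * (X 3 - X 2)" and w2: "w = P 1 2 * (X 1 - X 2) + P 3 4 * (X 3 - X 4)"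
    unfolding PX w_def by simp_all
  have "bfact_ok n w (C_arcs1 n)" unfolding w1 arcs1 by (intro bfact_ok_tensor ok)
  moreover have "bfact_ok n w (C_arcs2 n)" unfolding w2 arcs2 by (intro bfact_ok_tensor ok)
  ultimately show ?thesis
    unfolding target_def
    by (intro bfact_ok_dsum_family) (auto intro: bfact_ok_grade_shift bfact_ok_parity_shift simp: arcs1 arcs2)
qed

lemma bdiff_rank1_tensor:
  "bdiff (rank1_fact U d a b \<otimes>\<^sub>f rank1_fact U' d' a' b') (p, q) =
    Poly_Mapping.single (p + 1, q) (if p = 0 then a else b) +
    Poly_Mapping.single (p, q + 1) ((if p = 0 then 1 else - 1) * (if q = 0 then a' else b'))"
  by (rule poly_mapping_eqI)
    (auto simp: tensor_def rank1_fact_def lookup_add lookup_single when_def split_paired_all)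

lemma bdiff_target_Inl:
  "bdiff target (Inl (p, q)) =
    Poly_Mapping.single (Inl (p + 1, q)) (if p = 0 then P 1 2 else X 1 - X 2) +
    Poly_Mapping.single (Inl (p, q + 1)) ((if p = 0 then 1 else - 1) * (if q = 0 then P 3 4 else X 3 - X 4))"
  unfolding target_def arcs2 dsum_def
  by (simp only: bfact.select_convs sum.case bdiff_rank1_tensor) (simp add: inject_eq_lin lin_add)

lemma bdiff_target_Inr:
  "bdiff target (Inr (i, p, q)) =
    - (Poly_Mapping.single (Inr (i, p + 1, q)) (if p = 0 then P 1 4 else X 1 - X 4) +
       Poly_Mapping.single (Inr (i, p, q + 1)) ((if p = 0 then 1 else - 1) * (if q = 0 then P 3 2 else X 3 - X 2)))"
proof -
  have "bdiff (grade_shift m (parity_shift (C_arcs1 n))) (p, q) = - bdiff (C_arcs1 n) (p, q)" for m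
    by (simp add: grade_shift_def parity_shift_def)
  then have "bdiff target (Inr (i, p, q)) = inject Inr (inject (Pair i) (- bdiff (C_arcs1 n) (p, q)))"
    by (simp add: target_def dsum_def dsum_family_def)
  then show ?thesis
    unfolding arcs1 bdiff_rank1_tensor by (simp add: inject_eq_lin lin_add lin_diff lin_uminus lin_lin)
qed

lemma bdeg_target:
  "bdeg target (Inl (p, q)) = (if p = 0 then 0 else 1 - int n) + (if q = 0 then 0 else 1 - int n)"
  "bdeg target (Inr (i, p, q)) = (if p = 0 then 0 else 1 - int n) + (if q = 0 then 0 else 1 - int n) + (3 - int n + 2 * i)"
  unfolding target_def arcs1 arcs2 by simp_all

lemma par_target:
  "par target (Inl (p, q)) = p + q" "par target (Inr (i, p, q)) = p + q + 1"
  unfolding target_def arcs1 arcs2 by simp_all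

text \<open>Write e_pq for the components of \<open>quad\<close>. The differential has the entry
  (x_1 - x_4) y from e_1q to e_0q, so e_1q is taken with the basis y^j, z and e_0q with y^(j+1), 1.
  In a copy of Gamma_1 the generators of the first row keep their roles; for Gamma_2 they are
  exchanged, so that its generator (0, 0) begins with z e_10. \<open>t\<close>, \<open>u\<close>,
  \<open>v\<close> correct the a-entries. The other mixed terms come from x_3 - x_2 = B3 - (x_1 -
  x_4) and x_1 - x_2 = B3 - (x_3 - x_4).\<close>

definition embed :: "qpoly \<Rightarrow> qpoly \<Rightarrow> qpoly \<Rightarrow> (bit \<times> bit) + (int \<times> (bit \<times> bit)) \<Rightarrow> (bit \<times> bit \<times> bit) \<Rightarrow>\<^sub>0 qpoly" where
  "embed t u v b = (case b of
      Inl (p, q) \<Rightarrow> if p = 0 then if q = 0 then quad 0 z v 0 else quad 1 0 0 u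
        else if q = 0 then quad (- 1) 0 0 (- z - u) else quad 0 0 1 0
    | Inr (i, p, q) \<Rightarrow> let Y = y ^ nat i in
        if p = 0 then if q = 0 then quad (y * Y) 0 0 (Y * t) else quad 0 Y (- (y * Y)) 0
        else if q = 0 then quad 0 (- Y) 0 0 else quad 0 0 0 Y)"

lemma embed_simps:
  "embed t u v (Inl (0, 0)) = quad 0 z v 0" "embed t u v (Inl (0, 1)) = quad 1 0 0 u"
  "embed t u v (Inl (1, 0)) = quad (- 1) 0 0 (- z - u)" "embed t u v (Inl (1, 1)) = quad 0 0 1 0"
  "embed t u v (Inr (i, 0, 0)) = quad (y * y ^ nat i) 0 0 (y ^ nat i * t)"
  "embed t u v (Inr (i, 0, 1)) = quad 0 (y ^ nat i) (- (y * y ^ nat i)) 0"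
  "embed t u v (Inr (i, 1, 0)) = quad 0 (- (y ^ nat i)) 0 0"
  "embed t u v (Inr (i, 1, 1)) = quad 0 0 0 (y ^ nat i)"
  by (simp_all add: embed_def Let_def)

end

locale square_data = square +
  fixes t u v :: qpoly
  assumes mem: "t \<in> pring V5" "u \<in> pring V5" "v \<in> pring V4"
    and hom: "homogeneous t (2 * int n - 2)" "homogeneous u (2 * int n - 4)" "homogeneous v (2 * int n - 2)"
    and eq1: "A2 * y = B3 * t + P 1 4 - P 3 2 - (X 3 - X 5) * A4"
    and eq2: "A3 = P 3 2 - delta * t - X 5 * A4"
    and eq3: "delta * y * z + B3 * v = P 3 4 - P 1 2 - delta * A4"
    and eq4: "A2 = B3 * u + (X 3 - X 4) * z + A4"
    and eq5: "A3 = P 1 2 + (X 3 - X 4) * v - delta * y * u - X 5 * A4"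
begin

abbreviation \<psi> where "\<psi> \<equiv> embed t u v"

lemma mems: "y ^ j \<in> pring V5" "z \<in> pring V5" "v \<in> pring V5" "X 5 \<in> pring V5" "X 3 \<in> pring V5" "delta \<in> pring V5"
  using A_mem(4) z_mem mem V45 by (auto intro!: pring_diff pring_X)

lemma embed_bgrade:
  assumes "b \<in> basis target"
  shows "\<psi> b \<in> bgrade C_reduced (par target b) (bdeg target b)"
proof -
  have yj: "homogeneous (y ^ j) (2 * int j)" for j
    using homogeneous_power[OF A_hom(4), of j] by (simp add: mult.commute)
  have m1: "- z - u \<in> pring V5" "- (1::qpoly) \<in> pring V5" and h1: "homogeneous (- z - u) (2 * int n - 4)" "homogeneous (- 1) 0"
    using mems mem z_hom hom by (auto intro!: pring_diff homogeneous_diff)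
  consider p q where "b = Inl (p, q)" | i p q where "b = Inr (i, p, q)" "i \<ge> 0"
    using assms unfolding basis_target by (cases b) auto
  then show ?thesis
  proof cases
    case (1 p q)
    have "quad 0 z v 0 \<in> bgrade C_reduced 0 0" "quad 1 0 0 u \<in> bgrade C_reduced 1 (1 - int n)"
      "quad (- 1) 0 0 (- z - u) \<in> bgrade C_reduced 1 (1 - int n)" "quad 0 0 1 0 \<in> bgrade C_reduced 0 (2 - 2 * int n)"
      using mems mem hom z_hom m1 h1 by (auto intro!: quad_odd quad_even simp: algebra_simps)
    then show ?thesis
      using bit_cases[of p] bit_cases[of q] unfolding 1 by (auto simp: par_target bdeg_target embed_simps)
  next
    case (2 i p q)
    obtain j where j: "i = int j" using 2(2) nonneg_int_cases by blast
    let ?Y = "y ^ j"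
    have h: "homogeneous (y * ?Y) (2 + 2 * int j)" "homogeneous (?Y * t) (2 * int j + (2 * int n - 2))"
      by (rule homogeneous_mult[OF A_hom(4) yj], rule homogeneous_mult[OF yj hom(1)])
    have m: "y * ?Y \<in> pring V5" "?Y * t \<in> pring V5" "- (y * ?Y) \<in> pring V5" "- ?Y \<in> pring V5"
      using mems mem A_mem(4) by (auto intro!: pring_uminus pring_mult)
    have "quad (y * ?Y) 0 0 (?Y * t) \<in> bgrade C_reduced 1 (3 - int n + 2 * int j)"
      by (rule quad_odd[OF m(1,2)]) (use h in \<open>simp_all add: algebra_simps\<close>)
    moreover have "quad 0 ?Y (- (y * ?Y)) 0 \<in> bgrade C_reduced 0 (1 - int n + (3 - int n + 2 * int j))"
      by (rule quad_even[OF mems(1) m(3)]) (use yj[of j] homogeneous_uminus[OF h(1)] in \<open>simp_all add: algebra_simps\<close>)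
    moreover have "quad 0 (- ?Y) 0 0 \<in> bgrade C_reduced 0 (1 - int n + (3 - int n + 2 * int j))"
      by (rule quad_even[OF m(4)]) (use homogeneous_uminus[OF yj[of j]] in \<open>simp_all add: algebra_simps\<close>)
    moreover have "quad 0 0 0 ?Y \<in> bgrade C_reduced 1 (2 - 2 * int n + (3 - int n + 2 * int j))"
      by (rule quad_odd[OF _ mems(1)]) (use yj[of j] in \<open>simp_all add: algebra_simps\<close>)
    ultimately show ?thesis
      using bit_cases[of p] bit_cases[of q] unfolding 2 j by (auto simp: par_target bdeg_target embed_simps)
  qed
qed

lemma embed_bdiff_aux:
  assumes "\<psi> b = quad e00 e10 e01 e11" "lin \<psi> (bdiff target b) = quad c00 c10 c01 c11"
    and "delta * y * e10 + B3 * e01 - c00 = A4 * s00" "A2 * e00 - B3 * e11 - c10 = A4 * s10"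
    "A3 * e00 + delta * y * e11 - c01 = A4 * s01" "- A3 * e10 + A2 * e01 - c11 = A4 * s11"
    and "s00 \<in> pring V5" "s10 \<in> pring V5" "s01 \<in> pring V5" "s11 \<in> pring V5"
  shows "lin (bdiff C_reduced) (\<psi> b) - lin \<psi> (bdiff target b) \<in> K"
  unfolding K_iff assms(1,2) lookup_minus lookup_bdiff_quad lookup_quad using assms(3-) by auto

text \<open>In each case the right-hand sides display the quotients by \<^term>\<open>A4\<close>.\<close>

lemma embed_bdiff: "lin (bdiff C_reduced) (\<psi> b) - lin \<psi> (bdiff target b) \<in> K"
proof -
  note lk = bdiff_target_Inl bdiff_target_Inr lin_add lin_diff lin_uminus lin_single embed_simps quad_arith add_0 bit_add_self
  have P34: "P 3 4 = delta * y * z + B3 * v + P 1 2 + delta * A4" using eq3 by (simp add: algebra_simps)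
  have A2y: "A2 * (y * p) = (B3 * t + P 1 4 - P 3 2 - (X 3 - X 5) * A4) * p" for p
    unfolding mult.assoc[symmetric] eq1 ..
  have ring: "p \<in> pring V5 \<Longrightarrow> q \<in> pring V5 \<Longrightarrow> p * q \<in> pring V5" "p \<in> pring V5 \<Longrightarrow> q \<in> pring V5 \<Longrightarrow> p + q \<in> pring V5"
    "p \<in> pring V5 \<Longrightarrow> q \<in> pring V5 \<Longrightarrow> p - q \<in> pring V5" "p \<in> pring V5 \<Longrightarrow> - p \<in> pring V5" for p q
    by auto
  consider "b = Inl (0, 0)" | "b = Inl (1, 0)" | "b = Inl (0, 1)" | "b = Inl (1, 1)"
    | i where "b = Inr (i, 0, 0)" | i where "b = Inr (i, 1, 0)" | i where "b = Inr (i, 0, 1)" | i where "b = Inr (i, 1, 1)"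
  proof (cases b)
    case (Inl c)
    then show ?thesis using that(1-4) bit_cases[of "fst c"] bit_cases[of "snd c"] by (cases c) auto
  next
    case (Inr c)
    then show ?thesis using that(5-8) bit_cases[of "fst (snd c)"] bit_cases[of "snd (snd c)"] by (cases c) auto
  qed
  then show ?thesis
  proof cases
    case 1
    show ?thesis
      unfolding 1
    proof (rule embed_bdiff_aux)
      show "\<psi> (Inl (0, 0)) = quad (0) (z) (v) (0)" by (simp only: embed_simps)
      show "lin \<psi> (bdiff target (Inl (0, 0))) = quad (P 3 4 - P 1 2) (0) (0) (- (P 1 2 * (z + u)) + P 3 4 * u)"
        by (simp add: lk) (simp add: algebra_simps)?
      show "delta * y * (z) + B3 * (v) - (P 3 4 - P 1 2) = A4 * (- delta)"
        "A2 * (0) - B3 * (0) - (0) = A4 * (0)"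
        "A3 * (0) + delta * y * (0) - (0) = A4 * (0)"
        "- A3 * (z) + A2 * (v) - (- (P 1 2 * (z + u)) + P 3 4 * u) = A4 * (X 5 * z + v - delta * u)"
        by (simp_all only: P34 eq4 eq5) (simp_all add: B3_def algebra_simps)
      show "- delta \<in> pring V5" "0 \<in> pring V5" "0 \<in> pring V5" "X 5 * z + v - delta * u \<in> pring V5"
        by (intro ring mems mem A_mem pring_zero pring_one)+
    qed
  next
    case 2
    show ?thesis
      unfolding 2
    proof (rule embed_bdiff_aux)
      show "\<psi> (Inl (1, 0)) = quad (- 1) (0) (0) (- z - u)" by (simp only: embed_simps)
      show "lin \<psi> (bdiff target (Inl (1, 0))) = quad (0) ((X 1 - X 2) * z) ((X 1 - X 2) * v - P 3 4) (0)"
        by (simp add: lk) (simp add: algebra_simps)?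
      show "delta * y * (0) + B3 * (0) - (0) = A4 * (0)"
        "A2 * (- 1) - B3 * (- z - u) - ((X 1 - X 2) * z) = A4 * (- 1)"
        "A3 * (- 1) + delta * y * (- z - u) - ((X 1 - X 2) * v - P 3 4) = A4 * (delta + X 5)"
        "- A3 * (0) + A2 * (0) - (0) = A4 * (0)"
        by (simp_all only: P34 eq4 eq5) (simp_all add: B3_def algebra_simps)
      show "0 \<in> pring V5" "- 1 \<in> pring V5" "delta + X 5 \<in> pring V5" "0 \<in> pring V5"
        by (intro ring mems mem A_mem pring_zero pring_one)+
    qed
  next
    case 3
    show ?thesis
      unfolding 3
    proof (rule embed_bdiff_aux)
      show "\<psi> (Inl (0, 1)) = quad (1) (0) (0) (u)" by (simp only: embed_simps)
      show "lin \<psi> (bdiff target (Inl (0, 1))) = quad (0) ((X 3 - X 4) * z) (P 1 2 + (X 3 - X 4) * v) (0)"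
        by (simp add: lk) (simp add: algebra_simps)?
      show "delta * y * (0) + B3 * (0) - (0) = A4 * (0)"
        "A2 * (1) - B3 * (u) - ((X 3 - X 4) * z) = A4 * (1)"
        "A3 * (1) + delta * y * (u) - (P 1 2 + (X 3 - X 4) * v) = A4 * (- X 5)"
        "- A3 * (0) + A2 * (0) - (0) = A4 * (0)"
        by (simp_all only: P34 eq4 eq5) (simp_all add: B3_def algebra_simps)
      show "0 \<in> pring V5" "1 \<in> pring V5" "- X 5 \<in> pring V5" "0 \<in> pring V5"
        by (intro ring mems mem A_mem pring_zero pring_one)+
    qed
  next
    case 4
    show ?thesis
      unfolding 4
    proof (rule embed_bdiff_aux)
      show "\<psi> (Inl (1, 1)) = quad (0) (0) (1) (0)" by (simp only: embed_simps)
      show "lin \<psi> (bdiff target (Inl (1, 1))) = quad (X 1 - X 2 + (X 3 - X 4)) (0) (0) ((X 1 - X 2) * u + (X 3 - X 4) * (z + u))"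
        by (simp add: lk) (simp add: algebra_simps)?
      show "delta * y * (0) + B3 * (1) - (X 1 - X 2 + (X 3 - X 4)) = A4 * (0)"
        "A2 * (0) - B3 * (0) - (0) = A4 * (0)"
        "A3 * (0) + delta * y * (0) - (0) = A4 * (0)"
        "- A3 * (0) + A2 * (1) - ((X 1 - X 2) * u + (X 3 - X 4) * (z + u)) = A4 * (1)"
        by (simp_all only: P34 eq4 eq5) (simp_all add: B3_def algebra_simps)
      show "0 \<in> pring V5" "0 \<in> pring V5" "0 \<in> pring V5" "1 \<in> pring V5"
        by (intro ring mems mem A_mem pring_zero pring_one)+
    qed
  next
    case (5 i)
    let ?Y = "y ^ nat i"
    show ?thesis
      unfolding 5
    proof (rule embed_bdiff_aux)
      show "\<psi> (Inr (i, 0, 0)) = quad (y * ?Y) (0) (0) (?Y * t)" by (simp only: embed_simps)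
      show "lin \<psi> (bdiff target (Inr (i, 0, 0))) = quad (0) ((P 1 4 - P 3 2) * ?Y) (P 3 2 * (y * ?Y)) (0)"
        by (simp add: lk) (simp add: algebra_simps)?
      show "delta * y * (0) + B3 * (0) - (0) = A4 * (0)"
        "A2 * (y * ?Y) - B3 * (?Y * t) - ((P 1 4 - P 3 2) * ?Y) = A4 * (- (?Y * (X 3 - X 5)))"
        "A3 * (y * ?Y) + delta * y * (?Y * t) - (P 3 2 * (y * ?Y)) = A4 * (- (y * ?Y * X 5))"
        "- A3 * (0) + A2 * (0) - (0) = A4 * (0)"
        by (simp_all only: eq2 A2y mult_minus_right) (simp_all add: B3_def algebra_simps)
      show "0 \<in> pring V5" "- (?Y * (X 3 - X 5)) \<in> pring V5" "- (y * ?Y * X 5) \<in> pring V5" "0 \<in> pring V5"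
        by (intro ring mems mem A_mem pring_zero pring_one)+
    qed
  next
    case (6 i)
    let ?Y = "y ^ nat i"
    show ?thesis
      unfolding 6
    proof (rule embed_bdiff_aux)
      show "\<psi> (Inr (i, 1, 0)) = quad (0) (- ?Y) (0) (0)" by (simp only: embed_simps)
      show "lin \<psi> (bdiff target (Inr (i, 1, 0))) = quad (- (delta * (y * ?Y))) (0) (0) (P 3 2 * ?Y - delta * (?Y * t))"
        by (simp add: lk) (simp add: algebra_simps)?
      show "delta * y * (- ?Y) + B3 * (0) - (- (delta * (y * ?Y))) = A4 * (0)"
        "A2 * (0) - B3 * (0) - (0) = A4 * (0)"
        "A3 * (0) + delta * y * (0) - (0) = A4 * (0)"
        "- A3 * (- ?Y) + A2 * (0) - (P 3 2 * ?Y - delta * (?Y * t)) = A4 * (- (?Y * X 5))"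
        by (simp_all only: eq2 A2y mult_minus_right) (simp_all add: B3_def algebra_simps)
      show "0 \<in> pring V5" "0 \<in> pring V5" "0 \<in> pring V5" "- (?Y * X 5) \<in> pring V5"
        by (intro ring mems mem A_mem pring_zero pring_one)+
    qed
  next
    case (7 i)
    let ?Y = "y ^ nat i"
    show ?thesis
      unfolding 7
    proof (rule embed_bdiff_aux)
      show "\<psi> (Inr (i, 0, 1)) = quad (0) (?Y) (- (y * ?Y)) (0)" by (simp only: embed_simps)
      show "lin \<psi> (bdiff target (Inr (i, 0, 1))) = quad (- ((X 3 - X 2) * (y * ?Y))) (0) (0) (- (P 1 4 * ?Y) - (X 3 - X 2) * (?Y * t))"
        by (simp add: lk) (simp add: algebra_simps)?
      show "delta * y * (?Y) + B3 * (- (y * ?Y)) - (- ((X 3 - X 2) * (y * ?Y))) = A4 * (0)"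
        "A2 * (0) - B3 * (0) - (0) = A4 * (0)"
        "A3 * (0) + delta * y * (0) - (0) = A4 * (0)"
        "- A3 * (?Y) + A2 * (- (y * ?Y)) - (- (P 1 4 * ?Y) - (X 3 - X 2) * (?Y * t)) = A4 * (?Y * X 3)"
        by (simp_all only: eq2 A2y mult_minus_right) (simp_all add: B3_def algebra_simps)
      show "0 \<in> pring V5" "0 \<in> pring V5" "0 \<in> pring V5" "?Y * X 3 \<in> pring V5"
        by (intro ring mems mem A_mem pring_zero pring_one)+
    qed
  next
    case (8 i)
    let ?Y = "y ^ nat i"
    show ?thesis
      unfolding 8
    proof (rule embed_bdiff_aux)
      show "\<psi> (Inr (i, 1, 1)) = quad (0) (0) (0) (?Y)" by (simp only: embed_simps)
      show "lin \<psi> (bdiff target (Inr (i, 1, 1))) = quad (0) (- ((delta + (X 3 - X 2)) * ?Y)) (delta * (y * ?Y)) (0)"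
        by (simp add: lk) (simp add: algebra_simps)?
      show "delta * y * (0) + B3 * (0) - (0) = A4 * (0)"
        "A2 * (0) - B3 * (?Y) - (- ((delta + (X 3 - X 2)) * ?Y)) = A4 * (0)"
        "A3 * (0) + delta * y * (?Y) - (delta * (y * ?Y)) = A4 * (0)"
        "- A3 * (0) + A2 * (0) - (0) = A4 * (0)"
        by (simp_all only: eq2 A2y mult_minus_right) (simp_all add: B3_def algebra_simps)
      show "0 \<in> pring V5" "0 \<in> pring V5" "0 \<in> pring V5" "0 \<in> pring V5"
        by (intro ring mems mem A_mem pring_zero pring_one)+
    qed
  qed
qed
end

section \<open>Bijectivity of the splitting modulo the contractible part\<close>

context square
begin

lemma quad_zero: "quad 0 0 0 0 = 0" by (simp add: quad_def)

lemma quad_sum: "(\<Sum>j\<in>A. quad (a j) (b j) (c j) (d j)) = quad (sum a A) (sum b A) (sum c A) (sum d A)"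
  by (induction A rule: infinite_finite_induct) (simp_all add: quad_zero quad_arith)

lemma z_Rem: "z \<in> Rem"
  unfolding Rem_def using z_sum coeff_Z_mem by blast

text \<open>\<open>z\<close> also has an expansion with homogeneous coefficients; the difference of
  the two expansions is \<open>A4\<close> times 0, so they agree.\<close>

lemma coeff_Z_hom: "i < n - 1 \<Longrightarrow> homogeneous (coeff Z i) (2 * int n - 4 - int i * 2)"
proof -
  assume i: "i < n - 1"
  obtain c where c: "\<And>i. c i \<in> pring V4" "\<And>i. homogeneous (c i) (2 * int n - 4 - int i * 2)" "z = (\<Sum>i<n - 1. c i * y ^ i)"
    using Rem_homogeneous[OF z_Rem z_hom] by blast
  have "A4 * 0 = (\<Sum>i<n - 1. (coeff Z i - c i) * y ^ i)"
    using c(3) z_sum by (simp add: left_diff_distrib sum_subtractf)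
  then have "coeff Z i - c i = 0"
    using i c(1) coeff_Z_mem by (intro low_sum_multiple(2)[of "\<lambda>i. coeff Z i - c i" 0]) auto
  then show ?thesis using c(2)[of i] by simp
qed

text \<open>With integer bounds the index set is empty for \<open>n = 2\<close>, where truncated
  subtraction would leave the index 0.\<close>

lemma int_interval: "{0..int n - 3} = int ` {..<n - 2}"
proof -
  have "i \<in> int ` {..<n - 2}" if "0 \<le> i" "i \<le> int n - 3" for i
    using that n by (intro image_eqI[of _ _ "nat i"]) auto
  then show ?thesis by auto
qed

lemma finite_basis_target: "finite (basis target)"
  unfolding basis_target by simp

end

context square_data
begin

text \<open>Sorted by components: up to terms with \<open>t\<close>, \<open>u\<close>,
  \<open>v\<close>, those at e_00 and e_01 are expanded in 1, y, ..., y^(n-2), and those at e_10 and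
  e_11 in z, 1, ..., y^(n-3).\<close>

lemma lin_embed:
  assumes "x \<in> bcar target i"
  shows "lin \<psi> x =
    (let m = \<lambda>p q. Poly_Mapping.lookup x (Inl (p, q)); M = \<lambda>p q j. Poly_Mapping.lookup x (Inr (int j, p, q)) in
      quad (m 0 1 - m 1 0 + (\<Sum>j<n - 2. M 0 0 j * y ^ Suc j))
        (m 0 0 * z + (\<Sum>j<n - 2. (M 0 1 j - M 1 0 j) * y ^ j))
        (m 0 0 * v + m 1 1 + (\<Sum>j<n - 2. - M 0 1 j * y ^ Suc j))
        (m 0 1 * u - m 1 0 * (z + u) + (\<Sum>j<n - 2. M 0 0 j * y ^ j * t + M 1 1 j * y ^ j)))"
proof -
  let ?m = "\<lambda>p q. Poly_Mapping.lookup x (Inl (p, q))" and ?M = "\<lambda>p q j. Poly_Mapping.lookup x (Inr (int j, p, q))"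
  have keys: "Poly_Mapping.keys x \<subseteq> basis target" using assms by (auto simp: bcar_def in_keys_iff)
  have "lin \<psi> x = (\<Sum>b\<in>basis target. scale (Poly_Mapping.lookup x b) (\<psi> b))"
    by (rule lin_superset[OF finite_basis_target keys])
  also have "\<dots> = (\<Sum>p\<in>UNIV. \<Sum>q\<in>UNIV. scale (?m p q) (\<psi> (Inl (p, q)))) +
      (\<Sum>j<n - 2. \<Sum>p\<in>UNIV. \<Sum>q\<in>UNIV. scale (?M p q j) (\<psi> (Inr (int j, p, q))))"
  proof -
    have "(\<Sum>b\<in>{0..int n - 3} \<times> (UNIV :: (bit \<times> bit) set). f b) = (\<Sum>j<n - 2. \<Sum>p\<in>UNIV. \<Sum>q\<in>UNIV. f (int j, p, q))"
      for f :: "int \<times> (bit \<times> bit) \<Rightarrow> (bit \<times> bit \<times> bit) \<Rightarrow>\<^sub>0 qpoly"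
    proof -
      have "(\<Sum>b\<in>{0..int n - 3} \<times> UNIV. f b) = (\<Sum>i\<in>int ` {..<n - 2}. \<Sum>c\<in>UNIV. f (i, c))"
        unfolding int_interval by (simp add: sum.cartesian_product)
      then show ?thesis by (simp add: sum.reindex sum_UNIV_Times)
    qed
    then show ?thesis
      unfolding basis_target by (subst sum.Plus) (simp_all add: sum_UNIV_Times)
  qed
  also have "\<dots> = quad (?m 0 1 - ?m 1 0) (?m 0 0 * z) (?m 0 0 * v + ?m 1 1) (?m 0 1 * u - ?m 1 0 * (z + u)) +
      (\<Sum>j<n - 2. quad (?M 0 0 j * y ^ Suc j) ((?M 0 1 j - ?M 1 0 j) * y ^ j) (- ?M 0 1 j * y ^ Suc j) (?M 0 0 j * y ^ j * t + ?M 1 1 j * y ^ j))"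
    by (intro arg_cong2[where f = "(+)"] sum.cong refl)
      (simp_all add: UNIV_bit_eq embed_simps quad_arith, simp_all add: algebra_simps)
  finally show ?thesis by (simp add: quad_sum quad_arith Let_def)
qed

text \<open>A triangular system. The components e_00 and e_10 carry no corrections; once they are
  solved, the term with \<open>v\<close> is gone from e_01 and those with \<open>t\<close> and
  \<open>u\<close> from e_11.\<close>

lemma embed_inj:
  assumes x: "x \<in> bcar target i" and K: "lin \<psi> x \<in> K"
  shows "x = 0"
proof -
  define m where "m p q = Poly_Mapping.lookup x (Inl (p, q))" for p q
  define M where "M p q j = Poly_Mapping.lookup x (Inr (int j, p, q))" for p q j
  have mM: "m p q \<in> pring V4" "M p q j \<in> pring V4" for p q j
    using bcar_lookup[OF x] unfolding bvars_target m_def M_def by auto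
  have eq: "lin \<psi> x = quad (m 0 1 - m 1 0 + (\<Sum>j<n - 2. M 0 0 j * y ^ Suc j))
        (m 0 0 * z + (\<Sum>j<n - 2. (M 0 1 j - M 1 0 j) * y ^ j))
        (m 0 0 * v + m 1 1 + (\<Sum>j<n - 2. - M 0 1 j * y ^ Suc j))
        (m 0 1 * u - m 1 0 * (z + u) + (\<Sum>j<n - 2. M 0 0 j * y ^ j * t + M 1 1 j * y ^ j))"
    using lin_embed[OF x] unfolding Let_def m_def M_def .
  obtain s00 s10 s01 s11 where s: "s00 \<in> pring V5" "s10 \<in> pring V5" "s01 \<in> pring V5" "s11 \<in> pring V5"
    and e: "m 0 1 - m 1 0 + (\<Sum>j<n - 2. M 0 0 j * y ^ Suc j) = A4 * s00"
      "m 0 0 * z + (\<Sum>j<n - 2. (M 0 1 j - M 1 0 j) * y ^ j) = A4 * s10"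
      "m 0 0 * v + m 1 1 + (\<Sum>j<n - 2. - M 0 1 j * y ^ Suc j) = A4 * s01"
      "m 0 1 * u - m 1 0 * (z + u) + (\<Sum>j<n - 2. M 0 0 j * y ^ j * t + M 1 1 j * y ^ j) = A4 * s11"
    using K unfolding eq K_iff lookup_quad by auto
  have 1: "m 0 1 = m 1 0" "j < n - 2 \<Longrightarrow> M 0 0 j = 0" for j
    using independent_powers[OF pring_diff[OF mM(1) mM(1)] mM(2) s(1) e(1)] by auto
  have 2: "m 0 0 = 0" "j < n - 2 \<Longrightarrow> M 0 1 j = M 1 0 j" for j
    using independent_z[OF mM(1) pring_diff[OF mM(2) mM(2)] s(2) e(2)] by auto
  have e3: "m 1 1 + (\<Sum>j<n - 2. - M 0 1 j * y ^ Suc j) = A4 * s01" using e(3) 2(1) by simp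
  have 3: "m 1 1 = 0" "j < n - 2 \<Longrightarrow> M 0 1 j = 0" for j
    using independent_powers[OF mM(1) pring_uminus[OF mM(2)] s(3) e3] by auto
  have "(\<Sum>j<n - 2. M 0 0 j * y ^ j * t + M 1 1 j * y ^ j) = (\<Sum>j<n - 2. M 1 1 j * y ^ j)"
    using 1(2) by (intro sum.cong) auto
  then have e4: "- m 1 0 * z + (\<Sum>j<n - 2. M 1 1 j * y ^ j) = A4 * s11"
    using e(4) 1(1) by (simp add: algebra_simps)
  have 4: "m 1 0 = 0" "j < n - 2 \<Longrightarrow> M 1 1 j = 0" for j
    using independent_z[OF pring_uminus[OF mM(1)] mM(2) s(4) e4] by auto
  have m0: "m p q = 0" for p q
    using bit_cases[of p] bit_cases[of q] 1 2 3 4 by auto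
  have M0: "M p q j = 0" if "j < n - 2" for p q j
    using bit_cases[of p] bit_cases[of q] 1(2)[OF that] 2(2)[OF that] 3(2)[OF that] 4(2)[OF that] by auto
  have "Poly_Mapping.lookup x b = 0" if "b \<in> basis target" for b
    using that m0 M0 unfolding basis_target int_interval m_def M_def by auto
  moreover have "Poly_Mapping.lookup x b = 0" if "b \<notin> basis target" for b
    using x that by (auto simp: bcar_def)
  ultimately show ?thesis by (intro poly_mapping_eqI) (metis lookup_zero)
qed

text \<open>Attained by \<open>lin \<psi>\<close> modulo \<open>K\<close> in a given parity and
  degree. The preimage must be homogeneous because the inverse map has to be graded.\<close>

definition reached :: "bit \<Rightarrow> int \<Rightarrow> ((bit \<times> bit \<times> bit) \<Rightarrow>\<^sub>0 qpoly) \<Rightarrow> bool" where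
  "reached i k x \<longleftrightarrow> (\<exists>m\<in>bgrade target i k. x - lin \<psi> m \<in> K)"

lemma reached_add:
  assumes "reached i k x" "reached i k x'"
  shows "reached i k (x + x')"
proof -
  obtain m m' where "m \<in> bgrade target i k" "m' \<in> bgrade target i k" "x - lin \<psi> m \<in> K" "x' - lin \<psi> m' \<in> K"
    using assms by (auto simp: reached_def)
  moreover have "x + x' - lin \<psi> (m + m') = (x - lin \<psi> m) + (x' - lin \<psi> m')" by (simp add: lin_add)
  ultimately show ?thesis unfolding reached_def by (metis K_add bgrade_add)
qed

lemma reached_scale:
  assumes "reached i k x" "c \<in> pring V4" "homogeneous c l" "k' = k + l"
  shows "reached i k' (scale c x)"
proof -
  obtain m where m: "m \<in> bgrade target i k" "x - lin \<psi> m \<in> K" using assms(1) by (auto simp: reached_def)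
  have "scale c m \<in> bgrade target i k'"
    using assms(2-4) by (intro bgrade_scale[OF m(1)]) (simp_all add: bvars_target)
  moreover have "scale c x - lin \<psi> (scale c m) = scale c (x - lin \<psi> m)" by (simp add: lin_scale scale_diff_right)
  ultimately show ?thesis unfolding reached_def using K_scale[OF m(2) V45[OF assms(2)]] by metis
qed

lemma reached_uminus: "reached i k x \<Longrightarrow> reached i k (- x)"
  using reached_scale[of i k x "- 1" 0 k] homogeneous_uminus[OF homogeneous_one] by (auto simp: scale_uminus_left)

lemma reached_diff: "reached i k x \<Longrightarrow> reached i k x' \<Longrightarrow> reached i k (x - x')"
  using reached_add[of i k x "- x'"] reached_uminus[of i k x'] by simp

lemma reached_zero: "reached i k 0"
  unfolding reached_def by (intro bexI[of _ 0]) (auto simp: K_zero)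

lemma reached_sum: "(\<And>j. j \<in> A \<Longrightarrow> reached i k (f j)) \<Longrightarrow> reached i k (sum f A)"
  by (induction A rule: infinite_finite_induct) (auto intro: reached_add reached_zero)

lemma reached_mod_K:
  assumes "reached i k x" "x' - x \<in> K"
  shows "reached i k x'"
proof -
  obtain m where m: "m \<in> bgrade target i k" "x - lin \<psi> m \<in> K" using assms(1) by (auto simp: reached_def)
  have "x' - lin \<psi> m = (x - lin \<psi> m) + (x' - x)" by simp
  then show ?thesis unfolding reached_def using m K_add[OF m(2) assms(2)] by metis
qed

lemma reached_embed:
  assumes "b \<in> basis target" "par target b = i" "bdeg target b = k"
  shows "reached i k (\<psi> b)"
  unfolding reached_def using assms
  by (intro bexI[of _ "Poly_Mapping.single b 1"]) (auto simp: K_zero intro!: bgrade_single)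

text \<open>The remainder is rewritten in the basis z, 1, ..., y^(n-3); \<open>k0\<close> plays the
  role of the degree of \<open>e\<close>.\<close>

lemma reached_Rem_z:
  assumes gens: "\<And>j. j < n - 2 \<Longrightarrow> reached i (k0 + 2 * int j) (scale (y ^ j) e)"
    and z: "reached i (k0 + (2 * int n - 4)) (scale z e)"
    and r: "r \<in> Rem" "homogeneous r k"
  shows "reached i (k0 + k) (scale r e)"
proof -
  obtain c where c: "\<And>i. c i \<in> pring V4" "\<And>i. homogeneous (c i) (k - int i * 2)" "r = (\<Sum>i<n - 1. c i * y ^ i)"
    using Rem_homogeneous[OF r] by blast
  have n1: "n - 1 = Suc (n - 2)" using n by simp
  \<comment> \<open>The coefficient of y^(n-2) in \<open>r\<close>, divided by that of
    \<open>z\<close>, which is n + 1.\<close>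
  define c' where "c' = c (n - 2) * Const (1 / of_nat (n + 1))"
  define d where "d j = c j - c' * coeff Z j" for j
  have c': "c' \<in> pring V4" "homogeneous c' (k - (2 * int n - 4))"
  proof -
    show "c' \<in> pring V4" using c(1) by (auto simp: c'_def)
    show "homogeneous c' (k - (2 * int n - 4))"
      unfolding c'_def by (rule homogeneous_mult'[OF c(2) homogeneous_Const]) (use n in \<open>simp add: of_nat_diff\<close>)
  qed
  have d: "d j \<in> pring V4" "homogeneous (d j) (k - int j * 2)" if "j < n - 2" for j
  proof -
    show "d j \<in> pring V4" unfolding d_def by (intro pring_diff pring_mult c(1) c'(1) coeff_Z_mem)
    have "homogeneous (c' * coeff Z j) (k - int j * 2)"
      using that by (intro homogeneous_mult'[OF c'(2) coeff_Z_hom]) auto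
    then show "homogeneous (d j) (k - int j * 2)" unfolding d_def using c(2) by blast
  qed
  have lead: "c' * coeff Z (n - 2) = c (n - 2)"
  proof -
    have "Const (1 / of_nat (n + 1)) * of_nat (n + 1) = (1 :: qpoly)"
      unfolding Const_of_nat[symmetric] Const_mult[symmetric] by (simp del: of_nat_Suc of_nat_add)
    then show ?thesis unfolding c'_def lead_Z mult.assoc by simp
  qed
  have r_eq: "r = c' * z + (\<Sum>j<n - 2. d j * y ^ j)"
    unfolding c(3) z_sum n1 sum.lessThan_Suc
    by (simp add: d_def distrib_left left_diff_distrib sum_subtractf sum_distrib_left mult.assoc[symmetric] lead)
  then have "scale r e = scale c' (scale z e) + (\<Sum>j<n - 2. scale (d j) (scale (y ^ j) e))"
  proof -
    have "scale (sum f A) e = (\<Sum>j\<in>A. scale (f j) e)" for f :: "nat \<Rightarrow> qpoly" and A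
      by (induction A rule: infinite_finite_induct) (auto simp: scale_add_left)
    then show ?thesis unfolding r_eq by (simp add: scale_add_left)
  qed
  moreover have "reached i (k0 + k) (scale c' (scale z e))"
    by (rule reached_scale[OF z c']) simp
  moreover have "reached i (k0 + k) (scale (d j) (scale (y ^ j) e))" if "j < n - 2" for j
    by (rule reached_scale[OF gens[OF that] d[OF that]]) simp
  ultimately show ?thesis by (auto intro!: reached_add reached_sum)
qed

lemma reached_Rem_powers:
  assumes gens: "\<And>j. j < n - 2 \<Longrightarrow> reached i (k0 + 2 * int j + 2) (scale (y ^ Suc j) e)"
    and one: "reached i k0 e" and r: "r \<in> Rem" "homogeneous r k"
  shows "reached i (k0 + k) (scale r e)"
proof -
  obtain c where c: "\<And>i. c i \<in> pring V4" "\<And>i. homogeneous (c i) (k - int i * 2)" "r = (\<Sum>i<n - 1. c i * y ^ i)"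
    using Rem_homogeneous[OF r] by blast
  have n1: "n - 1 = Suc (n - 2)" using n by simp
  have "scale (sum f A) e = (\<Sum>j\<in>A. scale (f j) e)" for f :: "nat \<Rightarrow> qpoly" and A
    by (induction A rule: infinite_finite_induct) (auto simp: scale_add_left)
  then have "scale r e = scale (c 0) e + (\<Sum>j<n - 2. scale (c (Suc j)) (scale (y ^ Suc j) e))"
    unfolding c(3) n1 sum.lessThan_Suc_shift by (simp add: scale_add_left)
  moreover have "reached i (k0 + k) (scale (c 0) e)"
    by (rule reached_scale[OF one c(1,2)]) simp
  moreover have "reached i (k0 + k) (scale (c (Suc j)) (scale (y ^ Suc j) e))" if "j < n - 2" for j
    by (rule reached_scale[OF gens[OF that] c(1,2)]) simp
  ultimately show ?thesis by (auto intro!: reached_add reached_sum)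
qed

lemma in_basis_target: "Inl (p, q) \<in> basis target" "j < n - 2 \<Longrightarrow> Inr (int j, p, q) \<in> basis target"
  unfolding basis_target int_interval by auto

text \<open>The generators of this component need no corrections: y^j e_11 is an image, and the
  images of (1, 0) and (0, 1) in Gamma_2 add up to - z e_11. All of R[x_5] is covered, since the
  other components use it for \<open>u\<close> and y^j t, which need not be remainders.\<close>

lemma reached_11:
  assumes "s \<in> pring V5" "homogeneous s k"
  shows "reached 1 (5 - 3 * int n + k) (quad 0 0 0 s)"
proof -
  interpret division "pring V4" "pring V5" Rem A4 "2 * int n - 2" V5 by (rule division_A4)
  have gens: "reached 1 (5 - 3 * int n + 2 * int j) (scale (y ^ j) (quad 0 0 0 1))" if "j < n - 2" for j
    using reached_embed[OF in_basis_target(2)[OF that, of 1 1] refl refl]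
    by (simp add: embed_simps par_target bdeg_target quad_arith algebra_simps)
  have "reached 1 (1 - int n) (- (\<psi> (Inl (1, 0)) + \<psi> (Inl (0, 1))))"
    by (intro reached_uminus reached_add reached_embed in_basis_target) (simp_all add: par_target bdeg_target)
  then have z: "reached 1 (5 - 3 * int n + (2 * int n - 4)) (scale z (quad 0 0 0 1))"
    by (simp add: embed_simps quad_arith algebra_simps)
  let ?r = "s - A4 * quot s"
  have "homogeneous (A4 * quot s) k"
    by (rule homogeneous_mult'[OF A_hom(3) quot_homogeneous[OF assms]]) simp
  then have "homogeneous ?r k" using assms(2) by blast
  then have "reached 1 (5 - 3 * int n + k) (scale ?r (quad 0 0 0 1))"
    using quot(2)[OF assms(1)] by (intro reached_Rem_z[OF gens z])
  then show ?thesis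
  proof (rule reached_mod_K)
    show "quad 0 0 0 s - scale ?r (quad 0 0 0 1) \<in> K"
      using quot(1)[OF assms(1)] by (auto simp: K_iff quad_arith lookup_quad)
  qed
qed

text \<open>e_00 and y^(j+1) e_00 are images up to multiples of e_11, which
  \<open>reached_11\<close> supplies.\<close>

lemma reached_00:
  assumes "r \<in> Rem" "homogeneous r k"
  shows "reached 1 (1 - int n + k) (scale r (quad 1 0 0 0))"
proof (rule reached_Rem_powers[OF _ _ assms])
  have "reached 1 (1 - int n) (\<psi> (Inl (0, 1)) - quad 0 0 0 u)"
    using reached_11[OF mem(2) hom(2)]
    by (intro reached_diff reached_embed in_basis_target) (simp_all add: par_target bdeg_target algebra_simps)
  then show "reached 1 (1 - int n) (quad 1 0 0 0)" by (simp add: embed_simps quad_arith)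
  fix j assume j: "j < n - 2"
  have "homogeneous (y ^ j * t) (2 * int n - 2 + 2 * int j)"
    by (rule homogeneous_mult'[OF homogeneous_power[OF A_hom(4)] hom(1)]) simp
  from reached_11[OF _ this]
  have "reached 1 (5 - 3 * int n + (2 * int n - 2 + 2 * int j)) (quad 0 0 0 (y ^ j * t))"
    using mems mem by blast
  then have "reached 1 (3 - int n + 2 * int j) (\<psi> (Inr (int j, 0, 0)) - quad 0 0 0 (y ^ j * t))"
    using j by (intro reached_diff reached_embed in_basis_target) (simp_all add: par_target bdeg_target algebra_simps)
  then show "reached 1 (1 - int n + 2 * int j + 2) (scale (y ^ Suc j) (quad 1 0 0 0))"
    by (simp add: embed_simps quad_arith algebra_simps)
qed

lemma reached_01_one: "reached 0 (2 - 2 * int n) (quad 0 0 1 0)"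
  using reached_embed[OF in_basis_target(1)[of 1 1] refl refl] by (simp add: embed_simps par_target bdeg_target algebra_simps)

text \<open>y^(j+1) e_01 is minus the sum of the images of (0, 1) and (1, 0) in the copy j of
  Gamma_1.\<close>

lemma reached_01:
  assumes "r \<in> Rem" "homogeneous r k"
  shows "reached 0 (2 - 2 * int n + k) (scale r (quad 0 0 1 0))"
proof (rule reached_Rem_powers[OF _ reached_01_one assms])
  fix j assume j: "j < n - 2"
  then have "reached 0 (4 - 2 * int n + 2 * int j) (- (\<psi> (Inr (int j, 0, 1)) + \<psi> (Inr (int j, 1, 0))))"
    by (intro reached_uminus reached_add reached_embed in_basis_target) (simp_all add: par_target bdeg_target algebra_simps)
  then show "reached 0 (2 - 2 * int n + 2 * int j + 2) (scale (y ^ Suc j) (quad 0 0 1 0))"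
    by (simp add: embed_simps quad_arith algebra_simps)
qed

text \<open>z e_10 is the image of the generator (0, 0) of Gamma_2 minus v e_01, and the latter is
  attained because \<open>v\<close> lies in R.\<close>

lemma reached_10:
  assumes "r \<in> Rem" "homogeneous r k"
  shows "reached 0 (4 - 2 * int n + k) (scale r (quad 0 1 0 0))"
proof (rule reached_Rem_z[OF _ _ assms])
  fix j assume j: "j < n - 2"
  then have "reached 0 (4 - 2 * int n + 2 * int j) (- \<psi> (Inr (int j, 1, 0)))"
    by (intro reached_uminus reached_embed in_basis_target) (simp_all add: par_target bdeg_target algebra_simps)
  then show "reached 0 (4 - 2 * int n + 2 * int j) (scale (y ^ j) (quad 0 1 0 0))"
    by (simp add: embed_simps quad_arith)
next
  have "reached 0 0 (scale v (quad 0 0 1 0))"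
    by (rule reached_scale[OF reached_01_one mem(3) hom(3)]) simp
  then have "reached 0 0 (\<psi> (Inl (0, 0)) - scale v (quad 0 0 1 0))"
    by (intro reached_diff reached_embed in_basis_target) (simp_all add: par_target bdeg_target)
  then show "reached 0 (4 - 2 * int n + (2 * int n - 4)) (scale z (quad 0 1 0 0))"
    by (simp add: embed_simps quad_arith)
qed

definition flip3 :: "bit \<times> bit \<times> bit \<Rightarrow> bit \<times> bit \<times> bit" where
  "flip3 b = (fst b, fst (snd b), snd (snd b) + 1)"

text \<open>\<open>Q\<close> consists of the generators with last index 1, which \<open>A4\<close>
  enters from last index 0. The sign \<open>\<epsilon>\<close> is the one the last tensor factor
  receives from the parities of the first two.\<close>

lemma hequiv_reduced_target: "hequiv n V4 C_reduced target"
proof (rule hequiv_elimination[where Q = "{b. snd (snd b) = 1}" and \<tau> = flip3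
      and \<epsilon> = "\<lambda>b. if fst b + fst (snd b) = 0 then 1 else - 1"
      and S = "pring V5" and Rem = Rem and \<beta> = A4 and e = "2 * int n - 2" and w = w and \<Psi> = "lin \<psi>" and K = K])
  show "division (pring V4) (pring V5) Rem A4 (2 * int n - 2) (bvars C_reduced)"
    unfolding bvars_reduced by (rule division_A4)
  show "bfact_ok n w C_reduced" "bfact_ok n w target" by (rule bfact_ok_reduced bfact_ok_target)+
  show "basis C_reduced = UNIV" by (simp add: C_reduced_def)
  show "V4 \<subseteq> bvars C_reduced" "V4 \<subseteq> bvars target" by (auto simp: bvars_reduced bvars_target)
  show "w \<in> pring V4" unfolding w_def by (intro pring_add pring_diff pring_power pring_X) auto
  show "flip3 (flip3 b) = b" for b by (simp add: flip3_def)
  show "(flip3 b \<in> {b. snd (snd b) = 1}) = (b \<notin> {b. snd (snd b) = 1})" for b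
    using bit_cases[of "snd (snd b)"] by (auto simp: flip3_def)
  show "par C_reduced (flip3 b) = par C_reduced b + 1" for b
    by (cases b) (simp add: C_reduced_def flip3_def ac_simps)
  show "bdeg C_reduced b + (2 * int n - 2) = bdeg C_reduced (flip3 b) + int n + 1" if "b \<in> {b. snd (snd b) = 1}" for b
    using that by (cases b) (simp add: C_reduced_def flip3_def)
  show "(if fst b + fst (snd b) = 0 then 1 else - 1 :: qpoly) = 1 \<or> (if fst b + fst (snd b) = 0 then 1 else - 1 :: qpoly) = - 1"
    for b :: "bit \<times> bit \<times> bit"
    by simp
  show "Poly_Mapping.lookup (lin (bdiff C_reduced) x) b = (if fst b + fst (snd b) = 0 then 1 else - 1) * A4 * Poly_Mapping.lookup x (flip3 b)"
    if xQ: "\<And>b. b \<in> {b. snd (snd b) = 1} \<Longrightarrow> Poly_Mapping.lookup x b = 0" and bQ: "b \<in> {b. snd (snd b) = 1}" for x b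
  proof -
    obtain p q where b: "b = (p, q, 1)" using bQ by (cases b) auto
    have "Poly_Mapping.lookup x (p', q', 1) = 0" for p' q' using xQ[of "(p', q', 1)"] by simp
    then show ?thesis
      using bit_cases[of p] bit_cases[of q]
      unfolding b lookup_bdiff C_reduced_def by (auto simp: dop_tensor dop_rank1_fact flip3_def)
  qed
  show "K = {x. \<forall>b\<in>{b. snd (snd b) = 1}. \<exists>s\<in>pring V5. Poly_Mapping.lookup x b = A4 * s}" by (rule K_def)
  have sub: "bvars target \<subseteq> bvars C_reduced" by (auto simp: bvars_reduced bvars_target)
  show "blin V4 target C_reduced i i 0 (lin \<psi>)" for i
    unfolding blin_def
  proof (intro conjI ballI allI)
    have \<psi>: "\<psi> b \<in> bgrade C_reduced (par target b + 0) (bdeg target b + 0)" if "b \<in> basis target" for b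
      using embed_bgrade[OF that] by simp
    show "lin \<psi> x \<in> bcar C_reduced i" if "x \<in> bcar target i" for x
      using lin_bcar[OF bgrade_bcar[OF \<psi>] sub that] by simp
    show "lin \<psi> x \<in> bgrade C_reduced i (l + 0)" if "x \<in> bgrade target i l" for x l
      using lin_bgrade[OF \<psi> sub that] by simp
  qed (simp_all add: lin_add lin_scale)
  show "lin (bdiff C_reduced) (lin \<psi> x) - lin \<psi> (lin (bdiff target) x) \<in> K" if x: "x \<in> bcar target i" for i x
  proof -
    have "lin (bdiff C_reduced) (lin \<psi> x) - lin \<psi> (lin (bdiff target) x) =
        lin (\<lambda>b. lin (bdiff C_reduced) (\<psi> b) - lin \<psi> (bdiff target b)) x"
      by (simp add: lin_lin lin_diff_fun)
    also have "\<dots> \<in> K"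
      unfolding lin_def[of _ x] using bcar_lookup[OF x] V45
      by (intro K_sum K_scale embed_bdiff) (simp add: bvars_target)
    finally show ?thesis .
  qed
  show "\<exists>m\<in>bgrade target (par C_reduced b) (k + bdeg C_reduced b). Poly_Mapping.single b r - lin \<psi> m \<in> K"
    if bQ: "b \<in> {b. snd (snd b) = 1}" and r: "r \<in> Rem" "homogeneous r k" "r \<in> pring V5" for k b r
  proof -
    obtain p q where b: "b = (p, q, 1)" using bQ by (cases b) auto
    have s: "Poly_Mapping.single (0, 0, 1) r = scale r (quad 1 0 0 0)" "Poly_Mapping.single (1, 0, 1) r = scale r (quad 0 1 0 0)"
      "Poly_Mapping.single (0, 1, 1) r = scale r (quad 0 0 1 0)" "Poly_Mapping.single (1, 1, 1) r = quad 0 0 0 r"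
      by (simp_all add: quad_arith quad_def)
    have "reached (par C_reduced b) (k + bdeg C_reduced b) (Poly_Mapping.single b r)"
      using bit_cases[of p] bit_cases[of q] reached_00[OF r(1,2)] reached_01[OF r(1,2)] reached_10[OF r(1,2)] reached_11[OF r(3,2)]
      unfolding b by (auto simp: s C_reduced_def algebra_simps)
    then show ?thesis by (simp add: reached_def)
  qed
  show "x = 0" if "x \<in> bcar target i" "lin \<psi> x \<in> K" for i x using embed_inj[OF that] .
qed

end

context square
begin

lemma hmf_iso_square: "hmf_iso n V4 w (fact_of (C_square n)) (fact_of target)"
proof (rule hmf_iso_of_hequiv)
  obtain t u v where "square_data n t u v"
    using square_identities by (metis square_axioms square_data.intro square_data_axioms.intro)
  then have "hequiv n V4 C_reduced target" by (rule square_data.hequiv_reduced_target)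
  then show "hequiv n V4 (C_square n) target"
    by (rule hequiv_trans[OF hequiv_square_reduced _ bfact_ok_square bfact_ok_reduced bfact_ok_target])
  show "bfact_ok n w (C_square n)" "bfact_ok n w target" by (rule bfact_ok_square bfact_ok_target)+
  show "w \<in> pring V4" unfolding w_def by (intro pring_add pring_diff pring_power pring_X) auto
  show "V4 \<subseteq> bvars (C_square n)" unfolding C_square_eq by auto
  show "bvars target = V4" by (rule bvars_target)
  show "finite (basis target)" by (rule finite_basis_target)
qed

end

theorem proposition31:
  fixes n :: nat
  assumes "n \<ge> 2"
  shows "hmf_iso n {1, 2, 3, 4}
    (X 1 ^ (n + 1) - X 2 ^ (n + 1) + X 3 ^ (n + 1) - X 4 ^ (n + 1))
    (fact_of (C_square n))
    (fact_of (C_arcs2 n \<oplus>\<^sub>f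
      dsum_family {0..int n - 3}
        (\<lambda>i. grade_shift (3 - int n + 2 * i) (parity_shift (C_arcs1 n)))))"
proof -
  interpret square n by standard (rule assms)
  show ?thesis using hmf_iso_square unfolding w_def target_def .
qed

end
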